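(* Fix a point $x_0\in\mathcal{M}$, and let $[a,b]$ denote the largest interval $I$ containing $x_0$ such that $\widehat F_0$ is linear on $I$. Let $\mathbb{U}$ denote a standard Brownian bridge process on $[0,1]$, and let $\mathbb{U}_{F_0}(x)=\mathbb{U}(F_0(x))$ for $x\in\mathcal{S}_0$. Then, as $n\to\infty$, $$\sqrt{n}\,\bigl(\hat f_n(x_0)-\hat f_0(x_0)\bigr)\Rightarrow \operatorname{gren}_{[a,b]}\bigl(\mathbb{U}^{\mathrm{mod}}_{F_0}\bigr)(x_0),$$ where $$\mathbb{U}^{\mathrm{mod}}_{F_0}(u)=\begin{cases}\mathbb{U}_{F_0}(u), & u\in[a,b]\cap\mathcal{W},\\ -\infty, & u\in[a,b]\cap\mathcal{M}.\end{cases}$$ If it happens that $[a,b]\cap\mathcal{W}=\{a,b\}$, then $$\sqrt{n}\,\bigl(\hat f_n(x_0)-\hat f_0(x_0)\bigr)\Rightarrow \sigma Z,$$ where $Z$ is a standard normal random variable and $$\sigma^2=\hat f_0(x_0)\Bigl[\frac{1}{b-a}-\hat f_0(x_0)\Bigr].$$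
   Context: Let $f_0$ be a probability density on $[0,\infty)$ with support $\mathcal{S}_0$ and cumulative distribution function $F_0(x)=\int_0^x f_0(u)\,du$. Let $\widehat F_0$ be the least concave majorant of $F_0$ and $\hat f_0$ its left derivative (the Kullback--Leibler projection of $f_0$ onto decreasing densities). $f_0$ need not be decreasing. Put $\mathcal{M}=\{x\ge 0:\widehat F_0(x)>F_0(x)\}$ and $\mathcal{W}=\{x\ge 0:\widehat F_0(x)=F_0(x)\}$. $X_1,\dots,X_n$ are i.i.d. with density $f_0$, $\mathbb{F}_n(x)=n^{-1}\sum_{i=1}^n 1_{(-\infty,x]}(X_i)$ is the empirical distribution function, and $\hat f_n$ is the Grenander estimator: the maximizer of $\int\log g\,d\mathbb{F}_n$ over all decreasing densities $g$ on $[0,\infty)$, equivalently the left derivative of the least concave majorant of $\mathbb{F}_n$. For a function $g$ (possibly taking the value $-\infty$), $\operatorname{gren}_{[a,b]}(g)$ denotes the left derivative of the least concave majorant of $g$ restricted to $[a,b]$. $\Rightarrow$ denotes convergence in distribution. *)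

theory Defs
  imports "HOL-Probability.Probability"
begin

section \<open>Least concave majorants and their left derivatives\<close>

text \<open>
  The function \<^term>\<open>g\<close> may take the value \<^term>\<open>-\<infinity> :: ereal\<close>, and only its values on
  \<^term>\<open>I\<close> matter. The pointwise infimum of all concave majorants is again a concave majorant
  (see the lemmas below), hence the least one.
\<close>

definition concave_majorants :: "real set \<Rightarrow> (real \<Rightarrow> ereal) \<Rightarrow> (real \<Rightarrow> real) set" where
  "concave_majorants I g = {h. concave_on I h \<and> (\<forall>u\<in>I. g u \<le> ereal (h u))}"

definition least_concave_majorant :: "real set \<Rightarrow> (real \<Rightarrow> ereal) \<Rightarrow> real \<Rightarrow> real" where
  "least_concave_majorant I g x = (INF h\<in>concave_majorants I g. h x)"

lemma least_concave_majorant_least: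
  assumes "bdd_below ((\<lambda>h. h x) ` concave_majorants I g)" "h \<in> concave_majorants I g"
  shows "least_concave_majorant I g x \<le> h x"
  unfolding least_concave_majorant_def using assms by (rule cINF_lower)

lemma least_concave_majorant_in_concave_majorants:
  assumes ne: "concave_majorants I g \<noteq> {}"
    and bdd: "\<And>x. x \<in> I \<Longrightarrow> bdd_below ((\<lambda>h. h x) ` concave_majorants I g)"
  shows "least_concave_majorant I g \<in> concave_majorants I g"
proof -
  let ?L = "least_concave_majorant I g"
  have "concave_on I ?L"
    unfolding concave_on_iff
  proof (intro conjI ballI allI impI)
    show "convex I"
      using ne by (auto simp: concave_majorants_def concave_on_iff)
    fix x y u v :: real
    assume xy: "x \<in> I" "y \<in> I" and uv: "0 \<le> u" "0 \<le> v" "u + v = 1"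
    show "u * ?L x + v * ?L y \<le> ?L (u *\<^sub>R x + v *\<^sub>R y)"
      unfolding least_concave_majorant_def[of I g "u *\<^sub>R x + v *\<^sub>R y"]
    proof (rule cINF_greatest[OF ne])
      fix h assume h: "h \<in> concave_majorants I g"
      have "u * ?L x + v * ?L y \<le> u * h x + v * h y"
        using least_concave_majorant_least[OF bdd h] xy uv by (intro add_mono mult_left_mono) auto
      also have "\<dots> \<le> h (u *\<^sub>R x + v *\<^sub>R y)"
        using h xy uv by (auto simp: concave_majorants_def concave_on_iff)
      finally show "u * ?L x + v * ?L y \<le> h (u *\<^sub>R x + v *\<^sub>R y)" .
    qed
  qed
  moreover have "g u \<le> ereal (?L u)" if "u \<in> I" for u
  proof (cases "g u")
    case (real r)
    then have "r \<le> ?L u"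
      unfolding least_concave_majorant_def using that
      by (intro cINF_greatest[OF ne]) (force simp: concave_majorants_def)
    with real show ?thesis by simp
  next
    case PInf
    with ne that show ?thesis by (auto simp: concave_majorants_def)
  qed simp
  ultimately show ?thesis by (simp add: concave_majorants_def)
qed

definition left_deriv :: "(real \<Rightarrow> real) \<Rightarrow> real \<Rightarrow> real" where
  "left_deriv f x = vector_derivative f (at_left x)"

definition gren :: "real set \<Rightarrow> (real \<Rightarrow> ereal) \<Rightarrow> real \<Rightarrow> real" where
  "gren I g = left_deriv (least_concave_majorant I g)"

section \<open>The density and its projection onto decreasing densities\<close>

text \<open>A density on the half-line \<open>[0, \<infinity>)\<close> is extended by \<open>0\<close> to the negative reals.\<close>

definition halfline_density :: "(real \<Rightarrow> real) \<Rightarrow> bool" where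
  "halfline_density f \<longleftrightarrow>
     f \<in> borel_measurable borel \<and> (\<forall>x. 0 \<le> f x) \<and> (\<forall>x<0. f x = 0) \<and>
     has_bochner_integral lborel f 1"

definition distr_fun :: "(real \<Rightarrow> real) \<Rightarrow> real \<Rightarrow> real" where
  "distr_fun f x = (LINT u:{0..x}|lborel. f u)"

definition distr_fun_lcm :: "(real \<Rightarrow> real) \<Rightarrow> real \<Rightarrow> real" where
  "distr_fun_lcm f = least_concave_majorant {0..} (\<lambda>x. ereal (distr_fun f x))"

definition proj_density :: "(real \<Rightarrow> real) \<Rightarrow> real \<Rightarrow> real" where
  "proj_density f = left_deriv (distr_fun_lcm f)"

definition misspec_set :: "(real \<Rightarrow> real) \<Rightarrow> real set" where
  "misspec_set f = {x. 0 \<le> x \<and> distr_fun_lcm f x > distr_fun f x}"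

definition wellspec_set :: "(real \<Rightarrow> real) \<Rightarrow> real set" where
  "wellspec_set f = {x. 0 \<le> x \<and> distr_fun_lcm f x = distr_fun f x}"

text \<open>``Linear on an interval'' means affine: the graph over the interval lies on a line.\<close>

definition linear_on_set :: "real set \<Rightarrow> (real \<Rightarrow> real) \<Rightarrow> bool" where
  "linear_on_set I F \<longleftrightarrow> (\<exists>c d. \<forall>x\<in>I. F x = c + d * x)"

definition largest_linear_interval :: "(real \<Rightarrow> real) \<Rightarrow> real \<Rightarrow> real set \<Rightarrow> bool" where
  "largest_linear_interval F x I \<longleftrightarrow>
     (is_interval I \<and> I \<subseteq> {0..} \<and> x \<in> I \<and> linear_on_set I F) \<and>
     (\<forall>J. is_interval J \<and> J \<subseteq> {0..} \<and> x \<in> J \<and> linear_on_set J F \<longrightarrow> J \<subseteq> I)"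

section \<open>The Grenander estimator\<close>

text \<open>The sample of size \<open>n\<close> is \<open>X 0 \<omega>, \<dots>, X (n - 1) \<omega>\<close>. The estimator is taken in its
  left-derivative form, which also fixes the version of the maximum likelihood estimator of a
  decreasing density at every point of \<open>(0, \<infinity>)\<close>.\<close>

definition emp_distr_fun :: "(nat \<Rightarrow> 'a \<Rightarrow> real) \<Rightarrow> nat \<Rightarrow> 'a \<Rightarrow> real \<Rightarrow> real" where
  "emp_distr_fun X n \<omega> x = (\<Sum>i<n. indicator {..x} (X i \<omega>)) / real n"

definition grenander :: "(nat \<Rightarrow> 'a \<Rightarrow> real) \<Rightarrow> nat \<Rightarrow> 'a \<Rightarrow> real \<Rightarrow> real" where
  "grenander X n \<omega> = gren {0..} (\<lambda>x. ereal (emp_distr_fun X n \<omega> x))"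

section \<open>Brownian bridge\<close>

text \<open>The degenerate case \<open>\<sigma> = 0\<close>, a point mass at \<open>\<mu>\<close>, is included.\<close>

definition normal_law :: "real \<Rightarrow> real \<Rightarrow> real measure" where
  "normal_law \<mu> \<sigma> = distr std_normal_distribution borel (\<lambda>z. \<mu> + \<sigma> * z)"

definition gaussian_process :: "'b measure \<Rightarrow> real set \<Rightarrow> (real \<Rightarrow> 'b \<Rightarrow> real) \<Rightarrow> bool" where
  "gaussian_process N T U \<longleftrightarrow>
     (\<forall>t\<in>T. U t \<in> borel_measurable N) \<and>
     (\<forall>J c. finite J \<and> J \<subseteq> T \<longrightarrow>
        (\<exists>\<mu> \<sigma>. distr N borel (\<lambda>\<omega>. \<Sum>t\<in>J. c t * U t \<omega>) = normal_law \<mu> \<sigma>))"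

text \<open>All sample paths are continuous, so that functionals of the path are measurable without
  completing the probability space.\<close>

definition standard_brownian_bridge :: "'b measure \<Rightarrow> (real \<Rightarrow> 'b \<Rightarrow> real) \<Rightarrow> bool" where
  "standard_brownian_bridge N U \<longleftrightarrow>
     prob_space N \<and> gaussian_process N {0..1} U \<and>
     (\<forall>\<omega>\<in>space N. continuous_on {0..1} (\<lambda>t. U t \<omega>)) \<and>
     (\<forall>t\<in>{0..1}. (\<integral>\<omega>. U t \<omega> \<partial>N) = 0) \<and>
     (\<forall>s\<in>{0..1}. \<forall>t\<in>{0..1}. (\<integral>\<omega>. U s \<omega> * U t \<omega> \<partial>N) = min s t - s * t)"

text \<open>Used on an interval \<open>[a, b]\<close> inside the half-line; there \<^term>\<open>misspec_set f\<close> is the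
  complement of \<^term>\<open>wellspec_set f\<close>. The composition \<open>U (F\<^sub>0 x)\<close> is formed for every \<open>x \<ge> 0\<close>
  rather than only on the support of the density, because the left endpoint \<open>a = 0\<close> need not
  lie in the support.\<close>

definition mod_bridge ::
    "(real \<Rightarrow> real) \<Rightarrow> (real \<Rightarrow> 'b \<Rightarrow> real) \<Rightarrow> 'b \<Rightarrow> real \<Rightarrow> ereal" where
  "mod_bridge f U \<omega> u =
     (if u \<in> wellspec_set f then ereal (U (distr_fun f u) \<omega>) else -\<infinity>)"

end

theory Submission
  imports Defs
begin

text \<open>
  Let \<open>l\<close> be the line extending the linear piece of the majorant of \<open>F\<close> on \<open>[a, b]\<close>. The error
  \<open>sqrt n * (grenander - s)\<close> is the slope at \<open>x0\<close> of the least concave majorant of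
  \<open>sqrt n * (Fn - F) - sqrt n * (l - F)\<close>, whose second term vanishes on the compact contact set
  \<open>K\<close> of \<open>F\<close> and \<open>l\<close> and penalizes all other points more and more. By equicontinuity of the
  empirical process, this slope is uniformly close to a min-max formula evaluated on a finite
  net of \<open>K\<close>, because a line that nearly touches on both sides of the gap of \<open>K\<close> around \<open>x0\<close>
  determines the slope up to a small error. The min-max formula is a continuous function of finitely
  many coordinates, so the Cramer-Wold device applies. The same approximation holds for the
  bridge; when \<open>K = {a, b}\<close> the formula is a difference quotient and the
  one-dimensional central limit theorem suffices, without any bridge.
\<close>

section \<open>Slopes of least concave majorants\<close>

text \<open>Only a density is assumed, so \<open>F\<close> may be flat or irregular between contact
  points. The chaining therefore runs over dyadic quantiles, and equicontinuity is measured by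
  distances of \<open>F\<close>-values; these become ordinary distances only near
  \<open>{a..b}\<close>, where \<open>F\<close> is uniformly continuous. With second moments the
  union bound over the \<open>2 ^ j\<close> cells of level \<open>j\<close>, each of mass
  \<open>1 / 2 ^ j\<close>, would not be summable. Fourth moments gain another factor
  \<open>1 / 2 ^ j\<close>, up to a correction of order \<open>1 / n\<close> that stops the
  refinement at cells of mass about \<open>1 / n\<close>; below this scale monotonicity of the
  empirical distribution function takes over. The half-line is not compact: far out,
  \<open>F \<le> 1\<close> loses against a line of positive slope, so the penalty grows linearly in
  \<open>u\<close>. In the Cramer-Wold step, bounded continuous test functions are replaced by
  trigonometric sums, whose integrals the one-dimensional central limit theorem controls, with
  second moments supplying tightness. How fine a net must be for the bridge depends on the path, so
  its limit is taken along one fixed sequence of nets.\<close>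

lemma concave_on_left_deriv:
  assumes L: "concave_on I L" and x: "x \<in> interior I"
  shows "(L has_vector_derivative left_deriv L x) (at_left x)"
    and "\<And>u. u \<in> I \<Longrightarrow> u < x \<Longrightarrow> left_deriv L x \<le> (L x - L u) / (x - u)"
    and "\<And>v. v \<in> I \<Longrightarrow> x < v \<Longrightarrow> (L v - L x) / (v - x) \<le> left_deriv L x"
proof -
  define \<phi> where "\<phi> u = (L x - L u) / (x - u)" for u
  define D where "D = Inf (\<phi> ` (I \<inter> {..<x}))"
  obtain e where e: "e > 0" "ball x e \<subseteq> I"
    using x by (auto simp: mem_interior)
  have xI: "x \<in> I" using e by auto
  have cI: "convex I" using L by (simp add: concave_on_def convex_on_imp_convex)
  have conv: "convex_on I (\<lambda>x. - L x)" using L by (simp add: concave_on_def)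
  have left: "x - e/2 \<in> I" using e by (auto simp: dist_real_def)
  have right: "x + e/2 \<in> I" using e by (auto simp: dist_real_def)
  have lr: "(L v - L x) / (v - x) \<le> \<phi> u" if "u \<in> I" "u < x" "v \<in> I" "x < v" for u v
  proof -
    have "(- L u - (- L x)) / (u - x) \<le> (- L u - (- L v)) / (u - v)"
      and "(- L u - (- L v)) / (u - v) \<le> (- L x - (- L v)) / (x - v)"
      using convex_on_slope_le[OF conv that(1,3,2,4)] by auto
    then have "(- L u - (- L x)) / (u - x) \<le> (- L x - (- L v)) / (x - v)" by linarith
    moreover have "(- L u - (- L x)) / (u - x) = - \<phi> u" "(- L x - (- L v)) / (x - v) = - ((L v - L x) / (v - x))"
      using that by (simp_all add: \<phi>_def field_simps)
    ultimately show ?thesis by linarith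
  qed
  have mono: "\<phi> u' \<le> \<phi> u" if "u \<in> I" "u < u'" "u' < x" for u u'
  proof -
    have "(- L u - (- L x)) / (u - x) \<le> (- L u' - (- L x)) / (u' - x)"
      using convex_on_slope_le[OF conv that(1) xI that(2,3)] by auto
    moreover have "(- L u - (- L x)) / (u - x) = - \<phi> u" "(- L u' - (- L x)) / (u' - x) = - \<phi> u'"
      using that by (simp_all add: \<phi>_def field_simps)
    ultimately show ?thesis by linarith
  qed
  have bdd: "bdd_below (\<phi> ` (I \<inter> {..<x}))"
    using lr[OF _ _ right] e by (intro bdd_belowI[of _ "(L (x + e/2) - L x) / (x + e/2 - x)"]) auto
  have D_le: "D \<le> \<phi> u" if "u \<in> I" "u < x" for u
    unfolding D_def using that bdd by (intro cINF_lower) auto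
  have D_ge: "(L v - L x) / (v - x) \<le> D" if "v \<in> I" "x < v" for v
    unfolding D_def using that lr left e by (intro cINF_greatest) (auto intro!: exI[of _ "x - e/2"])
  have "((\<lambda>u. (L u - L x) / (u - x)) \<longlongrightarrow> D) (at_left x)"
  proof (rule tendstoI)
    fix r :: real assume "r > 0"
    have "\<exists>y\<in>\<phi> ` (I \<inter> {..<x}). y < D + r"
      using \<open>r > 0\<close> left e bdd unfolding D_def
      by (subst cInf_less_iff[symmetric]) (auto intro!: exI[of _ "x - e/2"])
    then obtain u0 where u0: "u0 \<in> I" "u0 < x" "\<phi> u0 < D + r" by auto
    have "\<forall>\<^sub>F u in at_left x. u \<in> {u0<..<x}"
      using u0 by (intro eventually_at_left_real) auto
    then show "\<forall>\<^sub>F u in at_left x. dist ((L u - L x) / (u - x)) D < r"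
    proof eventually_elim
      case (elim u)
      then have "u \<in> I"
        using cI u0(1) xI by (meson greaterThanLessThan_iff is_interval_convex_1 less_imp_le mem_is_interval_1_I)
      then have "D \<le> \<phi> u" "\<phi> u \<le> \<phi> u0" using elim D_le mono u0 by auto
      moreover have "(L u - L x) / (u - x) = \<phi> u"
        using elim by (simp add: \<phi>_def field_simps)
      ultimately show ?case using u0 \<open>r > 0\<close> by (simp add: dist_real_def)
    qed
  qed
  then have "(L has_field_derivative D) (at_left x)" by (simp add: has_field_derivative_iff)
  then have vd: "(L has_vector_derivative D) (at_left x)"
    by (simp add: has_real_derivative_iff_has_vector_derivative)
  have "left_deriv L x = D"
    unfolding left_deriv_def by (rule vector_derivative_within[OF _ vd]) simp
  then show "(L has_vector_derivative left_deriv L x) (at_left x)"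
    and "\<And>u. u \<in> I \<Longrightarrow> u < x \<Longrightarrow> left_deriv L x \<le> (L x - L u) / (x - u)"
    and "\<And>v. v \<in> I \<Longrightarrow> x < v \<Longrightarrow> (L v - L x) / (v - x) \<le> left_deriv L x"
    using vd D_le D_ge by (auto simp: \<phi>_def)
qed

text \<open>A real \<open>INF\<close> is meaningful only over a set bounded below. A concave
  function on an interval is at least the smaller of its end values, and these dominate the two
  given values of \<open>g\<close>. The points may lie away from \<open>x\<close>, since
  \<open>mod_bridge\<close> is \<open>-\<infinity>\<close> at \<open>x0\<close> itself.\<close>

lemma bdd_below_concave_majorants:
  assumes "p \<in> I" "q \<in> I" "p \<le> x" "x \<le> q" "g p \<noteq> -\<infinity>" "g q \<noteq> -\<infinity>"
  shows "bdd_below ((\<lambda>h. h x) ` concave_majorants I g)"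
proof (rule bdd_belowI2)
  fix h assume "h \<in> concave_majorants I g"
  then have h: "concave_on I h" "g p \<le> ereal (h p)" "g q \<le> ereal (h q)"
    using assms by (auto simp: concave_majorants_def)
  have fin: "real_of_ereal (g p) \<le> h p" "real_of_ereal (g q) \<le> h q"
    using h assms by (cases "g p"; cases "g q"; auto)+
  show "min (real_of_ereal (g p)) (real_of_ereal (g q)) \<le> h x"
  proof (cases "p = q")
    case True
    then show ?thesis using fin assms by auto
  next
    case False
    then have "p < q" using assms by auto
    define t where "t = (x - p) / (q - p)"
    have t: "0 \<le> t" "t \<le> 1" "(1 - t) * p + t * q = x"
    proof -
      show "0 \<le> t" "t \<le> 1" using \<open>p < q\<close> assms by (auto simp: t_def field_simps)
      have "t * (q - p) = x - p" using \<open>p < q\<close> by (simp add: t_def)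
      then show "(1 - t) * p + t * q = x" by (simp add: algebra_simps)
    qed
    have "(1 - t) * h p + t * h q \<le> h ((1 - t) *\<^sub>R p + t *\<^sub>R q)"
      using h(1) t assms by (auto simp: concave_on_iff)
    moreover have "(1 - t) * min (h p) (h q) + t * min (h p) (h q) \<le> (1 - t) * h p + t * h q"
      using t by (intro add_mono mult_left_mono) auto
    moreover have "(1 - t) * min (h p) (h q) + t * min (h p) (h q) = min (h p) (h q)"
      by (simp add: algebra_simps)
    ultimately have "min (h p) (h q) \<le> h x" using t by simp
    then show ?thesis using fin by linarith
  qed
qed

lemma affine_concave_on: "convex I \<Longrightarrow> concave_on I (\<lambda>w. \<alpha> + \<gamma> * w :: real)"
  unfolding concave_on_iff
proof (intro conjI ballI allI impI)
  fix x y u v :: real assume "0 \<le> u" "0 \<le> v" "u + v = 1"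
  then have "u * \<alpha> + v * \<alpha> = \<alpha>" by (metis distrib_right mult_1)
  then show "u * (\<alpha> + \<gamma> * x) + v * (\<alpha> + \<gamma> * y) \<le> \<alpha> + \<gamma> * (u *\<^sub>R x + v *\<^sub>R y)"
    by (simp add: algebra_simps)
qed auto

text \<open>The line bounds the majorant from above at \<open>x\<close>; the near-contacts bound it
  from below at \<open>u\<close> and \<open>v\<close>. Hence the chord slope from \<open>u\<close>
  to \<open>x\<close> exceeds \<open>\<gamma>\<close> by at most \<open>\<eta> / d\<close>, the one
  from \<open>x\<close> to \<open>v\<close> falls short by at most \<open>\<eta> / d\<close>, and
  the left derivative lies between them. The lemma serves both the half-line and
  \<open>{a..b}\<close>.\<close>

lemma gren_near_slope:
  assumes L: "least_concave_majorant I g \<in> concave_majorants I g"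
    and bdd: "bdd_below ((\<lambda>h. h x) ` concave_majorants I g)"
    and x: "x \<in> interior I" and uv: "u \<in> I" "v \<in> I" "u + d \<le> x" "x + d \<le> v" and d: "d > 0"
    and maj: "\<And>w. w \<in> I \<Longrightarrow> g w \<le> ereal (\<alpha> + \<gamma> * w)"
    and u: "ereal (\<alpha> + \<gamma> * u - \<eta>) \<le> g u" and v: "ereal (\<alpha> + \<gamma> * v - \<eta>) \<le> g v"
  shows "\<bar>gren I g x - \<gamma>\<bar> \<le> \<eta> / d"
proof -
  let ?L = "least_concave_majorant I g"
  have c: "concave_on I ?L" using L by (simp add: concave_majorants_def)
  have "convex I" using c by (simp add: concave_on_def convex_on_imp_convex)
  then have "?L x \<le> \<alpha> + \<gamma> * x"
    using maj by (intro least_concave_majorant_least[OF bdd, of "\<lambda>w. \<alpha> + \<gamma> * w"])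
      (auto simp: concave_majorants_def affine_concave_on)
  have Lu: "\<alpha> + \<gamma> * u - \<eta> \<le> ?L u"
    using L uv order_trans[OF u, of "ereal (?L u)"] by (auto simp: concave_majorants_def)
  have Lv: "\<alpha> + \<gamma> * v - \<eta> \<le> ?L v"
    using L uv order_trans[OF v, of "ereal (?L v)"] by (auto simp: concave_majorants_def)
  have "ereal (\<alpha> + \<gamma> * u - \<eta>) \<le> ereal (\<alpha> + \<gamma> * u)"
    using u maj[OF uv(1)] by (rule order_trans)
  then have \<eta>: "\<eta> \<ge> 0" by simp
  have "gren I g x \<le> (?L x - ?L u) / (x - u)"
    unfolding gren_def using uv d by (intro concave_on_left_deriv[OF c x]) auto
  also have "\<dots> \<le> (\<gamma> * (x - u) + \<eta>) / (x - u)"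
    using Lu \<open>?L x \<le> _\<close> uv d by (intro divide_right_mono) (auto simp: algebra_simps)
  also have "\<dots> = \<gamma> + \<eta> / (x - u)" using uv d by (simp add: field_simps)
  also have "\<dots> \<le> \<gamma> + \<eta> / d" using uv d \<eta> by (auto intro!: divide_left_mono mult_pos_pos)
  finally have 1: "gren I g x \<le> \<gamma> + \<eta> / d" .
  have "\<gamma> - \<eta> / d \<le> \<gamma> - \<eta> / (v - x)" using uv d \<eta> by (auto intro!: divide_left_mono mult_pos_pos)
  also have "\<dots> = (\<gamma> * (v - x) - \<eta>) / (v - x)" using uv d by (simp add: field_simps)
  also have "\<dots> \<le> (?L v - ?L x) / (v - x)"
    using Lv \<open>?L x \<le> _\<close> uv d by (intro divide_right_mono) (auto simp: algebra_simps)
  also have "\<dots> \<le> gren I g x"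
    unfolding gren_def using uv d by (intro concave_on_left_deriv[OF c x]) auto
  finally show ?thesis using 1 by linarith
qed

section \<open>The linear pieces of the majorant of a distribution function\<close>

text \<open>The concavity inequality cleared of denominators, so that any of the three values can be
  the one to be estimated.\<close>

lemma concave_on_three_points:
  fixes L :: "real \<Rightarrow> real"
  assumes "concave_on I L" "p \<in> I" "w \<in> I" "p \<le> z" "z \<le> w"
  shows "(w - z) * L p + (z - p) * L w \<le> (w - p) * L z"
proof (cases "p = w")
  case True then show ?thesis using assms by simp
next
  case False
  then have "p < w" using assms by simp
  define t where "t = (z - p) / (w - p)"
  have t: "0 \<le> t" "t \<le> 1" "t * (w - p) = z - p"
    using assms \<open>p < w\<close> by (auto simp: t_def)
  have z: "(1 - t) * p + t * w = z" using t(3) by (simp add: algebra_simps)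
  have "(1 - t) * L p + t * L w \<le> L ((1 - t) *\<^sub>R p + t *\<^sub>R w)"
    using assms t by (auto simp: concave_on_iff)
  then have "(1 - t) * L p + t * L w \<le> L z" using z by simp
  then have "(w - p) * ((1 - t) * L p + t * L w) \<le> (w - p) * L z"
    using \<open>p < w\<close> by simp
  moreover have "(w - p) * ((1 - t) * L p + t * L w) = (w - p) * L p - (t * (w - p)) * L p + (t * (w - p)) * L w"
    by (simp add: algebra_simps)
  ultimately show ?thesis unfolding t(3) by (simp add: algebra_simps)
qed

lemma concave_on_chord:
  fixes L :: "real \<Rightarrow> real"
  assumes L: "concave_on I L" and pq: "p \<in> I" "q \<in> I" "p < q"
    and eq: "L p = c + s * p" "L q = c + s * q" and w: "w \<in> I"
  shows "w \<in> {p..q} \<Longrightarrow> c + s * w \<le> L w"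
    and "w \<notin> {p<..<q} \<Longrightarrow> L w \<le> c + s * w"
proof -
  assume "w \<in> {p..q}"
  then have "(q - w) * L p + (w - p) * L q \<le> (q - p) * L w"
    using concave_on_three_points[OF L, of p q w] pq by auto
  then have "(q - p) * (c + s * w) \<le> (q - p) * L w"
    unfolding eq by (simp add: algebra_simps)
  then show "c + s * w \<le> L w" using pq by simp
next
  assume "w \<notin> {p<..<q}"
  then consider "w \<le> p" | "q \<le> w" by force
  then show "L w \<le> c + s * w"
  proof cases
    case 1
    then have "(q - p) * L w + (p - w) * L q \<le> (q - w) * L p"
      using concave_on_three_points[OF L, of w q p] pq w by auto
    then have "(q - p) * L w \<le> (q - p) * (c + s * w)"
      unfolding eq by (simp add: algebra_simps)
    then show ?thesis using pq by simp
  next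
    case 2
    then have "(w - q) * L p + (q - p) * L w \<le> (w - p) * L q"
      using concave_on_three_points[OF L, of p w q] pq w by auto
    then have "(q - p) * L w \<le> (q - p) * (c + s * w)"
      unfolding eq by (simp add: algebra_simps)
    then show ?thesis using pq by simp
  qed
qed

lemma exists_affine_interpolation:
  fixes L :: "real \<Rightarrow> real"
  assumes "p < q"
  obtains c s where "L p = c + s * p" "L q = c + s * q"
proof (rule that)
  define s where "s = (L q - L p) / (q - p)"
  have "s * (q - p) = L q - L p" using assms by (simp add: s_def)
  then show "L q = (L p - s * p) + s * q" by (simp add: algebra_simps)
  show "L p = (L p - s * p) + s * p" by simp
qed

text \<open>The overlap \<open>{r..q}\<close> has positive length, so the two lines share two points
  and coincide.\<close>

lemma linear_on_set_union:
  assumes "linear_on_set {p..q} L" "linear_on_set {r..t} L" "p \<le> r" "r < q" "q \<le> t"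
  shows "linear_on_set {p..t} L"
proof -
  obtain c d c' d' where 1: "\<And>x. x \<in> {p..q} \<Longrightarrow> L x = c + d * x"
    and 2: "\<And>x. x \<in> {r..t} \<Longrightarrow> L x = c' + d' * x"
    using assms(1,2) by (auto simp: linear_on_set_def)
  have "c + d * r = c' + d' * r" "c + d * q = c' + d' * q"
    using 1[of r] 2[of r] 1[of q] 2[of q] assms by auto
  then have "(d - d') * (q - r) = 0" by (simp add: algebra_simps)
  then have "d = d'" using assms by simp
  moreover then have "c = c'" using \<open>c + d * r = _\<close> by simp
  ultimately have "L x = c + d * x" if "x \<in> {p..t}" for x
    using 1[of x] 2[of x] that assms by (cases "x \<le> q") auto
  then show ?thesis unfolding linear_on_set_def by blast
qed

text \<open>Makes \<open>distr_fun\<close> accessible to the theory of distribution functions of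
  measures; continuity holds because a density charges no point.\<close>

lemma cdf_density_halfline:
  assumes f: "halfline_density f"
  shows "real_distribution (density lborel (\<lambda>x. ennreal (f x)))"
    and "distr_fun f = cdf (density lborel (\<lambda>x. ennreal (f x)))"
    and "isCont (distr_fun f) x"
proof -
  let ?D = "density lborel (\<lambda>x. ennreal (f x))"
  have [measurable]: "f \<in> borel_measurable borel" and nn: "\<And>x. 0 \<le> f x"
    and neg: "\<And>x. x < 0 \<Longrightarrow> f x = 0" and int: "has_bochner_integral lborel f 1"
    using f by (auto simp: halfline_density_def)
  have integ: "integrable lborel f" and i1: "integral\<^sup>L lborel f = 1"
    using int by (auto simp: has_bochner_integral_iff)
  have "emeasure ?D (space ?D) = (\<integral>\<^sup>+x. ennreal (f x) \<partial>lborel)"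
    by (simp add: emeasure_density)
  also have "\<dots> = 1" using nn integ i1 by (subst nn_integral_eq_integral) auto
  finally have "prob_space ?D" by (rule prob_spaceI)
  then interpret D: prob_space ?D .
  show rd: "real_distribution ?D" by unfold_locales auto
  then interpret D: real_distribution ?D .
  show eq: "distr_fun f = cdf ?D"
  proof
    fix x
    have "measure ?D {..x} = (\<integral>y. indicator {..x} y \<partial>?D)" by simp
    also have "\<dots> = (\<integral>y. f y * indicator {..x} y \<partial>lborel)"
      using nn by (subst integral_density) auto
    also have "\<dots> = (\<integral>y. indicator {0..x} y *\<^sub>R f y \<partial>lborel)"
      using neg by (intro Bochner_Integration.integral_cong) (auto simp: indicator_def not_le)
    finally show "distr_fun f x = cdf ?D x"
      by (simp add: distr_fun_def set_lebesgue_integral_def cdf_def)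
  qed
  have "emeasure ?D {x} = 0"
    by (subst emeasure_density) (auto simp: nn_integral_indicator_singleton)
  then have "measure ?D {x} = 0" by (simp add: measure_def)
  then show "isCont (distr_fun f) x" by (simp add: eq D.isCont_cdf)
qed

lemma distr_fun_props:
  assumes f: "halfline_density f"
  shows "mono (distr_fun f)" "0 \<le> distr_fun f x" "distr_fun f x \<le> 1" "distr_fun f 0 = 0"
    "(distr_fun f \<longlongrightarrow> 1) at_top" "continuous_on UNIV (distr_fun f)"
proof -
  let ?D = "density lborel (\<lambda>x. ennreal (f x))"
  interpret D: real_distribution ?D by (rule cdf_density_halfline[OF f])
  note eq = cdf_density_halfline(2)[OF f]
  show "mono (distr_fun f)" unfolding eq by (auto intro!: monoI D.cdf_nondecreasing)
  show "0 \<le> distr_fun f x" "distr_fun f x \<le> 1"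
    unfolding eq by (auto simp: D.cdf_nonneg D.cdf_bounded_prob)
  show "(distr_fun f \<longlongrightarrow> 1) at_top" unfolding eq by (rule D.cdf_lim_at_top_prob)
  show "continuous_on UNIV (distr_fun f)"
    using cdf_density_halfline(3)[OF f] by (simp add: continuous_on_eq_continuous_at)
  have "AE u in lborel. indicator {0..0} u *\<^sub>R f u = 0"
    using AE_lborel_singleton[of 0] by eventually_elim auto
  then show "distr_fun f 0 = 0"
    unfolding distr_fun_def set_lebesgue_integral_def by (rule integral_eq_zero_AE)
qed

lemma distr_fun_lcm_majorant:
  assumes f: "halfline_density f"
  shows "distr_fun_lcm f \<in> concave_majorants {0..} (\<lambda>x. ereal (distr_fun f x))"
    and "\<And>h x. h \<in> concave_majorants {0..} (\<lambda>x. ereal (distr_fun f x)) \<Longrightarrow> 0 \<le> x \<Longrightarrow> distr_fun_lcm f x \<le> h x"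
proof -
  have bdd: "bdd_below ((\<lambda>h. h x) ` concave_majorants {0..} (\<lambda>x. ereal (distr_fun f x)))" if "0 \<le> x" for x
    using that by (intro bdd_below_concave_majorants[of x _ x]) auto
  have "(\<lambda>_. 1) \<in> concave_majorants {0..} (\<lambda>x. ereal (distr_fun f x))"
    using distr_fun_props[OF f] affine_concave_on[of "{0..}" 1 0] by (auto simp: concave_majorants_def)
  then have ne: "concave_majorants {0..} (\<lambda>x. ereal (distr_fun f x)) \<noteq> {}" by auto
  show "distr_fun_lcm f \<in> concave_majorants {0..} (\<lambda>x. ereal (distr_fun f x))"
    unfolding distr_fun_lcm_def using ne bdd by (intro least_concave_majorant_in_concave_majorants) auto
  show "\<And>h x. h \<in> concave_majorants {0..} (\<lambda>x. ereal (distr_fun f x)) \<Longrightarrow> 0 \<le> x \<Longrightarrow> distr_fun_lcm f x \<le> h x"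
    unfolding distr_fun_lcm_def using bdd by (intro least_concave_majorant_least) auto
qed

text \<open>At each point one of two reasons gives the concavity inequality: \<open>k\<close> agrees
  there with the concave \<open>L\<close> and lies below it elsewhere, or a line above
  \<open>k\<close> touches it there. Used to cut a cap off \<open>L\<close> by a chord.\<close>

lemma concave_on_cut:
  fixes L k :: "real \<Rightarrow> real"
  assumes L: "concave_on I L" and le: "\<And>w. w \<in> I \<Longrightarrow> k w \<le> L w"
    and cut: "\<And>z. z \<in> I \<Longrightarrow> k z = L z \<or> (\<exists>c s. k z = c + s * z \<and> (\<forall>w\<in>I. k w \<le> c + s * w))"
  shows "concave_on I k"
  unfolding concave_on_iff
proof (intro conjI ballI allI impI)
  show cI: "convex I" using L by (simp add: concave_on_def convex_on_imp_convex)
  fix x y u v :: real assume xy: "x \<in> I" "y \<in> I" and uv: "0 \<le> u" "0 \<le> v" "u + v = 1"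
  let ?z = "u *\<^sub>R x + v *\<^sub>R y"
  have "?z \<in> I" using cI xy uv by (rule convexD)
  from cut[OF this] show "u * k x + v * k y \<le> k ?z"
  proof
    assume "k ?z = L ?z"
    moreover have "u * L x + v * L y \<le> L ?z" using L xy uv by (auto simp: concave_on_iff)
    moreover have "u * k x + v * k y \<le> u * L x + v * L y"
      using le xy uv by (intro add_mono mult_left_mono) auto
    ultimately show ?thesis by simp
  next
    assume "\<exists>c s. k ?z = c + s * ?z \<and> (\<forall>w\<in>I. k w \<le> c + s * w)"
    then obtain c s where cs: "k ?z = c + s * ?z" "\<And>w. w \<in> I \<Longrightarrow> k w \<le> c + s * w" by auto
    have "u * k x + v * k y \<le> u * (c + s * x) + v * (c + s * y)"
      using cs(2) xy uv by (intro add_mono mult_left_mono) auto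
    also have "\<dots> = (u + v) * c + s * ?z" by (simp add: algebra_simps)
    finally show ?thesis using uv cs(1) by simp
  qed
qed

text \<open>\<open>0\<close> is an extreme point of the half-line, so lowering a concave majorant to
  the value \<open>0\<close> at this single point keeps it concave; minimality then forces the
  value.\<close>

lemma distr_fun_lcm_0:
  assumes f: "halfline_density f"
  shows "distr_fun_lcm f 0 = 0"
proof -
  let ?F = "distr_fun f" and ?L = "distr_fun_lcm f"
  note maj = distr_fun_lcm_majorant[OF f] and F = distr_fun_props[OF f]
  have L: "concave_on {0..} ?L" and ge: "\<And>u. 0 \<le> u \<Longrightarrow> ?F u \<le> ?L u"
    using maj(1) by (auto simp: concave_majorants_def)
  define k where "k w = (if w = 0 then 0 else ?L w)" for w
  have "u * k x + v * k y \<le> k (u *\<^sub>R x + v *\<^sub>R y)"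
    if "x \<ge> 0" "y \<ge> 0" "0 \<le> u" "0 \<le> v" "u + v = 1" for x y u v
  proof (cases "u * x + v * y = 0")
    case True
    then have "u * x = 0" "v * y = 0" using that by (auto simp: add_nonneg_eq_0_iff)
    then show ?thesis by (auto simp: k_def)
  next
    case False
    have "u * k x + v * k y \<le> u * ?L x + v * ?L y"
      using that ge[of 0] F(4) by (intro add_mono mult_left_mono) (auto simp: k_def)
    also have "\<dots> \<le> ?L (u *\<^sub>R x + v *\<^sub>R y)" using L that by (auto simp: concave_on_iff)
    finally show ?thesis using False by (simp add: k_def)
  qed
  then have "concave_on {0..} k" by (auto simp: concave_on_iff)
  then have "k \<in> concave_majorants {0..} (\<lambda>x. ereal (?F x))"
    using ge F(4) by (auto simp: concave_majorants_def k_def)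
  from maj(2)[OF this, of 0] ge[of 0] F(4) show ?thesis by (simp add: k_def)
qed

text \<open>Where the majorant lies strictly above \<open>F\<close>, a short chord still dominates
  \<open>F\<close>. Replacing the arc by its chord gives another concave majorant, so by minimality
  the arc already was the chord.\<close>

lemma distr_fun_lcm_locally_linear:
  assumes f: "halfline_density f" and x: "0 \<le> x" and gt: "distr_fun f x < distr_fun_lcm f x"
  shows "0 < x" "\<exists>d>0. d \<le> x \<and> linear_on_set {x - d..x + d} (distr_fun_lcm f)"
proof -
  let ?F = "distr_fun f" and ?L = "distr_fun_lcm f"
  note maj = distr_fun_lcm_majorant[OF f] and F = distr_fun_props[OF f]
  show x0: "0 < x" using gt x F(4) distr_fun_lcm_0[OF f] by (cases "x = 0") auto
  have L: "concave_on {0..} ?L" and ge: "\<And>u. 0 \<le> u \<Longrightarrow> ?F u \<le> ?L u"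
    using maj(1) by (auto simp: concave_majorants_def)
  have "continuous_on {0<..} ?L"
  proof -
    have "convex_on {0<..} (\<lambda>x. - ?L x)"
      using L unfolding concave_on_def by (rule convex_on_subset) auto
    then have "continuous_on {0<..} (\<lambda>x. - (- ?L x))"
      by (intro continuous_on_minus convex_on_continuous) auto
    then show ?thesis by simp
  qed
  then have cL: "isCont ?L x" using x0 by (simp add: continuous_on_eq_continuous_at)
  have cF: "isCont ?F x" by (rule cdf_density_halfline(3)[OF f])
  \<comment> \<open>Half the gap: near \<open>x\<close>, \<open>F\<close> stays below
    \<open>?F x + g\<close> and the majorant above \<open>?L x - g\<close>, which is the same
    level.\<close>
  define g where "g = (?L x - ?F x) / 2"
  have g: "g > 0" using gt by (simp add: g_def)
  obtain d1 where d1: "d1 > 0" "\<And>w. \<bar>w - x\<bar> < d1 \<Longrightarrow> \<bar>?L w - ?L x\<bar> < g"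
    using cL g unfolding continuous_at_eps_delta dist_real_def by metis
  obtain d2 where d2: "d2 > 0" "\<And>w. \<bar>w - x\<bar> < d2 \<Longrightarrow> \<bar>?F w - ?F x\<bar> < g"
    using cF g unfolding continuous_at_eps_delta dist_real_def by metis
  define d where "d = min x (min d1 d2 / 2)"
  have d: "d > 0" "d \<le> x" "d < d1" "d < d2" using x0 d1 d2 by (auto simp: d_def)
  define p q where "p = x - d" and "q = x + d"
  have pq: "0 \<le> p" "p < q" using d by (auto simp: p_def q_def)
  obtain c s where cs: "?L p = c + s * p" "?L q = c + s * q"
    using exists_affine_interpolation[OF pq(2)] .
  have line_le: "c + s * w \<le> ?L w" if "w \<in> {p..q}" for w
    using concave_on_chord(1)[OF L _ _ pq(2) cs] pq that by auto
  have line_ge: "?L w \<le> c + s * w" if "w \<ge> 0" "w \<notin> {p<..<q}" for w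
    using concave_on_chord(2)[OF L _ _ pq(2) cs] pq that by auto
  have F_le: "?F w \<le> c + s * w" if w: "w \<in> {p..q}" for w
  proof -
    have "?L x - g < c + s * p" "?L x - g < c + s * q"
      unfolding cs[symmetric] using d1(2)[of p] d1(2)[of q] d by (auto simp: p_def q_def)
    moreover have "min (c + s * p) (c + s * q) \<le> c + s * w"
      using w mult_left_mono[of p w s] mult_left_mono_neg[of w q s] by (cases "s \<ge> 0") (auto simp: min_le_iff_disj)
    moreover have "\<bar>w - x\<bar> < d2" using w d by (auto simp: p_def q_def)
    then have "?F w < ?F x + g" using d2(2)[of w] by auto
    moreover have "?F x + g = ?L x - g" by (simp add: g_def field_simps)
    ultimately show ?thesis by linarith
  qed
  define k where "k w = (if w \<in> {p<..<q} then c + s * w else ?L w)" for w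
  have "concave_on {0..} k"
  proof (rule concave_on_cut[OF L])
    show "k w \<le> ?L w" if "w \<in> {0..}" for w using line_le by (auto simp: k_def)
    show "k z = ?L z \<or> (\<exists>c s. k z = c + s * z \<and> (\<forall>w\<in>{0..}. k w \<le> c + s * w))" for z
    proof (cases "z \<in> {p<..<q}")
      case True
      then have "k z = c + s * z \<and> (\<forall>w\<in>{0..}. k w \<le> c + s * w)"
        using line_ge by (auto simp: k_def)
      then show ?thesis by blast
    next
      case False
      then have "k z = ?L z" by (auto simp: k_def)
      then show ?thesis ..
    qed
  qed
  then have "k \<in> concave_majorants {0..} (\<lambda>x. ereal (?F x))"
    using ge F_le by (auto simp: concave_majorants_def k_def)
  then have L_le: "?L w \<le> k w" if "0 \<le> w" for w using maj(2) that by blast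
  have "?L w = c + s * w" if w: "w \<in> {p..q}" for w
  proof (cases "w = p \<or> w = q")
    case True then show ?thesis using cs by auto
  next
    case False
    then have "k w = c + s * w" "0 \<le> w" using w pq by (auto simp: k_def)
    then show ?thesis using L_le[of w] line_le[OF w] by simp
  qed
  then have "linear_on_set {p..q} ?L" by (auto simp: linear_on_set_def)
  then show "\<exists>d>0. d \<le> x \<and> linear_on_set {x - d..x + d} ?L" using d by (auto simp: p_def q_def)
qed

text \<open>Maximality does the work: if an end were not a contact point, or if \<open>F\<close> met
  the line outside \<open>{a..b}\<close>, the linear piece could be prolonged. Then
  \<open>x0\<close> is interior, because the ends are contact points and \<open>x0\<close> is
  not.\<close>

lemma linear_piece:
  assumes f: "halfline_density f" and x: "x0 \<in> misspec_set f"
    and I: "largest_linear_interval (distr_fun_lcm f) x0 {a..b}"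
  obtains c s where "0 < s" "0 \<le> a" "a < x0" "x0 < b"
    "\<And>u. u \<in> {a..b} \<Longrightarrow> distr_fun_lcm f u = c + s * u"
    "\<And>u. 0 \<le> u \<Longrightarrow> distr_fun f u \<le> c + s * u"
    "\<And>u. 0 \<le> u \<Longrightarrow> distr_fun f u = c + s * u \<longleftrightarrow> u \<in> {a..b} \<inter> wellspec_set f"
    "a \<in> wellspec_set f" "b \<in> wellspec_set f"
proof -
  let ?F = "distr_fun f" and ?L = "distr_fun_lcm f"
  note maj = distr_fun_lcm_majorant[OF f] and F = distr_fun_props[OF f]
  have L: "concave_on {0..} ?L" and ge: "\<And>u. 0 \<le> u \<Longrightarrow> ?F u \<le> ?L u"
    using maj(1) by (auto simp: concave_majorants_def)
  have I1: "{a..b} \<subseteq> {0..}" "x0 \<in> {a..b}" "linear_on_set {a..b} ?L"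
    and I2: "\<And>J. is_interval J \<and> J \<subseteq> {0..} \<and> x0 \<in> J \<and> linear_on_set J ?L \<Longrightarrow> J \<subseteq> {a..b}"
    using I unfolding largest_linear_interval_def by blast+
  have max: "{p..q} \<subseteq> {a..b}" if "0 \<le> p" "x0 \<in> {p..q}" "linear_on_set {p..q} ?L" for p q
    using that by (intro I2) (auto simp: is_interval_cc)
  have ab: "a \<le> x0" "x0 \<le> b" using I1 by auto
  then have a0: "0 \<le> a" using I1(1) by (meson atLeastAtMost_iff atLeast_iff order.refl order.trans subsetD)
  have x0: "0 \<le> x0" "?F x0 < ?L x0" using x by (auto simp: misspec_set_def)
  have "a < b"
  proof (rule ccontr)
    assume "\<not> a < b"
    then have "a = x0" "b = x0" using ab by auto
    obtain d where d: "d > 0" "d \<le> x0" "linear_on_set {x0 - d..x0 + d} ?L"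
      using distr_fun_lcm_locally_linear(2)[OF f x0] by blast
    then have "{x0 - d..x0 + d} \<subseteq> {a..b}" by (intro max) auto
    then have "x0 + d \<in> {a..b}" by (rule subsetD) (use d in auto)
    then show False using d \<open>b = x0\<close> by auto
  qed
  have aW: "?F a = ?L a"
  proof (rule ccontr)
    assume "?F a \<noteq> ?L a"
    then have "?F a < ?L a" using ge[OF a0] by simp
    then obtain d where d: "d > 0" "d \<le> a" "linear_on_set {a - d..a + d} ?L"
      using distr_fun_lcm_locally_linear(2)[OF f a0] by blast
    have "linear_on_set {a - d..min (a + d) b} ?L"
      using d(3) unfolding linear_on_set_def by force
    from linear_on_set_union[OF this I1(3)] have "linear_on_set {a - d..b} ?L"
      using d \<open>a < b\<close> by auto
    from max[OF _ _ this] show False using d ab \<open>a < b\<close> by auto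
  qed
  have bW: "?F b = ?L b"
  proof (rule ccontr)
    assume "?F b \<noteq> ?L b"
    have b0: "0 \<le> b" using a0 \<open>a < b\<close> by simp
    have "?F b < ?L b" using \<open>?F b \<noteq> ?L b\<close> ge[OF b0] by simp
    then obtain d where d: "d > 0" "d \<le> b" "linear_on_set {b - d..b + d} ?L"
      using distr_fun_lcm_locally_linear(2)[OF f b0] by blast
    have "linear_on_set {max (b - d) a..b + d} ?L"
      using d(3) unfolding linear_on_set_def by force
    from linear_on_set_union[OF I1(3) this] have "linear_on_set {a..b + d} ?L"
      using d \<open>a < b\<close> by auto
    from max[OF a0 _ this] show False using d ab \<open>a < b\<close> by auto
  qed
  have ax: "a < x0" "x0 < b" using ab x0 aW bW by (auto simp: less_le)
  obtain c s where cs: "\<And>u. u \<in> {a..b} \<Longrightarrow> ?L u = c + s * u"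
    using I1(3) by (auto simp: linear_on_set_def)
  have La: "?L a = c + s * a" and Lb: "?L b = c + s * b" using cs[of a] cs[of b] \<open>a < b\<close> by auto
  have aI: "a \<in> {0..}" and bI: "b \<in> {0..}" using a0 \<open>a < b\<close> by auto
  have Lle: "?L u \<le> c + s * u" if "0 \<le> u" for u
    using that cs[of u] concave_on_chord(2)[OF L aI bI \<open>a < b\<close> La Lb, of u] by (cases "u \<in> {a..b}") auto
  have Fle: "?F u \<le> c + s * u" if "0 \<le> u" for u using Lle[OF that] ge[OF that] by simp
  have contact: "u \<in> {a..b}" if u: "0 \<le> u" "?F u = c + s * u" for u
  proof (rule ccontr)
    assume "u \<notin> {a..b}"
    have Lu: "?L u = c + s * u" using u Lle[OF u(1)] ge[OF u(1)] by simp
    consider "u < a" | "b < u" using \<open>u \<notin> {a..b}\<close> by force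
    then show False
    proof cases
      case 1
      then have "?L w = c + s * w" if "w \<in> {u..b}" for w
        using concave_on_chord(1)[OF L _ bI _ Lu Lb, of w] Lle[of w] that u \<open>a < b\<close> by (auto intro: antisym)
      then have "linear_on_set {u..b} ?L" by (auto simp: linear_on_set_def)
      from max[OF u(1) _ this] show False using 1 ab \<open>a < b\<close> by auto
    next
      case 2
      then have "?L w = c + s * w" if "w \<in> {a..u}" for w
        using concave_on_chord(1)[OF L aI _ _ La Lu, of w] Lle[of w] that u a0 \<open>a < b\<close> by (auto intro: antisym)
      then have "linear_on_set {a..u} ?L" by (auto simp: linear_on_set_def)
      from max[OF a0 _ this] show False using 2 ab \<open>a < b\<close> by auto
    qed
  qed
  \<comment> \<open>Otherwise the line does not rise while \<open>F\<close> does not fall, so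
    \<open>F\<close> would still be on the line at \<open>b + 1\<close>, a contact outside
    \<open>{a..b}\<close>.\<close>
  have "0 < s"
  proof (rule ccontr)
    assume "\<not> 0 < s"
    then have "s * (b + 1) \<le> s * b" by (intro mult_left_mono_neg) auto
    have "?F b \<le> ?F (b + 1)" by (rule monoD[OF F(1)]) simp
    then have "?F (b + 1) = c + s * (b + 1)"
      using Fle[of "b + 1"] bI bW Lb \<open>s * (b + 1) \<le> s * b\<close> by fastforce
    moreover have "0 \<le> b + 1" using bI by simp
    ultimately show False using contact[of "b + 1"] by simp
  qed
  show thesis
  proof (rule that[of s c])
    show "?F u = c + s * u \<longleftrightarrow> u \<in> {a..b} \<inter> wellspec_set f" if "0 \<le> u" for u
      using contact[OF that] cs[of u] that by (auto simp: wellspec_set_def)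
  qed (use \<open>0 < s\<close> a0 ax cs Fle aW bW bI in \<open>auto simp: wellspec_set_def\<close>)
qed

section \<open>The slope of a finite set of points\<close>

text \<open>The slope at \<open>x\<close> of the least concave majorant of the points
  \<open>(u, h u)\<close> with \<open>u\<close> in \<open>S\<close>, when \<open>S\<close> has
  points on both sides of \<open>x\<close> but does not contain \<open>x\<close>. As a closed
  formula it is visibly continuous and measurable in \<open>h\<close>.\<close>

definition minmax_slope :: "real set \<Rightarrow> real \<Rightarrow> (real \<Rightarrow> real) \<Rightarrow> real" where
  "minmax_slope S x h =
     Min ((\<lambda>u. Max ((\<lambda>v. (h v - h u) / (v - u)) ` {v\<in>S. x < v})) ` {u\<in>S. u < x})"

text \<open>Take \<open>u\<close> attaining the minimum and \<open>v\<close> attaining the maximum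
  for this \<open>u\<close>. Points on the right lie below the line through them by the maximum. A
  point \<open>k\<close> on the left sees some right point \<open>w\<close> with slope at least
  \<open>\<gamma>\<close>, so it lies below the parallel line through \<open>w\<close>, and
  \<open>w\<close> is already placed.\<close>

lemma minmax_slope_touches:
  fixes h :: "real \<Rightarrow> real"
  assumes S: "finite S" "x \<notin> S" "{u\<in>S. u < x} \<noteq> {}" "{v\<in>S. x < v} \<noteq> {}"
  defines "\<gamma> \<equiv> minmax_slope S x h"
  obtains u v where "u \<in> S" "u < x" "v \<in> S" "x < v" "h v - \<gamma> * v = h u - \<gamma> * u"
    "\<And>k. k \<in> S \<Longrightarrow> h k - \<gamma> * k \<le> h u - \<gamma> * u"
proof -
  define A B where "A = {u\<in>S. u < x}" and "B = {v\<in>S. x < v}"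
  have fin: "finite A" "A \<noteq> {}" "finite B" "B \<noteq> {}" using S by (auto simp: A_def B_def)
  define \<phi> where "\<phi> u = Max ((\<lambda>v. (h v - h u) / (v - u)) ` B)" for u
  have \<gamma>: "\<gamma> = Min (\<phi> ` A)" by (simp add: \<gamma>_def minmax_slope_def A_def B_def \<phi>_def)
  have "\<gamma> \<in> \<phi> ` A" unfolding \<gamma> using fin by (intro Min_in) auto
  then obtain u where u: "u \<in> A" "\<phi> u = \<gamma>" by auto
  have "\<phi> u \<in> (\<lambda>v. (h v - h u) / (v - u)) ` B" unfolding \<phi>_def using fin by (intro Max_in) auto
  then obtain v where v: "v \<in> B" "(h v - h u) / (v - u) = \<gamma>" using u by auto
  have pos: "0 < b - a" if "a \<in> A" "b \<in> B" for a b using that by (auto simp: A_def B_def)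
  have "h v - h u = \<gamma> * (v - u)" using v pos[OF u(1) v(1)] by (auto simp: field_simps)
  then have eq: "h v - \<gamma> * v = h u - \<gamma> * u" by (simp add: algebra_simps)
  have B_le: "h k - \<gamma> * k \<le> h u - \<gamma> * u" if "k \<in> B" for k
  proof -
    have "(h k - h u) / (k - u) \<le> \<gamma>"
      unfolding u(2)[symmetric] \<phi>_def using fin that by (intro Max_ge) auto
    then have "h k - h u \<le> \<gamma> * (k - u)" using pos[OF u(1) that] by (simp add: pos_divide_le_eq)
    then show ?thesis by (simp add: algebra_simps)
  qed
  have A_le: "h k - \<gamma> * k \<le> h u - \<gamma> * u" if "k \<in> A" for k
  proof -
    have "\<gamma> \<le> \<phi> k" unfolding \<gamma> using fin that by (intro Min_le) auto
    moreover have "\<phi> k \<in> (\<lambda>v. (h v - h k) / (v - k)) ` B" unfolding \<phi>_def using fin by (intro Max_in) auto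
    ultimately obtain w where w: "w \<in> B" "\<gamma> \<le> (h w - h k) / (w - k)" by auto
    then have "\<gamma> * (w - k) \<le> h w - h k" using pos[OF that w(1)] by (simp add: pos_le_divide_eq)
    then show ?thesis using B_le[OF w(1)] by (simp add: algebra_simps)
  qed
  show thesis
  proof (rule that[of u v])
    show "h k - \<gamma> * k \<le> h u - \<gamma> * u" if "k \<in> S" for k
      using that A_le[of k] B_le[of k] S(2) by (cases k x rule: linorder_cases) (auto simp: A_def B_def)
  qed (use u v eq in \<open>auto simp: A_def B_def\<close>)
qed

text \<open>The touching chord spans at least \<open>2 * d\<close>, and its end values differ by at
  most \<open>2 * R\<close>.\<close>

lemma abs_minmax_slope_le:
  assumes S: "finite S" "x \<notin> S" "{u\<in>S. u < x} \<noteq> {}" "{v\<in>S. x < v} \<noteq> {}"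
    and d: "0 < d" "\<And>k. k \<in> S \<Longrightarrow> d \<le> \<bar>k - x\<bar>" and R: "\<And>k. k \<in> S \<Longrightarrow> \<bar>h k\<bar> \<le> R"
  shows "\<bar>minmax_slope S x h\<bar> \<le> R / d"
proof -
  let ?\<gamma> = "minmax_slope S x h"
  obtain u v where uv: "u \<in> S" "u < x" "v \<in> S" "x < v" "h v - ?\<gamma> * v = h u - ?\<gamma> * u"
    by (rule minmax_slope_touches[OF S, of h]) blast
  have eq: "?\<gamma> * (v - u) = h v - h u" using uv(5) by (simp add: algebra_simps)
  have "\<bar>?\<gamma>\<bar> * (2 * d) \<le> \<bar>?\<gamma>\<bar> * (v - u)"
    using d(2)[OF uv(1)] d(2)[OF uv(3)] uv by (intro mult_left_mono) auto
  also have "\<dots> = \<bar>?\<gamma> * (v - u)\<bar>" using uv by (simp add: abs_mult)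
  also have "\<dots> \<le> 2 * R" unfolding eq using R[OF uv(1)] R[OF uv(3)] by linarith
  finally show ?thesis using d by (simp add: field_simps)
qed

lemma continuous_on_Max_image:
  fixes f :: "'i \<Rightarrow> 'a::topological_space \<Rightarrow> real"
  assumes "finite I" "I \<noteq> {}" "\<And>i. i \<in> I \<Longrightarrow> continuous_on A (f i)"
  shows "continuous_on A (\<lambda>x. Max ((\<lambda>i. f i x) ` I))"
  using assms
proof (induction I rule: finite_ne_induct)
  case (insert i I)
  then show ?case by (simp add: continuous_on_max)
qed simp

lemma continuous_on_Min_image:
  fixes f :: "'i \<Rightarrow> 'a::topological_space \<Rightarrow> real"
  assumes "finite I" "I \<noteq> {}" "\<And>i. i \<in> I \<Longrightarrow> continuous_on A (f i)"
  shows "continuous_on A (\<lambda>x. Min ((\<lambda>i. f i x) ` I))"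
  using assms
proof (induction I rule: finite_ne_induct)
  case (insert i I)
  then show ?case by (simp add: continuous_on_min)
qed simp

lemma continuous_on_minmax_slope:
  assumes S: "finite S" "{u\<in>S. u < x} \<noteq> {}" "{v\<in>S. x < v} \<noteq> {}"
  shows "continuous_on UNIV (minmax_slope S x)"
  unfolding minmax_slope_def[abs_def] using S
  by (intro continuous_on_Min_image continuous_on_Max_image continuous_intros
      continuous_on_product_coordinates) auto

lemma measurable_minmax_slope:
  assumes S: "finite S" and h: "\<And>k. k \<in> S \<Longrightarrow> (\<lambda>\<omega>. h \<omega> k) \<in> borel_measurable M"
  shows "(\<lambda>\<omega>. minmax_slope S x (h \<omega>)) \<in> borel_measurable M"
  unfolding minmax_slope_def using assms
  by (intro borel_measurable_Min borel_measurable_Max borel_measurable_divide borel_measurable_diff) auto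

lemma minmax_slope_cong:
  assumes "\<And>k. k \<in> S \<Longrightarrow> h k = h' k"
  shows "minmax_slope S x h = minmax_slope S x h'"
proof -
  have "Max ((\<lambda>v. (h v - h u) / (v - u)) ` {v\<in>S. x < v}) = Max ((\<lambda>v. (h' v - h' u) / (v - u)) ` {v\<in>S. x < v})"
    if "u \<in> S" for u using assms that by (intro arg_cong[where f = Max] image_cong) auto
  then show ?thesis unfolding minmax_slope_def by (intro arg_cong[where f = Min] image_cong) auto
qed

section \<open>The Cramer-Wold device\<close>

text \<open>Trigonometric polynomials in linear forms of the coordinates in \<open>J\<close>. The
  phase \<open>b\<close> brings in the sines, and integrals of single cosines are exactly what
  convergence of linear combinations supplies.\<close>

inductive_set trig_sums :: "'i set \<Rightarrow> (('i \<Rightarrow> real) \<Rightarrow> real) set" for J where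
  cos: "(\<lambda>z. a * cos ((\<Sum>j\<in>J. c j * z j) + b)) \<in> trig_sums J"
| add: "p \<in> trig_sums J \<Longrightarrow> q \<in> trig_sums J \<Longrightarrow> (\<lambda>z. p z + q z) \<in> trig_sums J"

text \<open>The product-to-sum formula; it makes \<open>trig_sums\<close> an algebra, as
  Stone-Weierstrass requires.\<close>

lemma trig_sums_mult:
  assumes "p \<in> trig_sums J" "q \<in> trig_sums J"
  shows "(\<lambda>z. p z * q z) \<in> trig_sums J"
  using assms(1)
proof induction
  case (cos a c b)
  show ?case using assms(2)
  proof induction
    case (cos a' c' b')
    have "(\<lambda>z. (a * a' / 2) * cos ((\<Sum>j\<in>J. (c j - c' j) * z j) + (b - b')) +
           (a * a' / 2) * cos ((\<Sum>j\<in>J. (c j + c' j) * z j) + (b + b'))) \<in> trig_sums J"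
      by (intro trig_sums.intros)
    also have "(\<lambda>z. (a * a' / 2) * cos ((\<Sum>j\<in>J. (c j - c' j) * z j) + (b - b')) +
           (a * a' / 2) * cos ((\<Sum>j\<in>J. (c j + c' j) * z j) + (b + b'))) =
        (\<lambda>z. a * cos ((\<Sum>j\<in>J. c j * z j) + b) * (a' * cos ((\<Sum>j\<in>J. c' j * z j) + b')))"
      (is "?l = ?r")
    proof
      fix z
      let ?A = "(\<Sum>j\<in>J. c j * z j) + b" and ?B = "(\<Sum>j\<in>J. c' j * z j) + b'"
      have "(\<Sum>j\<in>J. (c j - c' j) * z j) + (b - b') = ?A - ?B"
        by (simp add: left_diff_distrib sum_subtractf)
      moreover have "(\<Sum>j\<in>J. (c j + c' j) * z j) + (b + b') = ?A + ?B"
        by (simp add: distrib_right sum.distrib)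
      moreover have "cos (A - B) + cos (A + B) = 2 * (cos A * cos B)" for A B :: real
        by (simp add: cos_add cos_diff)
      then have "(a * a' / 2) * (cos (?A - ?B) + cos (?A + ?B)) = (a * cos ?A) * (a' * cos ?B)"
        by (simp only:) simp
      ultimately show "?l z = ?r z" by (simp only: distrib_left)
    qed
    finally show ?case .
  next
    case (add p q)
    then show ?case by (simp add: distrib_left trig_sums.add)
  qed
next
  case (add p q)
  then show ?case by (simp add: distrib_right trig_sums.add)
qed

lemma trig_sums_const: "(\<lambda>_. a) \<in> trig_sums J"
  using trig_sums.cos[where a = a and c = "\<lambda>_. 0" and b = 0] by simp

lemma trig_sums_sin:
  assumes "finite J" "j \<in> J"
  shows "(\<lambda>z. sin (r * z j)) \<in> trig_sums J"
proof -
  have "(\<lambda>z. 1 * cos ((\<Sum>i\<in>J. (if i = j then r else 0) * z i) + (- pi / 2))) \<in> trig_sums J"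
    by (rule trig_sums.cos)
  moreover have "(\<Sum>i\<in>J. (if i = j then r else 0) * z i) = r * z j" for z
    using assms by (subst sum.remove[of J j]) auto
  moreover have "cos (y + - pi / 2) = sin y" for y :: real
    by (simp add: cos_diff)
  ultimately show ?thesis by simp
qed

text \<open>On the box of half-width \<open>R = L * pi / 2\<close> the coordinates are recovered from their sines by
  \<open>L * arcsin\<close>, so a polynomial approximation in the sines is at once good on the box
  and bounded everywhere.\<close>

lemma trig_sums_approx:
  fixes f :: "('i::countable \<Rightarrow> real) \<Rightarrow> real"
  assumes J: "finite J" and f: "continuous_on UNIV f" "\<And>z. \<bar>f z\<bar> \<le> B" and R: "0 < R" and e: "0 < e"
  obtains p where "p \<in> trig_sums J" "\<And>z. \<bar>p z\<bar> \<le> B + e"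
    "\<And>z. (\<And>j. j \<in> J \<Longrightarrow> \<bar>z j\<bar> \<le> R) \<Longrightarrow> (\<And>j. j \<notin> J \<Longrightarrow> z j = 0) \<Longrightarrow> \<bar>f z - p z\<bar> \<le> e"
proof -
  define L where "L = 2 * R / pi"
  have L: "L > 0" using R by (simp add: L_def)
  \<comment> \<open>The factor \<open>{0}\<close> outside \<open>J\<close> makes the cube compact in
    the product over the whole index type, and two of its points can differ only in coordinates of
    \<open>J\<close>.\<close>
  define S :: "('i \<Rightarrow> real) set" where "S = PiE UNIV (\<lambda>j. if j \<in> J then {-1..1} else {0})"
  have S_iff: "y \<in> S \<longleftrightarrow> (\<forall>j\<in>J. \<bar>y j\<bar> \<le> 1) \<and> (\<forall>j. j \<notin> J \<longrightarrow> y j = 0)" for y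
    unfolding S_def PiE_iff by (auto split: if_splits)
  define sn where "sn z = (\<lambda>j. if j \<in> J then sin (z j / L) else 0)" for z
  have sn: "sn z \<in> S" for z by (auto simp: S_iff sn_def)
  define g where "g y = f (\<lambda>j. if j \<in> J then L * arcsin (y j) else 0)" for y
  have "compactin (product_topology (\<lambda>i. euclidean) UNIV) S"
    unfolding S_def compactin_PiE by auto
  then have cS: "compact S" by (simp add: euclidean_product_topology)
  have coord: "continuous_on S (\<lambda>y. y j)" for j :: 'i
    by (rule continuous_on_subset[OF continuous_on_product_coordinates]) simp
  have "continuous_on S (\<lambda>y j. if j \<in> J then L * arcsin (y j) else 0)"
  proof (rule continuous_on_coordinatewise_then_product)
    fix j show "continuous_on S (\<lambda>y. if j \<in> J then L * arcsin (y j) else 0)"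
      by (cases "j \<in> J") (auto simp: S_iff abs_le_iff minus_le_iff intro!: continuous_intros coord)
  qed
  then have cg: "continuous_on S g"
    unfolding g_def by (rule continuous_on_compose2[OF f(1)]) auto
  \<comment> \<open>The ring of functions of the sines that pull back to trigonometric sums; the
    coordinates in \<open>J\<close> belong to it and separate the points of
    \<open>S\<close>.\<close>
  define Q where "Q = {q. continuous_on S q \<and> (\<lambda>z. q (sn z)) \<in> trig_sums J}"
  interpret Q: function_ring_on Q S
  proof
    show "\<exists>q\<in>Q. q x \<noteq> q y" if xy: "x \<in> S" "y \<in> S" "x \<noteq> y" for x y
    proof -
      obtain j where j: "x j \<noteq> y j" using xy(3) by auto
      then have "j \<in> J" using xy by (auto simp: S_iff)
      moreover have "(\<lambda>z. sn z j) = (\<lambda>z. sin ((1 / L) * z j))" using \<open>j \<in> J\<close> by (auto simp: sn_def)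
      ultimately have "(\<lambda>y. y j) \<in> Q" using trig_sums_sin[OF J, of j "1 / L"] coord by (simp add: Q_def)
      with j show ?thesis by (intro bexI[of _ "\<lambda>y. y j"])
    qed
  qed (auto simp: Q_def cS trig_sums.add trig_sums_mult trig_sums_const intro!: continuous_intros)
  obtain q where q: "q \<in> Q" "\<And>y. y \<in> S \<Longrightarrow> \<bar>g y - q y\<bar> < e"
    using Q.Stone_Weierstrass_basic[OF cg e] by (auto simp: Bex_def)
  show thesis
  proof (rule that[of "\<lambda>z. q (sn z)"])
    show "(\<lambda>z. q (sn z)) \<in> trig_sums J" using q by (simp add: Q_def)
    show "\<bar>q (sn z)\<bar> \<le> B + e" for z
      using q(2)[OF sn, of z] f(2)[of "\<lambda>j. if j \<in> J then L * arcsin (sn z j) else 0"]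
      by (auto simp: g_def)
    fix z assume z: "\<And>j. j \<in> J \<Longrightarrow> \<bar>z j\<bar> \<le> R" "\<And>j. j \<notin> J \<Longrightarrow> z j = 0"
    have "(if j \<in> J then L * arcsin (sn z j) else 0) = z j" for j
    proof (cases "j \<in> J")
      case True
      have "\<bar>z j / L\<bar> \<le> pi / 2" using z(1)[OF True] R L by (simp add: L_def abs_mult field_simps)
      then have "arcsin (sin (z j / L)) = z j / L" by (intro arcsin_sin) linarith+
      then show ?thesis using True L by (simp add: sn_def)
    qed (use z in auto)
    then have "g (sn z) = f z" by (simp add: g_def)
    then show "\<bar>f z - q (sn z)\<bar> \<le> e" using q(2)[OF sn, of z] by auto
  qed
qed

lemma integral_trig_sums_tendsto:
  assumes "prob_space M" "prob_space N"
    and H: "\<And>n j. j \<in> J \<Longrightarrow> (\<lambda>\<omega>. H n \<omega> j) \<in> borel_measurable M"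
    and U: "\<And>j. j \<in> J \<Longrightarrow> (\<lambda>\<omega>. U \<omega> j) \<in> borel_measurable N"
    and conv: "\<And>c b. (\<lambda>n. \<integral>\<omega>. cos ((\<Sum>j\<in>J. c j * H n \<omega> j) + b) \<partial>M) \<longlonglongrightarrow>
                 (\<integral>\<omega>. cos ((\<Sum>j\<in>J. c j * U \<omega> j) + b) \<partial>N)"
    and p: "p \<in> trig_sums J"
  shows "integrable M (\<lambda>\<omega>. p (H n \<omega>))" "integrable N (\<lambda>\<omega>. p (U \<omega>))"
    "(\<lambda>n. \<integral>\<omega>. p (H n \<omega>) \<partial>M) \<longlonglongrightarrow> (\<integral>\<omega>. p (U \<omega>) \<partial>N)"
proof -
  interpret M: prob_space M by fact
  interpret N: prob_space N by fact
  have "(\<forall>n. integrable M (\<lambda>\<omega>. p (H n \<omega>))) \<and> integrable N (\<lambda>\<omega>. p (U \<omega>)) \<and>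
    (\<lambda>n. \<integral>\<omega>. p (H n \<omega>) \<partial>M) \<longlonglongrightarrow> (\<integral>\<omega>. p (U \<omega>) \<partial>N)"
    using p
  proof induction
    case (cos a c b)
    have "integrable M (\<lambda>\<omega>. cos ((\<Sum>j\<in>J. c j * H n \<omega> j) + b))" for n
      using H by (intro M.integrable_const_bound[of _ 1]) auto
    moreover have "integrable N (\<lambda>\<omega>. cos ((\<Sum>j\<in>J. c j * U \<omega> j) + b))"
      using U by (intro N.integrable_const_bound[of _ 1]) auto
    ultimately show ?case using tendsto_mult_left[OF conv] by auto
  next
    case (add p q)
    then show ?case by (auto intro: tendsto_add)
  qed
  then show "integrable M (\<lambda>\<omega>. p (H n \<omega>))" "integrable N (\<lambda>\<omega>. p (U \<omega>))"
    "(\<lambda>n. \<integral>\<omega>. p (H n \<omega>) \<partial>M) \<longlonglongrightarrow> (\<integral>\<omega>. p (U \<omega>) \<partial>N)" by auto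
qed

text \<open>Off the box some coordinate exceeds \<open>R\<close>, so there the crude bound
  \<open>C\<close> may be multiplied by the sum of squares over \<open>R\<^sup>2\<close>, which is
  at least 1. Integrating gives a bound of Chebyshev type.\<close>

lemma integral_box_approx:
  assumes "prob_space M" and J: "finite J" and R: "0 < R" and C: "0 \<le> C" and e: "0 \<le> e"
    and Z: "\<And>j. j \<in> J \<Longrightarrow> integrable M (\<lambda>\<omega>. (Z \<omega> j)\<^sup>2)" "\<And>j. j \<in> J \<Longrightarrow> (\<integral>\<omega>. (Z \<omega> j)\<^sup>2 \<partial>M) \<le> V"
    and zero: "\<And>\<omega> j. j \<notin> J \<Longrightarrow> Z \<omega> j = 0"
    and int: "integrable M (\<lambda>\<omega>. f (Z \<omega>))" "integrable M (\<lambda>\<omega>. p (Z \<omega>))"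
    and box: "\<And>z. (\<And>j. j \<in> J \<Longrightarrow> \<bar>z j\<bar> \<le> R) \<Longrightarrow> (\<And>j. j \<notin> J \<Longrightarrow> z j = 0) \<Longrightarrow> \<bar>f z - p z\<bar> \<le> e"
    and all: "\<And>z. \<bar>f z - p z\<bar> \<le> (C::real)"
  shows "\<bar>(\<integral>\<omega>. f (Z \<omega>) \<partial>M) - (\<integral>\<omega>. p (Z \<omega>) \<partial>M)\<bar> \<le> e + C * (real (card J) * V / R\<^sup>2)"
proof -
  interpret M: prob_space M by fact
  have pt: "\<bar>f (Z \<omega>) - p (Z \<omega>)\<bar> \<le> e + C * ((\<Sum>j\<in>J. (Z \<omega> j)\<^sup>2) / R\<^sup>2)" for \<omega>
  proof (cases "\<forall>j\<in>J. \<bar>Z \<omega> j\<bar> \<le> R")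
    case True
    then have "\<bar>f (Z \<omega>) - p (Z \<omega>)\<bar> \<le> e" using box zero by blast
    moreover have "0 \<le> C * ((\<Sum>j\<in>J. (Z \<omega> j)\<^sup>2) / R\<^sup>2)" using C by (simp add: sum_nonneg)
    ultimately show ?thesis by linarith
  next
    case False
    then obtain j where j: "j \<in> J" "R < \<bar>Z \<omega> j\<bar>" by auto
    have "R\<^sup>2 \<le> (Z \<omega> j)\<^sup>2" using j R by (metis abs_of_pos less_imp_le power2_abs power_mono)
    also have "\<dots> \<le> (\<Sum>j\<in>J. (Z \<omega> j)\<^sup>2)" using j J by (intro member_le_sum) auto
    finally have "1 \<le> (\<Sum>j\<in>J. (Z \<omega> j)\<^sup>2) / R\<^sup>2" using R by simp
    then have "C * 1 \<le> C * ((\<Sum>j\<in>J. (Z \<omega> j)\<^sup>2) / R\<^sup>2)" using C by (intro mult_left_mono) auto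
    then show ?thesis using all[of "Z \<omega>"] e by linarith
  qed
  have "\<bar>(\<integral>\<omega>. f (Z \<omega>) \<partial>M) - (\<integral>\<omega>. p (Z \<omega>) \<partial>M)\<bar> = \<bar>\<integral>\<omega>. f (Z \<omega>) - p (Z \<omega>) \<partial>M\<bar>"
    using int by simp
  also have "\<dots> \<le> (\<integral>\<omega>. \<bar>f (Z \<omega>) - p (Z \<omega>)\<bar> \<partial>M)" by (rule integral_abs_bound)
  also have "\<dots> \<le> (\<integral>\<omega>. e + C * ((\<Sum>j\<in>J. (Z \<omega> j)\<^sup>2) / R\<^sup>2) \<partial>M)"
    using int Z(1) pt by (intro integral_mono) auto
  also have "\<dots> = e + C * ((\<Sum>j\<in>J. \<integral>\<omega>. (Z \<omega> j)\<^sup>2 \<partial>M) / R\<^sup>2)"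
    using Z(1) by (simp add: M.prob_space)
  also have "\<dots> \<le> e + C * ((\<Sum>j\<in>J. V) / R\<^sup>2)"
    using C Z(2) by (intro add_left_mono mult_left_mono divide_right_mono sum_mono) auto
  finally show ?thesis by simp
qed

text \<open>Vectors are functions on a countable index type that vanish outside \<open>J\<close>.
  The bound \<open>V\<close>, uniform in \<open>n\<close>, is the tightness that lets one box and
  one trigonometric sum serve all \<open>n\<close> and the limit.\<close>

lemma cramer_wold:
  fixes f :: "('i::countable \<Rightarrow> real) \<Rightarrow> real"
  assumes M: "prob_space M" and N: "prob_space N" and J: "finite J"
    and H: "\<And>n j. j \<in> J \<Longrightarrow> (\<lambda>\<omega>. H n \<omega> j) \<in> borel_measurable M"
      "\<And>n j. j \<in> J \<Longrightarrow> integrable M (\<lambda>\<omega>. (H n \<omega> j)\<^sup>2)" "\<And>n j. j \<in> J \<Longrightarrow> (\<integral>\<omega>. (H n \<omega> j)\<^sup>2 \<partial>M) \<le> V"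
      "\<And>n \<omega> j. j \<notin> J \<Longrightarrow> H n \<omega> j = 0"
    and U: "\<And>j. j \<in> J \<Longrightarrow> (\<lambda>\<omega>. U \<omega> j) \<in> borel_measurable N"
      "\<And>j. j \<in> J \<Longrightarrow> integrable N (\<lambda>\<omega>. (U \<omega> j)\<^sup>2)" "\<And>j. j \<in> J \<Longrightarrow> (\<integral>\<omega>. (U \<omega> j)\<^sup>2 \<partial>N) \<le> V"
      "\<And>\<omega> j. j \<notin> J \<Longrightarrow> U \<omega> j = 0"
    and conv: "\<And>c b. (\<lambda>n. \<integral>\<omega>. cos ((\<Sum>j\<in>J. c j * H n \<omega> j) + b) \<partial>M) \<longlonglongrightarrow>
                 (\<integral>\<omega>. cos ((\<Sum>j\<in>J. c j * U \<omega> j) + b) \<partial>N)"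
    and f: "continuous_on UNIV f" "\<And>z. \<bar>f z\<bar> \<le> B"
      "\<And>n. (\<lambda>\<omega>. f (H n \<omega>)) \<in> borel_measurable M" "(\<lambda>\<omega>. f (U \<omega>)) \<in> borel_measurable N"
  shows "(\<lambda>n. \<integral>\<omega>. f (H n \<omega>) \<partial>M) \<longlonglongrightarrow> (\<integral>\<omega>. f (U \<omega>) \<partial>N)"
proof (rule LIMSEQ_I)
  interpret M: prob_space M by fact
  interpret N: prob_space N by fact
  fix r :: real assume r: "0 < r"
  \<comment> \<open>Five terms of size at most \<open>e\<close> are collected: error on the box and
    tail, each for \<open>H n\<close> and for \<open>U\<close>, and the convergence for
    \<open>p\<close>.\<close>
  define e where "e = r / 8"
  have e: "e > 0" using r by (simp add: e_def)
  define C where "C = 2 * B + e"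
  have B: "0 \<le> B" using f(2)[of undefined] by linarith
  have C: "0 < C" using e B by (simp add: C_def)
  have intf: "integrable M (\<lambda>\<omega>. f (H n \<omega>))" "integrable N (\<lambda>\<omega>. f (U \<omega>))" for n
    using f by (auto intro!: M.integrable_const_bound[of _ B] N.integrable_const_bound[of _ B])
  have "((\<lambda>R. (C * (real (card J) * V)) / R\<^sup>2) \<longlongrightarrow> 0) at_top"
    by (intro tendsto_divide_0[OF tendsto_const] filterlim_at_top_imp_at_infinity
        filterlim_pow_at_top filterlim_ident) auto
  then have "((\<lambda>R. C * (real (card J) * V / R\<^sup>2)) \<longlongrightarrow> 0) at_top" by simp
  then have "\<forall>\<^sub>F R in at_top. C * (real (card J) * V / R\<^sup>2) < e \<and> R > 0"
    using e by (intro eventually_conj order_tendstoD(2)[of _ 0] eventually_gt_at_top) auto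
  then obtain R where R: "C * (real (card J) * V / R\<^sup>2) < e" "R > 0"
    using eventually_happens'[OF trivial_limit_at_top_linorder] by blast
  obtain p where p: "p \<in> trig_sums J" "\<And>z. \<bar>p z\<bar> \<le> B + e"
    "\<And>z. (\<And>j. j \<in> J \<Longrightarrow> \<bar>z j\<bar> \<le> R) \<Longrightarrow> (\<And>j. j \<notin> J \<Longrightarrow> z j = 0) \<Longrightarrow> \<bar>f z - p z\<bar> \<le> e"
    using trig_sums_approx[OF J f(1,2) R(2) e] by metis
  have all: "\<bar>f z - p z\<bar> \<le> C" for z using f(2)[of z] p(2)[of z] by (simp add: C_def)
  note P = integral_trig_sums_tendsto[OF M N H(1) U(1) conv p(1)]
  have 1: "\<bar>(\<integral>\<omega>. f (H n \<omega>) \<partial>M) - (\<integral>\<omega>. p (H n \<omega>) \<partial>M)\<bar> \<le> e + C * (real (card J) * V / R\<^sup>2)" for n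
    by (rule integral_box_approx[OF M J R(2) _ _ H(2) H(3) H(4) intf(1) P(1) p(3) all]) (use C e in auto)
  have 2: "\<bar>(\<integral>\<omega>. f (U \<omega>) \<partial>N) - (\<integral>\<omega>. p (U \<omega>) \<partial>N)\<bar> \<le> e + C * (real (card J) * V / R\<^sup>2)"
    by (rule integral_box_approx[OF N J R(2) _ _ U(2) U(3) U(4) intf(2) P(2) p(3) all]) (use C e in auto)
  obtain n0 where n0: "\<And>n. n \<ge> n0 \<Longrightarrow> \<bar>(\<integral>\<omega>. p (H n \<omega>) \<partial>M) - (\<integral>\<omega>. p (U \<omega>) \<partial>N)\<bar> < e"
    using LIMSEQ_D[OF P(3) e] by auto
  have "norm ((\<integral>\<omega>. f (H n \<omega>) \<partial>M) - (\<integral>\<omega>. f (U \<omega>) \<partial>N)) < r" if "n \<ge> n0" for n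
    using n0[OF that] 1[of n] 2 R(1) e_def unfolding real_norm_def by linarith
  then show "\<exists>n0. \<forall>n\<ge>n0. norm ((\<integral>\<omega>. f (H n \<omega>) \<partial>M) - (\<integral>\<omega>. f (U \<omega>) \<partial>N)) < r" by blast
qed

section \<open>Equicontinuity of the empirical process\<close>

text \<open>Induction on \<open>n\<close>, expanding the power of the sum with one more summand. By
  independence every mixed term containing a first power has mean zero. As the summands are at most
  1 in absolute value, the variance bound \<open>v\<close> also bounds their fourth moments.\<close>

lemma (in prob_space) moments_indep_sum:
  fixes Y :: "nat \<Rightarrow> 'a \<Rightarrow> real"
  assumes indep: "indep_vars (\<lambda>_. borel) Y UNIV"
    and bound: "\<And>i \<omega>. \<bar>Y i \<omega>\<bar> \<le> 1"
    and mean: "\<And>i. expectation (Y i) = 0" and var: "\<And>i. expectation (\<lambda>\<omega>. (Y i \<omega>)\<^sup>2) \<le> v"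
  shows "expectation (\<lambda>\<omega>. (\<Sum>i<n. Y i \<omega>) ^ 2) \<le> real n * v"
    and "expectation (\<lambda>\<omega>. (\<Sum>i<n. Y i \<omega>) ^ 4) \<le> real n * v + 3 * (real n)\<^sup>2 * v\<^sup>2"
proof -
  define S where "S n \<omega> = (\<Sum>i<n. Y i \<omega>)" for n \<omega>
  have [measurable]: "Y i \<in> borel_measurable M" for i using indep by (auto simp: indep_vars_def)
  have [measurable]: "S n \<in> borel_measurable M" for n unfolding S_def by measurable
  have S_bound: "\<bar>S n \<omega>\<bar> \<le> real n" for n \<omega>
  proof -
    have "\<bar>S n \<omega>\<bar> \<le> (\<Sum>i<n. \<bar>Y i \<omega>\<bar>)" unfolding S_def by (rule sum_abs)
    also have "\<dots> \<le> (\<Sum>i<n. 1)" using bound by (intro sum_mono)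
    finally show ?thesis by simp
  qed
  have "\<bar>S n \<omega>\<bar> ^ k \<le> real n ^ k" for n k \<omega> by (intro power_mono S_bound) auto
  then have intS: "integrable M (\<lambda>\<omega>. S n \<omega> ^ k)" for n k
    by (intro integrable_const_bound[of _ "real n ^ k"]) (auto simp: power_abs)
  have "\<bar>Y n \<omega>\<bar> ^ k \<le> 1" for n k \<omega> using bound by (intro power_le_one) auto
  then have intY: "integrable M (\<lambda>\<omega>. Y n \<omega> ^ k)" for n k
    by (intro integrable_const_bound[of _ 1]) (auto simp: power_abs)
  have prod: "expectation (\<lambda>\<omega>. S n \<omega> ^ j * Y n \<omega> ^ k) = expectation (\<lambda>\<omega>. S n \<omega> ^ j) * expectation (\<lambda>\<omega>. Y n \<omega> ^ k)"
    and intp: "integrable M (\<lambda>\<omega>. S n \<omega> ^ j * Y n \<omega> ^ k)" for n j k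
  proof -
    have "indep_var borel (Y n) borel (\<lambda>\<omega>. \<Sum>i\<in>{..<n}. Y i \<omega>)"
      by (rule indep_vars_sum) (auto intro: indep_vars_subset[OF indep])
    from indep_var_compose[OF this, of "\<lambda>x. x ^ k" borel "\<lambda>x. x ^ j" borel]
    have iv: "indep_var borel (\<lambda>\<omega>. Y n \<omega> ^ k) borel (\<lambda>\<omega>. S n \<omega> ^ j)"
      by (simp add: comp_def S_def)
    show "expectation (\<lambda>\<omega>. S n \<omega> ^ j * Y n \<omega> ^ k) = expectation (\<lambda>\<omega>. S n \<omega> ^ j) * expectation (\<lambda>\<omega>. Y n \<omega> ^ k)"
      using indep_var_lebesgue_integral[OF iv intY intS] by (simp add: mult.commute)
    show "integrable M (\<lambda>\<omega>. S n \<omega> ^ j * Y n \<omega> ^ k)"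
      using indep_var_integrable[OF iv intY intS] by (simp add: mult.commute)
  qed
  have mean_S: "expectation (\<lambda>\<omega>. S n \<omega> ^ Suc 0) = 0" for n
    using mean intY[of _ "Suc 0"] by (simp add: S_def)
  have v: "0 \<le> v" using var[of 0] by (rule order_trans[rotated]) simp
  have Y4: "expectation (\<lambda>\<omega>. Y n \<omega> ^ 4) \<le> v" for n
  proof -
    have "Y n \<omega> ^ 4 \<le> (Y n \<omega>)\<^sup>2" for \<omega>
    proof -
      have "(Y n \<omega>)\<^sup>2 \<le> 1" using bound[of n \<omega>] by (simp add: abs_square_le_1)
      then have "(Y n \<omega>)\<^sup>2 * (Y n \<omega>)\<^sup>2 \<le> 1 * (Y n \<omega>)\<^sup>2" by (intro mult_right_mono) auto
      then show ?thesis by (simp add: power4_eq_xxxx power2_eq_square mult.assoc)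
    qed
    then have "expectation (\<lambda>\<omega>. Y n \<omega> ^ 4) \<le> expectation (\<lambda>\<omega>. (Y n \<omega>)\<^sup>2)"
      using intY by (intro integral_mono) auto
    then show ?thesis using var[of n] by simp
  qed
  have S2: "expectation (\<lambda>\<omega>. S n \<omega> ^ 2) \<le> real n * v" for n
  proof (induction n)
    case (Suc n)
    have "expectation (\<lambda>\<omega>. S (Suc n) \<omega> ^ 2) =
      expectation (\<lambda>\<omega>. S n \<omega> ^ 2 + 2 * (S n \<omega> ^ 1 * Y n \<omega> ^ 1) + Y n \<omega> ^ 2)"
      by (intro Bochner_Integration.integral_cong) (auto simp: S_def power2_eq_square algebra_simps)
    also have "\<dots> = expectation (\<lambda>\<omega>. S n \<omega> ^ 2) + 2 * expectation (\<lambda>\<omega>. S n \<omega> ^ 1 * Y n \<omega> ^ 1) + expectation (\<lambda>\<omega>. Y n \<omega> ^ 2)"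
      using intS intY intp[of n 1 1] by simp
    also have "\<dots> \<le> real n * v + v" unfolding prod using Suc var[of n] mean[of n] by simp
    finally show ?case by (simp add: algebra_simps)
  qed (simp add: S_def)
  have "expectation (\<lambda>\<omega>. S n \<omega> ^ 4) \<le> real n * v + 3 * (real n)\<^sup>2 * v\<^sup>2" for n
  proof (induction n)
    case (Suc n)
    have "expectation (\<lambda>\<omega>. S (Suc n) \<omega> ^ 4) =
      expectation (\<lambda>\<omega>. S n \<omega> ^ 4 + 4 * (S n \<omega> ^ 3 * Y n \<omega> ^ 1) + 6 * (S n \<omega> ^ 2 * Y n \<omega> ^ 2)
        + 4 * (S n \<omega> ^ 1 * Y n \<omega> ^ 3) + Y n \<omega> ^ 4)"
      by (intro Bochner_Integration.integral_cong)
        (auto simp: S_def power4_eq_xxxx power3_eq_cube power2_eq_square algebra_simps)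
    also have "\<dots> = expectation (\<lambda>\<omega>. S n \<omega> ^ 4) + 4 * expectation (\<lambda>\<omega>. S n \<omega> ^ 3 * Y n \<omega> ^ 1)
      + 6 * expectation (\<lambda>\<omega>. S n \<omega> ^ 2 * Y n \<omega> ^ 2) + 4 * expectation (\<lambda>\<omega>. S n \<omega> ^ 1 * Y n \<omega> ^ 3)
      + expectation (\<lambda>\<omega>. Y n \<omega> ^ 4)"
      using intS intY intp[of n 3 1] intp[of n 2 2] intp[of n 1 3] by simp
    also have "\<dots> = expectation (\<lambda>\<omega>. S n \<omega> ^ 4)
      + 6 * (expectation (\<lambda>\<omega>. S n \<omega> ^ 2) * expectation (\<lambda>\<omega>. Y n \<omega> ^ 2)) + expectation (\<lambda>\<omega>. Y n \<omega> ^ 4)"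
      unfolding prod using mean[of n] mean_S[of n] by simp
    also have "\<dots> \<le> (real n * v + 3 * (real n)\<^sup>2 * v\<^sup>2) + 6 * ((real n * v) * v) + v"
      using Suc S2[of n] var[of n] Y4[of n] v
      by (intro add_mono mult_left_mono mult_mono) auto
    \<comment> \<open>The cross term \<open>6 * n * v\<^sup>2\<close> fits into the increase
      \<open>3 * (2 * n + 1) * v\<^sup>2\<close> of the bound.\<close>
    also have "\<dots> \<le> real (Suc n) * v + 3 * (real (Suc n))\<^sup>2 * v\<^sup>2"
      by (simp add: power2_eq_square algebra_simps)
    finally show ?case .
  qed (simp add: S_def)
  with S2 show "expectation (\<lambda>\<omega>. (\<Sum>i<n. Y i \<omega>) ^ 2) \<le> real n * v"
    and "expectation (\<lambda>\<omega>. (\<Sum>i<n. Y i \<omega>) ^ 4) \<le> real n * v + 3 * (real n)\<^sup>2 * v\<^sup>2"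
    by (simp_all add: S_def)
qed

text \<open>Halving the index leads to the parent node. An even node is the same dyadic point one
  level up; an odd one is a single step away from its parent and costs one
  \<open>\<theta>\<close>.\<close>

lemma dyadic_chain:
  fixes h :: "real \<Rightarrow> real" and \<theta> :: "nat \<Rightarrow> real"
  assumes step: "\<And>j k. m \<le> j \<Longrightarrow> j \<le> J \<Longrightarrow> k < 2 ^ j \<Longrightarrow> \<bar>h (real (Suc k) / 2 ^ j) - h (real k / 2 ^ j)\<bar> \<le> \<theta> j"
    and \<theta>: "\<And>j. 0 \<le> \<theta> j"
  shows "m + l \<le> J \<Longrightarrow> k < 2 ^ (m + l) \<Longrightarrow>
    \<bar>h (real k / 2 ^ (m + l)) - h (real (k div 2 ^ l) / 2 ^ m)\<bar> \<le> (\<Sum>j\<in>{m<..m + l}. \<theta> j)"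
proof (induction l arbitrary: k)
  case (Suc l)
  let ?k = "k div 2"
  have k: "?k < 2 ^ (m + l)" using Suc.prems by auto
  have "\<bar>h (real k / 2 ^ (m + Suc l)) - h (real ?k / 2 ^ (m + l))\<bar> \<le> \<theta> (m + Suc l)"
  proof (cases "even k")
    case True
    then have "real k = 2 * real ?k" by (metis dvd_mult_div_cancel of_nat_mult of_nat_numeral)
    then show ?thesis using \<theta> by simp
  next
    case False
    then have k': "k = Suc (2 * ?k)" by simp
    have "real ?k / 2 ^ (m + l) = real (2 * ?k) / 2 ^ (m + Suc l)" by simp
    moreover have "2 * ?k < 2 ^ (m + Suc l)" using Suc.prems k' by linarith
    ultimately show ?thesis using step[of "m + Suc l" "2 * ?k"] Suc.prems k' by simp
  qed
  moreover have "\<bar>h (real ?k / 2 ^ (m + l)) - h (real (?k div 2 ^ l) / 2 ^ m)\<bar> \<le> (\<Sum>j\<in>{m<..m + l}. \<theta> j)"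
    using Suc k by simp
  moreover have "?k div 2 ^ l = k div 2 ^ Suc l" by (simp add: div_mult2_eq)
  moreover have "{m<..m + Suc l} = insert (m + Suc l) {m<..m + l}" by auto
  ultimately show ?case by simp
qed simp

lemma dyadic_level:
  fixes h :: "real \<Rightarrow> real"
  assumes step: "\<And>k. k < 2 ^ m \<Longrightarrow> \<bar>h (real (Suc k) / 2 ^ m) - h (real k / 2 ^ m)\<bar> \<le> \<theta>"
  shows "k + l \<le> 2 ^ m \<Longrightarrow> \<bar>h (real (k + l) / 2 ^ m) - h (real k / 2 ^ m)\<bar> \<le> real l * \<theta>"
proof (induction l)
  case (Suc l)
  then have "\<bar>h (real (Suc (k + l)) / 2 ^ m) - h (real (k + l) / 2 ^ m)\<bar> \<le> \<theta>" by (intro step) auto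
  then show ?case using Suc by (simp add: algebra_simps)
qed simp

section \<open>Moments of the empirical process over Borel sets\<close>

locale density_sample = prob_space M for M :: "'a measure" +
  fixes X :: "nat \<Rightarrow> 'a \<Rightarrow> real" and f0 :: "real \<Rightarrow> real"
  assumes density: "halfline_density f0"
    and indep: "indep_vars (\<lambda>_. borel) X UNIV"
    and distributed: "\<And>i. distributed M lborel (X i) (\<lambda>x. ennreal (f0 x))"
begin

abbreviation F where "F \<equiv> distr_fun f0"
abbreviation Q where "Q \<equiv> density lborel (\<lambda>x. ennreal (f0 x))"

text \<open>The empirical process indexed by sets, so that increments between nested sets are of the
  same form. For \<open>n = 0\<close> it has the value \<open>0\<close>.\<close>

definition emp_sum :: "real set \<Rightarrow> nat \<Rightarrow> 'a \<Rightarrow> real" where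
  "emp_sum A n \<omega> = (\<Sum>i<n. indicator A (X i \<omega>) - measure Q A) / sqrt n"

definition emp_process :: "nat \<Rightarrow> 'a \<Rightarrow> real \<Rightarrow> real" where
  "emp_process n \<omega> u = sqrt n * (emp_distr_fun X n \<omega> u - F u)"

lemma X_measurable [measurable]: "X i \<in> borel_measurable M"
  using distributed[of i] by (simp add: distributed_def)

lemma distr_X: "distr M borel (X i) = Q"
proof -
  have "distr M borel (X i) = distr M lborel (X i)" by (intro distr_cong) auto
  then show ?thesis using distributed[of i] by (simp add: distributed_def)
qed

lemma expectation_X:
  fixes g :: "real \<Rightarrow> real"
  assumes "g \<in> borel_measurable borel"
  shows "expectation (\<lambda>\<omega>. g (X i \<omega>)) = (\<integral>x. g x \<partial>Q)"
  using integral_distr[of "X i" M borel g] assms by (simp add: distr_X)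

sublocale Q: real_distribution Q by (rule cdf_density_halfline[OF density])

lemmas F = distr_fun_props[OF density]

lemma F_eq: "F x = measure Q {..x}"
  by (simp add: cdf_density_halfline(2)[OF density] cdf_def)

text \<open>The moment bounds are applied to centred indicators, whose variance
  \<open>p - p\<^sup>2\<close> is at most \<open>p\<close>. The term \<open>measure Q A / n\<close>
  takes over once the mass of \<open>A\<close> falls below about \<open>1 / n\<close>, which limits
  the depth of the chaining.\<close>

lemma emp_sum_moments:
  assumes A: "A \<in> sets borel" and n: "0 < n"
  shows "expectation (\<lambda>\<omega>. (emp_sum A n \<omega>)\<^sup>2) \<le> measure Q A"
    and "expectation (\<lambda>\<omega>. (emp_sum A n \<omega>) ^ 4) \<le> 3 * (measure Q A)\<^sup>2 + measure Q A / n"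
    and "integrable M (\<lambda>\<omega>. (emp_sum A n \<omega>) ^ k)" "emp_sum A n \<in> borel_measurable M"
proof -
  define p where "p = measure Q A"
  define Y where "Y i \<omega> = indicator A (X i \<omega>) - p" for i \<omega>
  have p: "0 \<le> p" "p \<le> 1" by (auto simp: p_def)
  have A' [measurable]: "A \<in> sets borel" by fact
  have indepY: "indep_vars (\<lambda>_. borel) Y UNIV"
    unfolding Y_def using indep by (rule indep_vars_compose2) measurable
  have Yb: "\<bar>Y i \<omega>\<bar> \<le> 1" for i \<omega> using p by (auto simp: Y_def indicator_def)
  have intA: "integrable Q (indicator A :: real \<Rightarrow> real)"
    by (intro Q.integrable_const_bound[of _ 1]) (auto simp: indicator_def)
  have mean: "expectation (Y i) = 0" for i
    unfolding Y_def using intA by (subst expectation_X[of "\<lambda>x. indicator A x - p"]) (auto simp: p_def Q.prob_space[simplified])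
  have "expectation (\<lambda>\<omega>. (Y i \<omega>)\<^sup>2) = (\<integral>x. indicator A x - 2 * p * indicator A x + p\<^sup>2 \<partial>Q)" for i
    unfolding Y_def by (subst expectation_X[of "\<lambda>x. (indicator A x - p)\<^sup>2"])
      (auto simp: power2_diff indicator_def intro!: Bochner_Integration.integral_cong)
  also have "(\<integral>x. indicator A x - 2 * p * indicator A x + p\<^sup>2 \<partial>Q) = p - 2 * p * p + p\<^sup>2"
    using intA by (simp add: p_def Q.prob_space[simplified])
  finally have var: "expectation (\<lambda>\<omega>. (Y i \<omega>)\<^sup>2) \<le> p" for i
    by (simp add: power2_eq_square)
  note mom = moments_indep_sum[OF indepY Yb mean var, of n]
  have eq: "emp_sum A n \<omega> = (\<Sum>i<n. Y i \<omega>) / sqrt n" for \<omega>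
    by (simp add: emp_sum_def Y_def p_def)
  show [measurable]: "emp_sum A n \<in> borel_measurable M" unfolding emp_sum_def by measurable
  have "expectation (\<lambda>\<omega>. (emp_sum A n \<omega>)\<^sup>2) = expectation (\<lambda>\<omega>. (\<Sum>i<n. Y i \<omega>)\<^sup>2) / n"
    using n by (simp add: eq power_divide)
  also have "\<dots> \<le> real n * p / n" using mom(1) by (intro divide_right_mono) auto
  finally show "expectation (\<lambda>\<omega>. (emp_sum A n \<omega>)\<^sup>2) \<le> measure Q A" using n by (simp add: p_def)
  have "sqrt (real n) ^ 4 = (real n)\<^sup>2"
    using real_sqrt_pow2[of "real n"] by (simp add: power2_eq_square power4_eq_xxxx)
  then have "expectation (\<lambda>\<omega>. (emp_sum A n \<omega>) ^ 4) = expectation (\<lambda>\<omega>. (\<Sum>i<n. Y i \<omega>) ^ 4) / (real n)\<^sup>2"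
    by (simp add: eq power_divide)
  also have "\<dots> \<le> (real n * p + 3 * (real n)\<^sup>2 * p\<^sup>2) / (real n)\<^sup>2"
    using mom(2) by (intro divide_right_mono) auto
  also have "\<dots> = 3 * p\<^sup>2 + p / n" using n by (simp add: field_simps power2_eq_square)
  finally show "expectation (\<lambda>\<omega>. (emp_sum A n \<omega>) ^ 4) \<le> 3 * (measure Q A)\<^sup>2 + measure Q A / n"
    by (simp add: p_def)
  have "\<bar>emp_sum A n \<omega>\<bar> \<le> real n / sqrt n" for \<omega>
  proof -
    have "\<bar>\<Sum>i<n. Y i \<omega>\<bar> \<le> (\<Sum>i<n. \<bar>Y i \<omega>\<bar>)" by (rule sum_abs)
    also have "\<dots> \<le> (\<Sum>i<n. 1)" using Yb by (intro sum_mono)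
    finally show ?thesis unfolding eq abs_divide by (simp add: divide_right_mono)
  qed
  then have "\<bar>emp_sum A n \<omega>\<bar> ^ k \<le> (real n / sqrt n) ^ k" for \<omega> by (intro power_mono) auto
  then show "integrable M (\<lambda>\<omega>. (emp_sum A n \<omega>) ^ k)"
    by (intro integrable_const_bound[of _ "(real n / sqrt n) ^ k"]) (auto simp: power_abs)
qed

lemma emp_sum_tail:
  assumes A: "A \<in> sets borel" and n: "0 < n" and \<theta>: "0 < \<theta>"
  shows "prob {\<omega>\<in>space M. \<theta> < \<bar>emp_sum A n \<omega>\<bar>} \<le> (3 * (measure Q A)\<^sup>2 + measure Q A / n) / \<theta> ^ 4"
    and "{\<omega>\<in>space M. \<theta> < \<bar>emp_sum A n \<omega>\<bar>} \<in> events"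
proof -
  note mom = emp_sum_moments[OF A n]
  have [measurable]: "emp_sum A n \<in> borel_measurable M" by (rule mom(4))
  show "{\<omega>\<in>space M. \<theta> < \<bar>emp_sum A n \<omega>\<bar>} \<in> events" by measurable
  have "prob {\<omega>\<in>space M. \<theta> < \<bar>emp_sum A n \<omega>\<bar>} \<le> prob {\<omega>\<in>space M. \<theta> ^ 4 \<le> emp_sum A n \<omega> ^ 4}"
  proof (rule finite_measure_mono)
    have "\<theta> ^ 4 \<le> x ^ 4" if "\<theta> < \<bar>x\<bar>" for x :: real
      using power_mono[of \<theta> "\<bar>x\<bar>" 4] \<theta> that by simp
    then show "{\<omega>\<in>space M. \<theta> < \<bar>emp_sum A n \<omega>\<bar>} \<subseteq> {\<omega>\<in>space M. \<theta> ^ 4 \<le> emp_sum A n \<omega> ^ 4}" by auto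
  qed measurable
  also have "\<dots> \<le> expectation (\<lambda>\<omega>. emp_sum A n \<omega> ^ 4) / \<theta> ^ 4"
    using \<theta> by (intro integral_Markov_inequality_measure[where A = "{}"] mom(3)) auto
  also have "\<dots> \<le> (3 * (measure Q A)\<^sup>2 + measure Q A / n) / \<theta> ^ 4"
    using mom(2) \<theta> by (intro divide_right_mono) auto
  finally show "prob {\<omega>\<in>space M. \<theta> < \<bar>emp_sum A n \<omega>\<bar>} \<le> (3 * (measure Q A)\<^sup>2 + measure Q A / n) / \<theta> ^ 4" .
qed

end

text \<open>Provides the finest level of the chaining, with cells of mass between
  \<open>1 / (2 * n)\<close> and \<open>1 / n\<close>.\<close>

lemma exists_power2_between:
  fixes n :: nat
  assumes "0 < n"
  obtains J where "n \<le> 2 ^ J" "2 ^ J \<le> 2 * n"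
proof -
  define J where "J = (LEAST J. n \<le> 2 ^ J)"
  have n: "n \<le> 2 ^ J" unfolding J_def by (rule LeastI[of "\<lambda>J. n \<le> 2 ^ J" n]) (simp add: less_imp_le)
  have "2 ^ J \<le> 2 * n"
  proof (cases J)
    case (Suc J')
    then have "\<not> n \<le> 2 ^ J'" using not_less_Least[of J' "\<lambda>J. n \<le> 2 ^ J"] by (simp add: J_def)
    then show ?thesis using Suc by simp
  qed (use assms in simp)
  with n show thesis by (rule that)
qed

lemma geometric_tail_sum:
  fixes x :: real
  assumes "0 \<le> x" "x < 1"
  shows "(\<Sum>j\<in>{m..J}. x ^ j) \<le> x ^ m / (1 - x)"
proof (cases "m \<le> J")
  case True
  have "(1 - x) * (\<Sum>j\<in>{m..J}. x ^ j) = x ^ m - x ^ Suc J" using True by (rule sum_gp_multiplied)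
  also have "\<dots> \<le> x ^ m" using assms by simp
  finally show ?thesis using assms by (simp add: field_simps)
qed (use assms in simp)

lemma tendsto_shrinking_powers: "((\<lambda>m. c * x ^ m) \<longlonglongrightarrow> (0::real))" if "\<bar>x\<bar> < 1"
  using tendsto_mult_right_zero[OF LIMSEQ_power_zero[of x]] that by simp

section \<open>Chaining along dyadic quantiles\<close>

context density_sample
begin

text \<open>The smallest point of the closed set where \<open>F\<close> is at least
  \<open>s\<close>. For \<open>s < 1\<close> this set is not empty, whereas \<open>F\<close> may
  reach \<open>1\<close> only in the limit.\<close>

lemma quantile_exists:
  assumes "0 \<le> s" "s < 1"
  shows "\<exists>q\<ge>0. F q = s \<and> (\<forall>u\<ge>0. s \<le> F u \<longrightarrow> q \<le> u)"
proof -
  define C where "C = {0..} \<inter> F -` {s..}"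
  have "\<forall>\<^sub>F x in at_top. s < F x \<and> 0 \<le> x"
    using order_tendstoD(1)[OF F(5) assms(2)] eventually_ge_at_top[of 0] by eventually_elim auto
  then obtain x where "s < F x \<and> 0 \<le> x" using eventually_happens'[OF trivial_limit_at_top_linorder] by blast
  then have ne: "C \<noteq> {}" by (auto simp: C_def)
  have cl: "closed C" unfolding C_def using F(6) by (intro closed_Int closed_vimage) auto
  have bdd: "bdd_below C" by (auto simp: C_def bdd_below_def)
  have q: "Inf C \<in> C" using closed_contains_Inf[OF ne bdd cl] .
  then have "0 \<le> Inf C" "s \<le> F (Inf C)" by (auto simp: C_def)
  \<comment> \<open>The infimum a priori only satisfies \<open>s \<le> F (Inf C)\<close>. A point of
    value exactly \<open>s\<close> at or before it also lies in \<open>C\<close>, hence equals the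
    infimum.\<close>
  then obtain y where y: "0 \<le> y" "y \<le> Inf C" "F y = s"
    using IVT'[of F 0 s "Inf C"] F(4) assms continuous_on_subset[OF F(6)] by auto
  then have "Inf C \<le> y" using bdd by (intro cInf_lower) (auto simp: C_def)
  then have "F (Inf C) = s" using y by simp
  moreover have "Inf C \<le> u" if "0 \<le> u" "s \<le> F u" for u
    using bdd that by (intro cInf_lower) (auto simp: C_def)
  ultimately show ?thesis using \<open>0 \<le> Inf C\<close> by blast
qed

definition quantile :: "real \<Rightarrow> real" where
  "quantile s = (SOME q. 0 \<le> q \<and> F q = s \<and> (\<forall>u\<ge>0. s \<le> F u \<longrightarrow> q \<le> u))"

lemma quantile:
  assumes "0 \<le> s" "s < 1"
  shows "0 \<le> quantile s" "F (quantile s) = s" "\<And>u. 0 \<le> u \<Longrightarrow> s \<le> F u \<Longrightarrow> quantile s \<le> u"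
  using someI_ex[OF quantile_exists[OF assms, unfolded Bex_def]] unfolding quantile_def by blast+

text \<open>The top quantile is taken to be infinite.\<close>

definition quantile_set :: "real \<Rightarrow> real set" where
  "quantile_set s = (if s < 1 then {..quantile s} else UNIV)"

lemma quantile_set_borel [measurable]: "quantile_set s \<in> sets borel"
  by (simp add: quantile_set_def)

lemma measure_quantile_set:
  assumes "0 \<le> s" "s \<le> 1"
  shows "measure Q (quantile_set s) = s"
proof (cases "s < 1")
  case True
  then show ?thesis using quantile(2)[of s] assms by (simp add: quantile_set_def F_eq)
next
  case False
  then show ?thesis using assms Q.prob_space by (simp add: quantile_set_def)
qed

lemma quantile_set_mono:
  assumes "0 \<le> s" "s \<le> t"
  shows "quantile_set s \<subseteq> quantile_set t"
proof (cases "t < 1")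
  case True
  then show ?thesis
    using quantile(3)[of s "quantile t"] quantile[of t] assms by (auto simp: quantile_set_def)
qed (simp add: quantile_set_def)

text \<open>Since \<open>F\<close> may be flat, a point with \<open>F u = s\<close> can lie beyond
  the smallest quantile. The upper inclusion therefore asks for strict inequality, or for the top
  level, whose set is the whole line.\<close>

lemma quantile_set_sandwich:
  assumes "0 \<le> u" "0 \<le> s" "s \<le> 1"
  shows "s < 1 \<Longrightarrow> s \<le> F u \<Longrightarrow> quantile_set s \<subseteq> {..u}"
    and "F u < s \<or> s = 1 \<Longrightarrow> {..u} \<subseteq> quantile_set s"
proof -
  show "quantile_set s \<subseteq> {..u}" if "s < 1" "s \<le> F u"
    using quantile(3)[of s u] assms that by (auto simp: quantile_set_def)
  assume 1: "F u < s \<or> s = 1"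
  show "{..u} \<subseteq> quantile_set s"
  proof (cases "s < 1")
    case True
    have "u \<le> quantile s"
    proof (rule ccontr)
      assume "\<not> ?thesis"
      then have "F (quantile s) \<le> F u" by (intro monoD[OF F(1)]) auto
      then show False using quantile(2)[of s] True 1 assms by auto
    qed
    then show ?thesis using True by (auto simp: quantile_set_def)
  qed (simp add: quantile_set_def)
qed

lemma emp_sum_diff:
  assumes "A \<subseteq> B" "A \<in> sets borel" "B \<in> sets borel"
  shows "emp_sum (B - A) n \<omega> = emp_sum B n \<omega> - emp_sum A n \<omega>"
proof -
  have "measure Q (B - A) = measure Q B - measure Q A" using assms by (intro Q.finite_measure_Diff) auto
  moreover have "(indicator (B - A) x :: real) = indicator B x - indicator A x" for x
    using assms(1) by (auto simp: indicator_def)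
  ultimately show ?thesis
    unfolding emp_sum_def diff_divide_distrib[symmetric] sum_subtractf[symmetric]
    by (intro arg_cong2[where f = "(/)"] sum.cong) auto
qed

lemma emp_process_eq: "emp_process n \<omega> u = emp_sum {..u} n \<omega>"
proof (cases "n = 0")
  case False
  then have "sqrt n * (S / n - f) = (S - n * f) / sqrt n" for S f :: real
    by (simp add: field_simps)
  then show ?thesis by (simp add: emp_process_def emp_sum_def emp_distr_fun_def sum_subtractf F_eq)
qed (simp add: emp_process_def emp_sum_def)

text \<open>The empirical mass grows with the set, so passing from \<open>A\<close> to
  \<open>B\<close> costs only the change of centring. This bracketing replaces further chaining
  below the finest level.\<close>

lemma emp_sum_compare:
  assumes "A \<subseteq> B" "0 < n"
  shows "emp_sum A n \<omega> \<le> emp_sum B n \<omega> + sqrt n * (measure Q B - measure Q A)"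
proof -
  have "(\<Sum>i<n. indicator A (X i \<omega>) - measure Q A) \<le> (\<Sum>i<n. indicator B (X i \<omega>) - measure Q A)"
    using assms by (intro sum_mono) (auto simp: indicator_def)
  also have "\<dots> = (\<Sum>i<n. indicator B (X i \<omega>) - measure Q B) + n * (measure Q B - measure Q A)"
    by (simp add: sum_subtractf algebra_simps)
  finally have "emp_sum A n \<omega> \<le> ((\<Sum>i<n. indicator B (X i \<omega>) - measure Q B) + n * (measure Q B - measure Q A)) / sqrt n"
    unfolding emp_sum_def by (intro divide_right_mono) auto
  also have "\<dots> = emp_sum B n \<omega> + sqrt n * (measure Q B - measure Q A)"
  proof -
    have "real n * c / sqrt n = sqrt n * c" for c
      by (metis of_nat_0_le_iff real_div_sqrt times_divide_eq_left)
    then show ?thesis by (simp add: emp_sum_def add_divide_distrib)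
  qed
  finally show ?thesis .
qed

text \<open>Chaining with fourth moments needs \<open>\<rho> < 1 < 2 * \<rho> ^ 4\<close>; the ratio
  \<open>1 / (2 * \<rho> ^ 4)\<close> of the level probabilities is then \<open>5000 / 6561\<close>.\<close>

definition \<rho> :: real where "\<rho> = 9 / 10"

definition bad_event :: "nat \<Rightarrow> nat \<Rightarrow> nat \<Rightarrow> 'a set" where
  "bad_event n m J = (\<Union>j\<in>{m..J}. \<Union>k\<in>{..<2 ^ j}.
     {\<omega>\<in>space M. \<rho> ^ j < \<bar>emp_sum (quantile_set (real (Suc k) / 2 ^ j) - quantile_set (real k / 2 ^ j)) n \<omega>\<bar>})"

text \<open>A union bound: each of the \<open>2 ^ j\<close> cells has mass \<open>1 / 2 ^ j\<close>,
  and \<open>1 / n \<le> 2 / 2 ^ j\<close> up to level \<open>J\<close>. With the fourth-moment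
  tail, level \<open>j\<close> contributes at most \<open>3 + 2\<close> times
  \<open>(1 / (2 * \<rho> ^ 4)) ^ j\<close>.\<close>

lemma bad_event:
  assumes n: "0 < n" "2 ^ J \<le> 2 * n"
  shows "bad_event n m J \<in> events"
    and "prob (bad_event n m J) \<le> 5 * (\<Sum>j\<in>{m..J}. (5000 / 6561) ^ j)"
proof -
  define B where "B j k = {\<omega>\<in>space M. \<rho> ^ j < \<bar>emp_sum (quantile_set (real (Suc k) / 2 ^ j) - quantile_set (real k / 2 ^ j)) n \<omega>\<bar>}" for j k :: nat
  have \<rho>: "0 < \<rho>" by (simp add: \<rho>_def)
  have bad: "bad_event n m J = (\<Union>j\<in>{m..J}. \<Union>k\<in>{..<2 ^ j}. B j k)" by (simp add: bad_event_def B_def)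
  have B: "B j k \<in> events" for j k
    unfolding B_def using \<rho> n by (intro emp_sum_tail(2)) auto
  then show "bad_event n m J \<in> events" unfolding bad by (intro sets.finite_UN) auto
  have pB: "prob (B j k) \<le> (3 * (1 / 2 ^ j)\<^sup>2 + (1 / 2 ^ j) / n) / (\<rho> ^ j) ^ 4" if "k < 2 ^ j" for j k
  proof -
    have "real (Suc k) \<le> 2 ^ j" using that by (metis Suc_leI of_nat_le_iff of_nat_numeral of_nat_power)
    then have s: "0 \<le> real k / 2 ^ j" "real k / 2 ^ j \<le> real (Suc k) / 2 ^ j" "real (Suc k) / 2 ^ j \<le> 1"
      by (auto simp: divide_right_mono)
    note s4 = order_trans[OF s(2,3)]
    have "measure Q (quantile_set (real (Suc k) / 2 ^ j) - quantile_set (real k / 2 ^ j)) =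
        measure Q (quantile_set (real (Suc k) / 2 ^ j)) - measure Q (quantile_set (real k / 2 ^ j))"
      using quantile_set_mono[OF s(1,2)] by (intro Q.finite_measure_Diff) auto
    also have "\<dots> = 1 / 2 ^ j" using s s4 by (simp add: measure_quantile_set diff_divide_distrib[symmetric])
    finally have eq: "measure Q (quantile_set (real (Suc k) / 2 ^ j) - quantile_set (real k / 2 ^ j)) = 1 / 2 ^ j" .
    show ?thesis using emp_sum_tail(1)[of "quantile_set (real (Suc k) / 2 ^ j) - quantile_set (real k / 2 ^ j)" n "\<rho> ^ j"] \<rho> n
      unfolding eq B_def by simp
  qed
  have "prob (bad_event n m J) \<le> (\<Sum>j\<in>{m..J}. prob (\<Union>k\<in>{..<2 ^ j}. B j k))"
    unfolding bad using B by (intro finite_measure_subadditive_finite) auto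
  also have "\<dots> \<le> (\<Sum>j\<in>{m..J}. \<Sum>k\<in>{..<2 ^ j}. prob (B j k))"
    using B by (intro sum_mono finite_measure_subadditive_finite) auto
  also have "\<dots> \<le> (\<Sum>j\<in>{m..J}. \<Sum>k\<in>{..<(2::nat) ^ j}. (3 * (1 / 2 ^ j)\<^sup>2 + (1 / 2 ^ j) / n) / (\<rho> ^ j) ^ 4)"
    using pB by (intro sum_mono) auto
  also have "\<dots> \<le> (\<Sum>j\<in>{m..J}. 5 * (5000 / 6561) ^ j)"
  proof (rule sum_mono)
    fix j assume j: "j \<in> {m..J}"
    have "(2::real) ^ j \<le> 2 ^ J" using j by (intro power_increasing) auto
    also have "\<dots> \<le> 2 * real n" using n(2) by (metis of_nat_le_iff of_nat_mult of_nat_numeral of_nat_power)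
    finally have "1 / real n \<le> 2 * (1 / 2 ^ j)" using n by (simp add: field_simps)
    then have "3 * (1 / 2 ^ j) + 1 / real n \<le> 5 * (1 / (2::real) ^ j)" by simp
    then have "(3 * (1 / 2 ^ j) + 1 / real n) / (\<rho> ^ j) ^ 4 \<le> 5 * (1 / 2 ^ j) / (\<rho> ^ j) ^ 4"
      using \<rho> by (intro divide_right_mono) auto
    also have "\<dots> = 5 * (1 / (2 * \<rho> ^ 4)) ^ j"
      by (simp add: power_divide power_mult_distrib power_mult[symmetric] mult.commute)
    also have "1 / (2 * \<rho> ^ 4) = 5000 / 6561" by (simp add: \<rho>_def power4_eq_xxxx)
    finally have le: "(3 * (1 / 2 ^ j) + 1 / real n) / (\<rho> ^ j) ^ 4 \<le> 5 * (5000 / 6561) ^ j" .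
    have "(2::real) ^ j * ((3 * y\<^sup>2 + y / n) / c) = ((2 ^ j * y) * (3 * y + 1 / real n)) / c" for y c
      by (simp add: power2_eq_square algebra_simps add_divide_distrib)
    from this[of "1 / 2 ^ j"]
    have eq: "(2::real) ^ j * ((3 * (1 / 2 ^ j)\<^sup>2 + (1 / 2 ^ j) / n) / c) = (3 * (1 / 2 ^ j) + 1 / real n) / c" for c
      by simp
    have sum_eq: "(\<Sum>k\<in>{..<(2::nat) ^ j}. (3 * (1 / 2 ^ j)\<^sup>2 + (1 / 2 ^ j) / n) / (\<rho> ^ j) ^ 4) =
        2 ^ j * ((3 * (1 / 2 ^ j)\<^sup>2 + (1 / 2 ^ j) / n) / (\<rho> ^ j) ^ 4)" by simp
    show "(\<Sum>k\<in>{..<(2::nat) ^ j}. (3 * (1 / 2 ^ j)\<^sup>2 + (1 / 2 ^ j) / n) / (\<rho> ^ j) ^ 4) \<le> 5 * (5000 / 6561) ^ j"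
      using le by (simp only: sum_eq eq)
  qed
  also have "\<dots> = 5 * (\<Sum>j\<in>{m..J}. (5000 / 6561) ^ j)" by (simp add: sum_distrib_left)
  finally show "prob (bad_event n m J) \<le> 5 * (\<Sum>j\<in>{m..J}. (5000 / 6561) ^ j)" .
qed

lemma bad_event_step:
  assumes \<omega>: "\<omega> \<in> space M - bad_event n m J" and jk: "m \<le> j" "j \<le> J" "k < 2 ^ j"
  shows "\<bar>emp_sum (quantile_set (real (Suc k) / 2 ^ j)) n \<omega> - emp_sum (quantile_set (real k / 2 ^ j)) n \<omega>\<bar> \<le> \<rho> ^ j"
proof -
  have "\<not> \<rho> ^ j < \<bar>emp_sum (quantile_set (real (Suc k) / 2 ^ j) - quantile_set (real k / 2 ^ j)) n \<omega>\<bar>"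
    using \<omega> jk by (auto simp: bad_event_def)
  moreover have "quantile_set (real k / 2 ^ j) \<subseteq> quantile_set (real (Suc k) / 2 ^ j)"
    by (intro quantile_set_mono) (auto simp: divide_right_mono)
  ultimately show ?thesis by (subst (asm) emp_sum_diff) auto
qed

text \<open>The set \<open>{..u}\<close> is bracketed by neighbouring quantile sets of level
  \<open>J\<close>, at the cost of one finest increment and \<open>sqrt n / 2 ^ J\<close>. From the
  lower one the chain leads to its ancestor of level \<open>m\<close>, whose cell still contains
  \<open>F u\<close>.\<close>

lemma emp_process_near_node:
  assumes n: "0 < n" and mJ: "m \<le> J" and \<omega>: "\<omega> \<in> space M - bad_event n m J" and u: "0 \<le> u"
  obtains k where "k < 2 ^ m" "real k / 2 ^ m \<le> F u" "F u \<le> real (Suc k) / 2 ^ m"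
    "\<bar>emp_process n \<omega> u - emp_sum (quantile_set (real k / 2 ^ m)) n \<omega>\<bar>
       \<le> (\<Sum>j\<in>{m..J}. \<rho> ^ j) + \<rho> ^ m + sqrt n / 2 ^ J"
proof -
  define h where "h s = emp_sum (quantile_set s) n \<omega>" for s
  have \<rho>: "0 < \<rho>" "\<rho> < 1" by (auto simp: \<rho>_def)
  have step: "\<bar>h (real (Suc k) / 2 ^ j) - h (real k / 2 ^ j)\<bar> \<le> \<rho> ^ j"
    if "m \<le> j" "j \<le> J" "k < 2 ^ j" for j k
    unfolding h_def using bad_event_step[OF \<omega> that] .
  have Fu: "0 \<le> F u" "F u \<le> 1" using F by auto
  \<comment> \<open>The cap at \<open>2 ^ J - 1\<close> is for \<open>F u = 1\<close>: then the last
    cell is taken, with upper node \<open>1\<close>.\<close>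
  define k where "k = min (nat \<lfloor>F u * 2 ^ J\<rfloor>) (2 ^ J - 1)"
  have k_lt: "k < 2 ^ J" by (simp add: k_def min_less_iff_disj)
  then have k1: "real (Suc k) \<le> 2 ^ J" by (metis Suc_leI of_nat_le_iff of_nat_numeral of_nat_power)
  have "k \<le> nat \<lfloor>F u * 2 ^ J\<rfloor>" by (simp add: k_def)
  then have "int k \<le> \<lfloor>F u * 2 ^ J\<rfloor>" using Fu by (simp add: le_nat_iff)
  then have "real k \<le> of_int \<lfloor>F u * 2 ^ J\<rfloor>" by linarith
  then have k_le: "real k / 2 ^ J \<le> F u" by (simp add: divide_le_eq) linarith
  have k_ge: "F u < real (Suc k) / 2 ^ J \<or> real (Suc k) / 2 ^ J = 1"
  proof (cases "nat \<lfloor>F u * 2 ^ J\<rfloor> \<le> 2 ^ J - 1")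
    case True
    then have "real k = of_int \<lfloor>F u * 2 ^ J\<rfloor>" using Fu by (simp add: k_def min_def)
    then have "F u * 2 ^ J < real (Suc k)" by linarith
    then show ?thesis by (simp add: less_divide_eq)
  next
    case False
    then have "Suc k = 2 ^ J" by (simp add: k_def min_def)
    then have "real (Suc k) = 2 ^ J" by (metis of_nat_numeral of_nat_power)
    then show ?thesis by simp
  qed
  define s s' where "s = real k / 2 ^ J" and "s' = real (Suc k) / 2 ^ J"
  have ss: "0 \<le> s" "s < s'" "s' \<le> 1" "s' - s = 1 / 2 ^ J" "s \<le> F u" "F u \<le> s'"
    using k1 k_le k_ge Fu by (auto simp: s_def s'_def divide_strict_right_mono diff_divide_distrib[symmetric])
  have mono1: "quantile_set s \<subseteq> {..u}" using quantile_set_sandwich(1)[OF u, of s] ss by auto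
  have mono2: "{..u} \<subseteq> quantile_set s'" using quantile_set_sandwich(2)[OF u, of s'] ss k_ge by (auto simp: s'_def)
  have low: "h s - sqrt n / 2 ^ J \<le> emp_process n \<omega> u"
  proof -
    have "h s \<le> emp_process n \<omega> u + sqrt n * (F u - s)"
      using emp_sum_compare[OF mono1 n] ss by (simp add: h_def emp_process_eq measure_quantile_set F_eq[symmetric])
    also have "\<dots> \<le> emp_process n \<omega> u + sqrt n * (1 / 2 ^ J)"
      using ss by (intro add_left_mono mult_left_mono) auto
    finally show ?thesis by simp
  qed
  have up: "emp_process n \<omega> u \<le> h s' + sqrt n / 2 ^ J"
  proof -
    have "emp_process n \<omega> u \<le> h s' + sqrt n * (s' - F u)"
      using emp_sum_compare[OF mono2 n] ss by (simp add: h_def emp_process_eq measure_quantile_set F_eq[symmetric])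
    also have "\<dots> \<le> h s' + sqrt n * (1 / 2 ^ J)"
      using ss by (intro add_left_mono mult_left_mono) auto
    finally show ?thesis by simp
  qed
  have "\<bar>h s' - h s\<bar> \<le> \<rho> ^ J" unfolding s_def s'_def using step[of J k] mJ k_lt by auto
  also have "\<dots> \<le> \<rho> ^ m" using \<rho> mJ by (intro power_decreasing) auto
  finally have near: "\<bar>emp_process n \<omega> u - h s\<bar> \<le> \<rho> ^ m + sqrt n / 2 ^ J" using low up by auto
  define l where "l = J - m"
  have l: "m + l = J" using mJ by (simp add: l_def)
  define K where "K = k div 2 ^ l"
  have "\<bar>h s - h (real K / 2 ^ m)\<bar> \<le> (\<Sum>j\<in>{m<..J}. \<rho> ^ j)"
    using dyadic_chain[of m J h "\<lambda>j. \<rho> ^ j" l k] step \<rho> k_lt by (simp add: l s_def K_def)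
  also have "\<dots> \<le> (\<Sum>j\<in>{m..J}. \<rho> ^ j)" using \<rho> by (intro sum_mono2) auto
  finally have chain: "\<bar>h s - h (real K / 2 ^ m)\<bar> \<le> (\<Sum>j\<in>{m..J}. \<rho> ^ j)" .
  \<comment> \<open>Integer division keeps the whole fine cell from \<open>k\<close> to
    \<open>k + 1\<close> inside the cell of its ancestor, and so \<open>F u\<close> as well.\<close>
  have pow: "(2::real) ^ J = 2 ^ m * 2 ^ l" by (simp add: l[symmetric] power_add)
  have "K * 2 ^ l \<le> k" by (simp add: K_def)
  moreover have "k mod 2 ^ l < 2 ^ l" by simp
  then have "Suc k \<le> Suc K * 2 ^ l"
    using div_mult_mod_eq[of k "2 ^ l"] unfolding K_def mult_Suc by linarith
  ultimately have "K * 2 ^ l \<le> k" "Suc k \<le> Suc K * 2 ^ l" .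
  then have "real (K * 2 ^ l) \<le> real k" "real (Suc k) \<le> real (Suc K * 2 ^ l)"
    by (simp_all only: of_nat_le_iff)
  then have "real K * 2 ^ l \<le> real k" "real (Suc k) \<le> real (Suc K) * 2 ^ l"
    by (simp_all only: of_nat_mult of_nat_power of_nat_numeral)
  then have "real K \<le> real k / 2 ^ l" "real (Suc k) / 2 ^ l \<le> real (Suc K)"
    by (simp_all add: le_divide_eq divide_le_eq del: of_nat_Suc)
  then have "real K / 2 ^ m \<le> real k / 2 ^ l / 2 ^ m" "real (Suc k) / 2 ^ l / 2 ^ m \<le> real (Suc K) / 2 ^ m"
    by (intro divide_right_mono; simp)+
  then have "real K / 2 ^ m \<le> s" "s' \<le> real (Suc K) / 2 ^ m"
    by (simp_all add: s_def s'_def pow mult.commute)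
  then have KF: "real K / 2 ^ m \<le> F u" "F u \<le> real (Suc K) / 2 ^ m" using ss by auto
  have "K < 2 ^ m" using k_lt unfolding K_def l[symmetric] power_add
    by (subst div_less_iff_less_mult) auto
  then show thesis
    using that[of K] KF near chain unfolding h_def by auto
qed

text \<open>Values of \<open>F\<close> at distance at most \<open>1 / 2 ^ m\<close> lie in cells of
  level \<open>m\<close> whose indices differ by at most 2, and the process at each point is close
  to its value at the node of the cell. The uniform bound comes along because the process vanishes
  at the top node.\<close>

theorem emp_process_equicontinuous:
  assumes \<epsilon>: "0 < \<epsilon>"
  obtains \<delta> R n0 where "0 < \<delta>" "0 < R"
    "\<And>n. n0 \<le> n \<Longrightarrow> \<exists>B\<in>events. prob B \<le> \<epsilon> \<and> (\<forall>\<omega>\<in>space M - B.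
       (\<forall>u\<ge>0. \<bar>emp_process n \<omega> u\<bar> \<le> R) \<and>
       (\<forall>u\<ge>0. \<forall>v\<ge>0. \<bar>F u - F v\<bar> \<le> \<delta> \<longrightarrow> \<bar>emp_process n \<omega> u - emp_process n \<omega> v\<bar> \<le> \<epsilon>))"
proof -
  have \<rho>: "0 < \<rho>" "\<rho> < 1" by (auto simp: \<rho>_def)
  \<comment> \<open>The factor \<open>25\<close> exceeds \<open>5 / (1 - 5000 / 6561)\<close>. The
    modulus consists of \<open>11 * \<rho> ^ m\<close> for each of the two points and
    \<open>2 * \<rho> ^ m\<close> between the nodes, together below \<open>\<epsilon> / 2\<close>,
    and of twice \<open>sqrt n / 2 ^ J\<close>, again below \<open>\<epsilon> / 2\<close>.\<close>
  have "\<forall>\<^sub>F m in sequentially. 25 * (5000 / 6561) ^ m < \<epsilon> \<and> 48 * \<rho> ^ m < \<epsilon>"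
    using \<epsilon> \<rho> by (intro eventually_conj order_tendstoD(2)[OF tendsto_shrinking_powers]) auto
  then obtain m where m: "25 * (5000 / 6561) ^ m < \<epsilon>" "48 * \<rho> ^ m < \<epsilon>"
    using eventually_happens'[OF sequentially_bot] by blast
  have "((\<lambda>n. 1 / sqrt (real n)) \<longlongrightarrow> 0) sequentially"
    by (intro tendsto_divide_0[OF tendsto_const] filterlim_at_top_imp_at_infinity
        filterlim_compose[OF sqrt_at_top] filterlim_real_sequentially)
  then have "\<forall>\<^sub>F n in sequentially. 1 / sqrt (real n) < min 1 (\<epsilon> / 4) \<and> 2 ^ m \<le> n \<and> 0 < n"
    using \<epsilon> by (intro eventually_conj order_tendstoD(2) eventually_ge_at_top eventually_gt_at_top) auto
  then obtain n0 where n0: "\<And>n. n0 \<le> n \<Longrightarrow> 1 / sqrt (real n) < min 1 (\<epsilon> / 4) \<and> 2 ^ m \<le> n \<and> 0 < n"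
    by (auto simp: eventually_sequentially)
  show thesis
  proof (rule that[of "1 / 2 ^ m" "2 ^ m * \<rho> ^ m + 11 * \<rho> ^ m + 1" n0])
    show "0 < 2 ^ m * \<rho> ^ m + 11 * \<rho> ^ m + 1" using \<rho> by (simp add: add_pos_pos)
    fix n assume "n0 \<le> n"
    then have n: "1 / sqrt (real n) < 1" "1 / sqrt (real n) < \<epsilon> / 4" "2 ^ m \<le> n" "0 < n"
      using n0[OF \<open>n0 \<le> n\<close>] unfolding min_less_iff_conj by blast+
    obtain J where J: "n \<le> 2 ^ J" "2 ^ J \<le> 2 * n" using exists_power2_between[OF n(4)] .
    have "(2::nat) ^ m \<le> 2 ^ J" using n J by linarith
    then have mJ: "m \<le> J" by simp
    have "sqrt n / 2 ^ J \<le> sqrt n / n"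
      using J n(4) by (intro divide_left_mono) (auto simp: of_nat_le_iff[symmetric] simp del: of_nat_le_iff)
    also have "\<dots> = 1 / sqrt n" using n(4) by (simp add: field_simps)
    finally have "sqrt n / 2 ^ J \<le> 1 / sqrt n" .
    then have \<kappa>: "sqrt n / 2 ^ J < 1" "sqrt n / 2 ^ J < \<epsilon> / 4" using n(1,2) by linarith+
    \<comment> \<open>The factor is \<open>1 / (1 - \<rho>) = 10\<close>; the additional
      \<open>\<rho> ^ m\<close> of the node estimate makes it \<open>11\<close>.\<close>
    have sum_le: "(\<Sum>j\<in>{m..J}. \<rho> ^ j) \<le> 10 * \<rho> ^ m"
      using geometric_tail_sum[of \<rho> m J] \<rho> by (simp add: \<rho>_def)
    define B where "B = bad_event n m J"
    have "prob B \<le> 5 * (\<Sum>j\<in>{m..J}. (5000 / 6561) ^ j)"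
      unfolding B_def using n(4) J(2) by (rule bad_event)
    also have "\<dots> \<le> 5 * ((5000 / 6561) ^ m / (1 - 5000 / 6561))"
      by (intro mult_left_mono geometric_tail_sum) auto
    also have "\<dots> \<le> 25 * (5000 / 6561) ^ m" by (simp add: field_simps)
    finally have pB: "prob B \<le> \<epsilon>" using m by simp
    have "(\<forall>u\<ge>0. \<bar>emp_process n \<omega> u\<bar> \<le> 2 ^ m * \<rho> ^ m + 11 * \<rho> ^ m + 1) \<and>
       (\<forall>u\<ge>0. \<forall>v\<ge>0. \<bar>F u - F v\<bar> \<le> 1 / 2 ^ m \<longrightarrow> \<bar>emp_process n \<omega> u - emp_process n \<omega> v\<bar> \<le> \<epsilon>)"
      if \<omega>: "\<omega> \<in> space M - B" for \<omega>
    proof (intro conjI allI impI)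
      define h where "h k = emp_sum (quantile_set (real k / 2 ^ m)) n \<omega>" for k
      have node: "\<exists>k<2 ^ m. real k / 2 ^ m \<le> F u \<and> F u \<le> real (Suc k) / 2 ^ m \<and>
          \<bar>emp_process n \<omega> u - h k\<bar> \<le> 11 * \<rho> ^ m + sqrt n / 2 ^ J" if u0: "0 \<le> u" for u
      proof -
        obtain k where "k < 2 ^ m" "real k / 2 ^ m \<le> F u" "F u \<le> real (Suc k) / 2 ^ m"
          "\<bar>emp_process n \<omega> u - h k\<bar> \<le> (\<Sum>j\<in>{m..J}. \<rho> ^ j) + \<rho> ^ m + sqrt n / 2 ^ J"
          using emp_process_near_node[OF n(4) mJ \<omega>[unfolded B_def] u0] unfolding h_def by metis
        moreover from this(4) have "\<bar>emp_process n \<omega> u - h k\<bar> \<le> 11 * \<rho> ^ m + sqrt n / 2 ^ J"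
          using sum_le by linarith
        ultimately show ?thesis by blast
      qed
      have step: "\<bar>h (Suc k) - h k\<bar> \<le> \<rho> ^ m" if "k < 2 ^ m" for k
        unfolding h_def using \<omega> mJ that unfolding B_def by (intro bad_event_step) auto
      have level: "\<bar>h (k + l) - h k\<bar> \<le> real l * \<rho> ^ m" if "k + l \<le> 2 ^ m" for k l
        using dyadic_level[of m "\<lambda>s. emp_sum (quantile_set s) n \<omega>" "\<rho> ^ m" k l] step that
        unfolding h_def by blast
      have level': "\<bar>h k - h l\<bar> \<le> 2 * \<rho> ^ m" if "k \<le> 2 ^ m" "l \<le> 2 ^ m" "k \<le> l + 2" "l \<le> k + 2" for k l
      proof (cases "k \<le> l")
        case True
        then have "\<bar>h l - h k\<bar> \<le> real (l - k) * \<rho> ^ m" using level[of k "l - k"] that by simp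
        also have "\<dots> \<le> 2 * \<rho> ^ m" using that \<rho> by (intro mult_right_mono) auto
        finally show ?thesis by linarith
      next
        case False
        then have "\<bar>h k - h l\<bar> \<le> real (k - l) * \<rho> ^ m" using level[of l "k - l"] that by simp
        also have "\<dots> \<le> 2 * \<rho> ^ m" using that \<rho> by (intro mult_right_mono) auto
        finally show ?thesis .
      qed
      {
        fix u :: real assume "0 \<le> u"
        then obtain k where k: "k < 2 ^ m" "\<bar>emp_process n \<omega> u - h k\<bar> \<le> 11 * \<rho> ^ m + sqrt n / 2 ^ J"
          using node by blast
        \<comment> \<open>At the top node the set is the whole line, where empirical and true mass
          agree; from there at most \<open>2 ^ m\<close> cells lead to any other node.\<close>
        have "h (2 ^ m) = 0"
          using Q.prob_space by (simp add: h_def quantile_set_def emp_sum_def)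
        then have "\<bar>h k\<bar> \<le> real (2 ^ m - k) * \<rho> ^ m" using level[of k "2 ^ m - k"] k by simp
        also have "\<dots> \<le> 2 ^ m * \<rho> ^ m" using \<rho> k by (intro mult_right_mono) (auto simp: of_nat_diff)
        finally show "\<bar>emp_process n \<omega> u\<bar> \<le> 2 ^ m * \<rho> ^ m + 11 * \<rho> ^ m + 1"
          using k(2) \<kappa>(1) by linarith
      }
      fix u v :: real assume uv: "0 \<le> u" "0 \<le> v" "\<bar>F u - F v\<bar> \<le> 1 / 2 ^ m"
      obtain k where k: "k < 2 ^ m" "real k / 2 ^ m \<le> F u" "F u \<le> real (Suc k) / 2 ^ m"
          "\<bar>emp_process n \<omega> u - h k\<bar> \<le> 11 * \<rho> ^ m + sqrt n / 2 ^ J"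
        using node[OF uv(1)] by blast
      obtain l where l: "l < 2 ^ m" "real l / 2 ^ m \<le> F v" "F v \<le> real (Suc l) / 2 ^ m"
          "\<bar>emp_process n \<omega> v - h l\<bar> \<le> 11 * \<rho> ^ m + sqrt n / 2 ^ J"
        using node[OF uv(2)] by blast
      have "real k / 2 ^ m \<le> real (Suc l) / 2 ^ m + 1 / 2 ^ m" "real l / 2 ^ m \<le> real (Suc k) / 2 ^ m + 1 / 2 ^ m"
        using k l uv(3) by linarith+
      then have "k \<le> l + 2" "l \<le> k + 2" by (simp_all add: add_divide_distrib[symmetric] divide_le_cancel)
      then have "\<bar>h k - h l\<bar> \<le> 2 * \<rho> ^ m" using k l by (intro level') auto
      then show "\<bar>emp_process n \<omega> u - emp_process n \<omega> v\<bar> \<le> \<epsilon>"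
        using k(4) l(4) \<kappa>(2) m(2) by linarith
    qed
    moreover have "B \<in> events" unfolding B_def using n(4) J(2) by (rule bad_event)
    ultimately show "\<exists>B\<in>events. prob B \<le> \<epsilon> \<and> (\<forall>\<omega>\<in>space M - B.
       (\<forall>u\<ge>0. \<bar>emp_process n \<omega> u\<bar> \<le> 2 ^ m * \<rho> ^ m + 11 * \<rho> ^ m + 1) \<and>
       (\<forall>u\<ge>0. \<forall>v\<ge>0. \<bar>F u - F v\<bar> \<le> 1 / 2 ^ m \<longrightarrow> \<bar>emp_process n \<omega> u - emp_process n \<omega> v\<bar> \<le> \<epsilon>))"
      using pB by blast
  qed simp
qed

end

section \<open>Finite-dimensional limits\<close>

text \<open>Taken from the real and imaginary parts of the characteristic function; it is real, so
  the sine part of the shifted cosine drops out.\<close>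

lemma integral_cos_std_normal:
  "(\<integral>z. cos (s * z + b) \<partial>std_normal_distribution) = cos b * exp (- s\<^sup>2 / 2)"
proof -
  interpret N: real_distribution std_normal_distribution by (rule real_dist_normal_dist)
  let ?E = "\<lambda>x::real. exp (\<i> * complex_of_real (s * x))"
  have int: "integrable std_normal_distribution ?E" by (rule N.integrable_iexp) auto
  have char: "(\<integral>x. ?E x \<partial>std_normal_distribution) = complex_of_real (exp (- s\<^sup>2 / 2))"
    using fun_cong[OF char_std_normal_distribution, of s] by (simp add: char_def)
  have "(\<integral>x. cos (s * x) \<partial>std_normal_distribution) = (\<integral>x. Re (?E x) \<partial>std_normal_distribution)"
    by (simp add: Re_exp)
  also have "\<dots> = exp (- s\<^sup>2 / 2)" using integral_Re[OF int] char by simp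
  finally have c: "(\<integral>x. cos (s * x) \<partial>std_normal_distribution) = exp (- s\<^sup>2 / 2)" .
  have "(\<integral>x. sin (s * x) \<partial>std_normal_distribution) = (\<integral>x. Im (?E x) \<partial>std_normal_distribution)"
    by (simp add: Im_exp)
  also have "\<dots> = 0" using integral_Im[OF int] char by simp
  finally have sn: "(\<integral>x. sin (s * x) \<partial>std_normal_distribution) = 0" .
  have ints: "integrable std_normal_distribution (\<lambda>x. cos (s * x))" "integrable std_normal_distribution (\<lambda>x. sin (s * x))"
    by (auto intro!: N.integrable_const_bound[of _ 1])
  have "(\<integral>z. cos (s * z + b) \<partial>std_normal_distribution) =
    (\<integral>z. cos (s * z) * cos b - sin (s * z) * sin b \<partial>std_normal_distribution)"
    by (simp add: cos_add)
  also have "\<dots> = exp (- s\<^sup>2 / 2) * cos b" using ints c sn by simp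
  finally show ?thesis by simp
qed

text \<open>If the variance vanishes, the summands are almost surely zero and the limit is a point
  mass. Otherwise the sums are standardized by \<open>\<sigma>\<close>, and this factor is put back
  into the test function.\<close>

lemma (in prob_space) central_limit_test_function:
  fixes Z :: "nat \<Rightarrow> 'a \<Rightarrow> real"
  assumes indep: "indep_vars (\<lambda>_. borel) Z UNIV" and bound: "\<And>i \<omega>. \<bar>Z i \<omega>\<bar> \<le> c"
    and distr: "\<And>i. distr M borel (Z i) = \<mu>"
    and mean: "\<And>i. expectation (Z i) = 0" and var: "\<And>i. expectation (\<lambda>\<omega>. (Z i \<omega>)\<^sup>2) = v"
    and g: "\<And>x. isCont g x" "\<And>x. \<bar>g x\<bar> \<le> (B::real)"
  shows "(\<lambda>n. expectation (\<lambda>\<omega>. g ((\<Sum>i<n. Z i \<omega>) / sqrt n))) \<longlonglongrightarrow>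
    (\<integral>z. g (sqrt v * z) \<partial>std_normal_distribution)"
proof -
  have [measurable]: "Z i \<in> borel_measurable M" for i using indep by (auto simp: indep_vars_def)
  have [measurable]: "g \<in> borel_measurable borel"
    using g(1) by (intro borel_measurable_continuous_onI continuous_at_imp_continuous_on) auto
  have v: "0 \<le> v" unfolding var[of 0, symmetric] by simp
  have sq: "integrable M (\<lambda>\<omega>. (Z i \<omega>)\<^sup>2)" for i
  proof (rule integrable_const_bound[of _ "c\<^sup>2"])
    have "(Z i \<omega>)\<^sup>2 \<le> c\<^sup>2" for \<omega>
      using power_mono[OF bound abs_ge_zero, where n=2] by simp
    then show "AE \<omega> in M. norm ((Z i \<omega>)\<^sup>2) \<le> c\<^sup>2" by simp
  qed simp
  show ?thesis
  proof (cases "v = 0")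
    case True
    have "AE \<omega> in M. (Z i \<omega>)\<^sup>2 = 0" for i
      using integral_nonneg_eq_0_iff_AE[OF sq[of i]] var[of i] True by simp
    then have "AE \<omega> in M. \<forall>i. Z i \<omega> = 0" unfolding AE_all_countable by simp
    then have "expectation (\<lambda>\<omega>. g ((\<Sum>i<n. Z i \<omega>) / sqrt n)) = expectation (\<lambda>\<omega>. g 0)" for n
      by (intro integral_cong_AE) (auto elim!: eventually_mono)
    moreover interpret N: real_distribution std_normal_distribution by (rule real_dist_normal_dist)
    have "(\<integral>z. g (sqrt v * z) \<partial>std_normal_distribution) = g 0"
      using True N.prob_space by simp
    ultimately show ?thesis by (simp add: prob_space)
  next
    case False
    define \<sigma> where "\<sigma> = sqrt v"
    have \<sigma>: "\<sigma> > 0" "\<sigma>\<^sup>2 = v" using v False by (auto simp: \<sigma>_def)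
    have wc: "weak_conv_m (\<lambda>n. distr M borel (\<lambda>x. (\<Sum>i<n. Z i x) / sqrt (n * \<sigma>\<^sup>2))) std_normal_distribution"
      using mean var \<sigma> distr sq by (intro central_limit_theorem_zero_mean[OF indep]) auto
    have rd: "real_distribution (distr M borel (\<lambda>x. (\<Sum>i<n. Z i x) / sqrt (n * \<sigma>\<^sup>2)))" for n
      by (intro real_distribution_distr) auto
    have "isCont (\<lambda>x. \<sigma> * x) x" for x by (intro continuous_intros)
    then have gc: "isCont (\<lambda>x. g (\<sigma> * x)) x" for x using g(1) by (rule isCont_o2)
    have "(\<lambda>n. integral\<^sup>L (distr M borel (\<lambda>x. (\<Sum>i<n. Z i x) / sqrt (n * \<sigma>\<^sup>2))) (\<lambda>x. g (\<sigma> * x)))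
        \<longlonglongrightarrow> integral\<^sup>L std_normal_distribution (\<lambda>x. g (\<sigma> * x))"
      using weak_conv_imp_integral_bdd_continuous_conv[OF rd real_dist_normal_dist wc gc, where B = B] g(2) by simp
    moreover have "integral\<^sup>L (distr M borel (\<lambda>x. (\<Sum>i<n. Z i x) / sqrt (n * \<sigma>\<^sup>2))) (\<lambda>x. g (\<sigma> * x)) =
        expectation (\<lambda>\<omega>. g ((\<Sum>i<n. Z i \<omega>) / sqrt n))" for n
      using \<sigma>(1) by (subst integral_distr) (auto simp: real_sqrt_mult field_simps)
    ultimately show ?thesis by (simp add: \<sigma>_def)
  qed
qed

lemma sum_square_double:
  fixes a :: "'i \<Rightarrow> real" shows "(\<Sum>u\<in>J. a u)\<^sup>2 = (\<Sum>u\<in>J. \<Sum>w\<in>J. a u * a w)"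
  by (simp add: power2_eq_square sum_product)

text \<open>The Gaussian law of a linear combination comes with unknown \<open>\<mu>\<close> and
  \<open>\<sigma>\<close>; they are read off from the mean and covariance of the bridge. Square
  integrability has to come from the law of a single coordinate: a non-integrable function has
  integral \<open>0\<close>, so the moment conditions alone would not show it.\<close>

lemma bridge_sum_cos:
  assumes bridge: "standard_brownian_bridge N U" and J: "finite J" "J \<subseteq> {0..1}"
  shows "(\<integral>\<omega>. cos ((\<Sum>t\<in>J. c t * U t \<omega>) + b) \<partial>N) =
      cos b * exp (- (\<Sum>s\<in>J. \<Sum>t\<in>J. c s * c t * (min s t - s * t)) / 2)"
    and "t \<in> {0..1} \<Longrightarrow> integrable N (\<lambda>\<omega>. (U t \<omega>)\<^sup>2)"
proof -
  interpret N: prob_space N using bridge by (simp add: standard_brownian_bridge_def)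
  interpret S: real_distribution std_normal_distribution by (rule real_dist_normal_dist)
  have meas: "U t \<in> borel_measurable N" if "t \<in> {0..1}" for t
    using bridge that by (auto simp: standard_brownian_bridge_def gaussian_process_def)
  have gauss: "\<exists>\<mu> \<sigma>. distr N borel (\<lambda>\<omega>. \<Sum>t\<in>J. c t * U t \<omega>) = normal_law \<mu> \<sigma>"
    if "finite J" "J \<subseteq> {0..1}" for J c
    using bridge that by (simp add: standard_brownian_bridge_def gaussian_process_def)
  have mean: "(\<integral>\<omega>. U t \<omega> \<partial>N) = 0" if "t \<in> {0..1}" for t
    using bridge that by (simp add: standard_brownian_bridge_def)
  have cov: "(\<integral>\<omega>. U s \<omega> * U t \<omega> \<partial>N) = min s t - s * t" if "s \<in> {0..1}" "t \<in> {0..1}" for s t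
    using bridge that by (simp add: standard_brownian_bridge_def)
  have mom: "integrable std_normal_distribution (\<lambda>z. (\<mu> + \<sigma> * z) ^ 2)" for \<mu> \<sigma> :: real
    using integrable_std_normal_distribution_moment[of 1] integrable_std_normal_distribution_moment[of 2]
    by (simp add: power2_sum power_mult_distrib mult.assoc)
  show sq: "integrable N (\<lambda>\<omega>. (U t \<omega>)\<^sup>2)" if t: "t \<in> {0..1}" for t
  proof -
    obtain \<mu> \<sigma> where "distr N borel (\<lambda>\<omega>. \<Sum>t\<in>{t}. 1 * U t \<omega>) = normal_law \<mu> \<sigma>"
      using gauss[of "{t}" "\<lambda>_. 1"] t by blast
    then have eq: "distr N borel (U t) = distr std_normal_distribution borel (\<lambda>z. \<mu> + \<sigma> * z)"
      by (simp add: normal_law_def)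
    have "integrable (distr std_normal_distribution borel (\<lambda>z. \<mu> + \<sigma> * z)) (\<lambda>x. x\<^sup>2)"
      using mom by (subst integrable_distr_eq) auto
    then have "integrable (distr N borel (U t)) (\<lambda>x. x\<^sup>2)" by (simp only: eq)
    then show ?thesis using meas[OF t] by (subst (asm) integrable_distr_eq) auto
  qed
  have int: "integrable N (U t)" if "t \<in> {0..1}" for t
    using N.square_integrable_imp_integrable[OF meas sq] that by blast
  have int2: "integrable N (\<lambda>\<omega>. U s \<omega> * U t \<omega>)" if "s \<in> {0..1}" "t \<in> {0..1}" for s t
  proof (rule Bochner_Integration.integrable_bound)
    show "integrable N (\<lambda>\<omega>. (U s \<omega>)\<^sup>2 + (U t \<omega>)\<^sup>2)" using sq that by auto
    have "\<bar>x * y\<bar> \<le> x\<^sup>2 + y\<^sup>2" for x y :: real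
      using sum_squares_bound[of "\<bar>x\<bar>" "\<bar>y\<bar>"] mult_nonneg_nonneg[of "\<bar>x\<bar>" "\<bar>y\<bar>"]
      unfolding abs_mult mult.assoc power2_abs by linarith
    then show "AE \<omega> in N. norm (U s \<omega> * U t \<omega>) \<le> norm ((U s \<omega>)\<^sup>2 + (U t \<omega>)\<^sup>2)" by simp
  qed (use meas that in auto)
  define V where "V \<omega> = (\<Sum>t\<in>J. c t * U t \<omega>)" for \<omega>
  have inJ: "t \<in> {0..1}" if "t \<in> J" for t using that J by auto
  have Vm: "V \<in> borel_measurable N" unfolding V_def using meas inJ by (auto intro!: borel_measurable_sum)
  obtain \<mu> \<sigma> where "distr N borel V = normal_law \<mu> \<sigma>"
    using gauss[OF J, of c] unfolding V_def by blast
  then have eq: "distr N borel V = distr std_normal_distribution borel (\<lambda>z. \<mu> + \<sigma> * z)"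
    by (simp add: normal_law_def)
  have trans: "(\<integral>\<omega>. h (V \<omega>) \<partial>N) = (\<integral>z. h (\<mu> + \<sigma> * z) \<partial>std_normal_distribution)"
    if "h \<in> borel_measurable borel" for h :: "real \<Rightarrow> real"
  proof -
    have "(\<integral>\<omega>. h (V \<omega>) \<partial>N) = integral\<^sup>L (distr N borel V) h"
      using Vm that by (subst integral_distr) auto
    also have "\<dots> = (\<integral>z. h (\<mu> + \<sigma> * z) \<partial>std_normal_distribution)"
      unfolding eq using that by (subst integral_distr) auto
    finally show ?thesis .
  qed
  have z1: "(\<integral>z. z \<partial>std_normal_distribution) = 0" "integrable std_normal_distribution (\<lambda>z. z)"
    using integral_std_normal_distribution_moment_odd[of 1] integrable_std_normal_distribution_moment[of 1] by auto
  have z2: "(\<integral>z. z\<^sup>2 \<partial>std_normal_distribution) = 1" "integrable std_normal_distribution (\<lambda>z. z\<^sup>2)"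
    using std_normal_distribution_even_moments[of 1] by auto
  have "(\<integral>\<omega>. V \<omega> \<partial>N) = 0"
    unfolding V_def using int mean inJ by (subst Bochner_Integration.integral_sum) auto
  moreover have "(\<integral>\<omega>. V \<omega> \<partial>N) = (\<integral>z. \<mu> + \<sigma> * z \<partial>std_normal_distribution)"
    by (rule trans) simp
  moreover have "(\<integral>z. \<mu> + \<sigma> * z \<partial>std_normal_distribution) =
      (\<integral>z. \<mu> \<partial>std_normal_distribution) + (\<integral>z. \<sigma> * z \<partial>std_normal_distribution)"
    using z1(2) by (intro Bochner_Integration.integral_add) auto
  moreover have "\<dots> = \<mu>" using z1(1) S.prob_space by simp
  ultimately have \<mu>: "\<mu> = 0" by simp
  have "(\<integral>\<omega>. (V \<omega>)\<^sup>2 \<partial>N) = (\<integral>\<omega>. (\<Sum>s\<in>J. \<Sum>t\<in>J. c s * c t * (U s \<omega> * U t \<omega>)) \<partial>N)"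
    unfolding V_def sum_square_double by (simp add: mult_ac)
  also have "\<dots> = (\<Sum>s\<in>J. \<integral>\<omega>. (\<Sum>t\<in>J. c s * c t * (U s \<omega> * U t \<omega>)) \<partial>N)"
    by (intro Bochner_Integration.integral_sum Bochner_Integration.integrable_sum integrable_mult_right int2 inJ)
  also have "\<dots> = (\<Sum>s\<in>J. \<Sum>t\<in>J. \<integral>\<omega>. c s * c t * (U s \<omega> * U t \<omega>) \<partial>N)"
    by (intro sum.cong refl Bochner_Integration.integral_sum integrable_mult_right int2 inJ)
  also have "\<dots> = (\<Sum>s\<in>J. \<Sum>t\<in>J. c s * c t * (min s t - s * t))"
    by (intro sum.cong refl) (simp only: integral_mult_right_zero cov[OF inJ inJ])
  finally have "(\<Sum>s\<in>J. \<Sum>t\<in>J. c s * c t * (min s t - s * t)) = \<sigma>\<^sup>2"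
    using trans[of "\<lambda>x. x\<^sup>2"] z2 by (simp add: \<mu> power_mult_distrib)
  moreover have "(\<integral>\<omega>. cos (V \<omega> + b) \<partial>N) = cos b * exp (- \<sigma>\<^sup>2 / 2)"
    using trans[of "\<lambda>x. cos (x + b)"] integral_cos_std_normal[of \<sigma> b] by (simp add: \<mu>)
  ultimately show "(\<integral>\<omega>. cos ((\<Sum>t\<in>J. c t * U t \<omega>) + b) \<partial>N) =
      cos b * exp (- (\<Sum>s\<in>J. \<Sum>t\<in>J. c s * c t * (min s t - s * t)) / 2)"
    by (simp add: V_def)
qed

context density_sample
begin

text \<open>A linear combination of the process is a normalized sum of the bounded function
  \<open>\<phi>\<close> over independent observations. The product of two centred indicators
  integrates to the bridge covariance at the times \<open>F u\<close> and \<open>F w\<close>;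
  \<open>v\<close> is the integral of a square.\<close>

lemma emp_process_fdd:
  fixes c :: "real \<Rightarrow> real"
  assumes J: "finite J" and g: "\<And>x. isCont g x" "\<And>x. \<bar>g x\<bar> \<le> (B::real)"
  defines "v \<equiv> (\<Sum>u\<in>J. \<Sum>w\<in>J. c u * c w * (min (F u) (F w) - F u * F w))"
  shows "(\<lambda>n. expectation (\<lambda>\<omega>. g (\<Sum>u\<in>J. c u * emp_process n \<omega> u))) \<longlonglongrightarrow>
    (\<integral>z. g (sqrt v * z) \<partial>std_normal_distribution)"
    and "0 \<le> v"
proof -
  define \<phi> where "\<phi> x = (\<Sum>u\<in>J. c u * (indicator {..u} x - F u))" for x :: real
  have [measurable]: "\<phi> \<in> borel_measurable borel" unfolding \<phi>_def by measurable
  have \<phi>_bound: "\<bar>\<phi> x\<bar> \<le> (\<Sum>u\<in>J. \<bar>c u\<bar>)" for x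
  proof -
    have "\<bar>\<phi> x\<bar> \<le> (\<Sum>u\<in>J. \<bar>c u * (indicator {..u} x - F u)\<bar>)" unfolding \<phi>_def by (rule sum_abs)
    also have "\<dots> \<le> (\<Sum>u\<in>J. \<bar>c u\<bar>)"
    proof (rule sum_mono)
      fix u
      have "\<bar>indicator {..u} x - F u\<bar> \<le> 1" using F(2)[of u] F(3)[of u] by (auto simp: indicator_def)
      then show "\<bar>c u * (indicator {..u} x - F u)\<bar> \<le> \<bar>c u\<bar>"
        unfolding abs_mult by (intro mult_left_le) auto
    qed
    finally show ?thesis .
  qed
  have iQ: "integrable Q (indicator A :: real \<Rightarrow> real)" if "A \<in> sets borel" for A
    using that by (intro Q.integrable_const_bound[of _ 1]) (auto simp: indicator_def)
  have Qsp: "measure Q UNIV = 1" using Q.prob_space by simp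
  have "(\<integral>x. \<phi> x \<partial>Q) = (\<Sum>u\<in>J. c u * (\<integral>x. indicator {..u} x - F u \<partial>Q))"
    unfolding \<phi>_def using iQ by (subst Bochner_Integration.integral_sum) auto
  also have "\<dots> = 0" using iQ by (simp add: Qsp F_eq)
  finally have mean: "(\<integral>x. \<phi> x \<partial>Q) = 0" .
  have prod: "(\<integral>x. (indicator {..u} x - F u) * (indicator {..w} x - F w) \<partial>Q) = min (F u) (F w) - F u * F w"
    and iprod: "integrable Q (\<lambda>x. (indicator {..u} x - F u) * (indicator {..w} x - F w))" for u w
  proof -
    have eq: "(indicator {..u} x - F u) * (indicator {..w} x - F w) =
      indicator {..min u w} x - F w * indicator {..u} x - F u * indicator {..w} x + F u * F w" for x
      by (auto simp: indicator_def algebra_simps)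
    have min: "F (min u w) = min (F u) (F w)" by (simp add: min_of_mono F(1))
    show "(\<integral>x. (indicator {..u} x - F u) * (indicator {..w} x - F w) \<partial>Q) = min (F u) (F w) - F u * F w"
      unfolding eq min[symmetric] using iQ by (simp add: Qsp F_eq)
    show "integrable Q (\<lambda>x. (indicator {..u} x - F u) * (indicator {..w} x - F w))"
      unfolding eq using iQ by auto
  qed
  have "(\<integral>x. (\<phi> x)\<^sup>2 \<partial>Q) =
    (\<integral>x. (\<Sum>u\<in>J. \<Sum>w\<in>J. c u * c w * ((indicator {..u} x - F u) * (indicator {..w} x - F w))) \<partial>Q)"
    unfolding \<phi>_def sum_square_double by (simp add: mult_ac)
  also have "\<dots> = (\<Sum>u\<in>J. \<Sum>w\<in>J. c u * c w * (\<integral>x. (indicator {..u} x - F u) * (indicator {..w} x - F w) \<partial>Q))"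
    using iprod by simp
  also have "\<dots> = v" by (simp add: prod v_def)
  finally have var: "(\<integral>x. (\<phi> x)\<^sup>2 \<partial>Q) = v" .
  have "(\<lambda>n. expectation (\<lambda>\<omega>. g ((\<Sum>i<n. \<phi> (X i \<omega>)) / sqrt n))) \<longlonglongrightarrow>
    (\<integral>z. g (sqrt v * z) \<partial>std_normal_distribution)"
  proof (rule central_limit_test_function[where c = "\<Sum>u\<in>J. \<bar>c u\<bar>" and \<mu> = "distr Q borel \<phi>"])
    show "indep_vars (\<lambda>_. borel) (\<lambda>i \<omega>. \<phi> (X i \<omega>)) UNIV"
      using indep by (rule indep_vars_compose2) measurable
    show "distr M borel (\<lambda>\<omega>. \<phi> (X i \<omega>)) = distr Q borel \<phi>" for i
      unfolding distr_X[of i, symmetric] by (subst distr_distr) (auto simp: comp_def)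
    show "expectation (\<lambda>\<omega>. \<phi> (X i \<omega>)) = 0" for i
      using expectation_X[of \<phi> i] mean by simp
    show "expectation (\<lambda>\<omega>. (\<phi> (X i \<omega>))\<^sup>2) = v" for i
      using expectation_X[of "\<lambda>x. (\<phi> x)\<^sup>2" i] var by simp
  qed (use \<phi>_bound g in auto)
  moreover have "(\<Sum>u\<in>J. c u * emp_process n \<omega> u) = (\<Sum>i<n. \<phi> (X i \<omega>)) / sqrt n" for n \<omega>
    unfolding emp_process_eq emp_sum_def \<phi>_def F_eq
    by (subst sum.swap) (simp add: sum_divide_distrib sum_distrib_left)
  ultimately show "(\<lambda>n. expectation (\<lambda>\<omega>. g (\<Sum>u\<in>J. c u * emp_process n \<omega> u))) \<longlonglongrightarrow>
    (\<integral>z. g (sqrt v * z) \<partial>std_normal_distribution)" by simp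
  show "0 \<le> v" unfolding var[symmetric] by simp
qed

text \<open>The Cramer-Wold device with the process values on \<open>S\<close> as coordinates,
  numbered by naturals to obtain a countable index type. Injectivity of \<open>F\<close> on
  \<open>S\<close> turns a linear combination over \<open>S\<close> into one over distinct bridge
  times.\<close>

lemma minmax_slope_emp_process_tendsto:
  assumes S: "finite S" "S \<subseteq> {0..}" "inj_on F S" "{u\<in>S. u < x} \<noteq> {}" "{v\<in>S. x < v} \<noteq> {}"
    and bridge: "standard_brownian_bridge N U"
    and \<psi>: "continuous_on UNIV \<psi>" "\<And>y. \<bar>\<psi> y\<bar> \<le> (B::real)"
  shows "(\<lambda>n. expectation (\<lambda>\<omega>. \<psi> (minmax_slope S x (emp_process n \<omega>)))) \<longlonglongrightarrow>
    (\<integral>\<omega>. \<psi> (minmax_slope S x (\<lambda>u. U (F u) \<omega>)) \<partial>N)"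
proof -
  interpret N: prob_space N using bridge by (simp add: standard_brownian_bridge_def)
  obtain idx :: "real \<Rightarrow> nat" where idx: "inj_on idx S"
    using finite_imp_inj_to_nat_seg[OF S(1)] by blast
  define J where "J = idx ` S"
  define pt where "pt = the_inv_into S idx"
  have pt: "pt (idx u) = u" if "u \<in> S" for u using idx that by (simp add: pt_def the_inv_into_f_f)
  have ptS: "pt j \<in> S" if "j \<in> J" for j using that pt by (auto simp: J_def)
  define H where "H n \<omega> j = (if j \<in> J then emp_process n \<omega> (pt j) else 0)" for n \<omega> j
  define W where "W \<omega> j = (if j \<in> J then U (F (pt j)) \<omega> else 0)" for \<omega> j
  define f where "f z = \<psi> (minmax_slope S x (\<lambda>u. z (idx u)))" for z :: "nat \<Rightarrow> real"
  have fH: "f (H n \<omega>) = \<psi> (minmax_slope S x (emp_process n \<omega>))" for n \<omega>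
    unfolding f_def by (intro arg_cong[where f = \<psi>] minmax_slope_cong) (auto simp: H_def J_def pt)
  have fW: "f (W \<omega>) = \<psi> (minmax_slope S x (\<lambda>u. U (F u) \<omega>))" for \<omega>
    unfolding f_def by (intro arg_cong[where f = \<psi>] minmax_slope_cong) (auto simp: W_def J_def pt)
  have F01: "F u \<in> {0..1}" for u using F(2,3) by auto
  have \<psi>_meas: "\<psi> \<in> borel_measurable borel" using \<psi>(1) by (rule borel_measurable_continuous_onI)
  have emp_meas [measurable]: "(\<lambda>\<omega>. emp_process n \<omega> u) \<in> borel_measurable M" for n u
    unfolding emp_process_eq emp_sum_def by measurable
  have U_meas: "U (F u) \<in> borel_measurable N" for u
    using bridge F01[of u] by (auto simp: standard_brownian_bridge_def gaussian_process_def)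
  have emp2: "integrable M (\<lambda>\<omega>. (emp_process n \<omega> u)\<^sup>2) \<and> expectation (\<lambda>\<omega>. (emp_process n \<omega> u)\<^sup>2) \<le> 1" for n u
  proof (cases "n = 0")
    case False
    then show ?thesis using emp_sum_moments(1,3)[of "{..u}" n] F(3)[of u]
      by (auto simp: emp_process_eq F_eq[symmetric])
  qed (simp add: emp_process_def)
  have conv: "(\<lambda>n. \<integral>\<omega>. cos ((\<Sum>j\<in>J. c j * H n \<omega> j) + b) \<partial>M) \<longlonglongrightarrow>
      (\<integral>\<omega>. cos ((\<Sum>j\<in>J. c j * W \<omega> j) + b) \<partial>N)" for c b
  proof -
    define v where "v = (\<Sum>u\<in>S. \<Sum>w\<in>S. c (idx u) * c (idx w) * (min (F u) (F w) - F u * F w))"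
    have v: "0 \<le> v" unfolding v_def by (rule emp_process_fdd(2)[OF S(1), where g = cos and B = 1]) auto
    have 1: "(\<Sum>j\<in>J. c j * H n \<omega> j) = (\<Sum>u\<in>S. c (idx u) * emp_process n \<omega> u)" for n \<omega>
      unfolding J_def by (subst sum.reindex[OF idx]) (auto simp: H_def J_def pt intro!: sum.cong)
    have "(\<Sum>j\<in>J. c j * W \<omega> j) = (\<Sum>u\<in>S. c (idx u) * U (F u) \<omega>)" for \<omega>
      unfolding J_def by (subst sum.reindex[OF idx]) (auto simp: W_def J_def pt intro!: sum.cong)
    also have "(\<Sum>u\<in>S. c (idx u) * U (F u) \<omega>) = (\<Sum>t\<in>F ` S. c (idx (the_inv_into S F t)) * U t \<omega>)" for \<omega>
      by (subst sum.reindex[OF S(3)]) (auto simp: the_inv_into_f_f[OF S(3)] intro!: sum.cong)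
    finally have 2: "(\<Sum>j\<in>J. c j * W \<omega> j) = (\<Sum>t\<in>F ` S. c (idx (the_inv_into S F t)) * U t \<omega>)" for \<omega> .
    have "(\<integral>\<omega>. cos ((\<Sum>j\<in>J. c j * W \<omega> j) + b) \<partial>N) = cos b * exp (- (\<Sum>s\<in>F ` S. \<Sum>t\<in>F ` S.
        c (idx (the_inv_into S F s)) * c (idx (the_inv_into S F t)) * (min s t - s * t)) / 2)"
      unfolding 2 using S(1) F01 by (intro bridge_sum_cos(1)[OF bridge]) auto
    also have "(\<Sum>s\<in>F ` S. \<Sum>t\<in>F ` S.
        c (idx (the_inv_into S F s)) * c (idx (the_inv_into S F t)) * (min s t - s * t)) = v"
      unfolding v_def by (simp add: sum.reindex[OF S(3)] the_inv_into_f_f[OF S(3)])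
    finally have "(\<integral>\<omega>. cos ((\<Sum>j\<in>J. c j * W \<omega> j) + b) \<partial>N) = (\<integral>z. cos (sqrt v * z + b) \<partial>std_normal_distribution)"
      using v by (simp add: integral_cos_std_normal)
    moreover have "(\<lambda>n. expectation (\<lambda>\<omega>. cos ((\<Sum>u\<in>S. c (idx u) * emp_process n \<omega> u) + b))) \<longlonglongrightarrow>
      (\<integral>z. cos (sqrt v * z + b) \<partial>std_normal_distribution)"
      unfolding v_def by (intro emp_process_fdd(1)[OF S(1), where B = 1 and g = "\<lambda>y. cos (y + b)"])
        (auto intro!: continuous_intros)
    ultimately show ?thesis by (simp add: 1)
  qed
  have cont: "continuous_on UNIV f"
  proof -
    have "continuous_on UNIV (\<lambda>z u. z (idx u) :: real)"
      by (intro continuous_on_coordinatewise_then_product continuous_on_product_coordinates)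
    from continuous_on_compose2[OF continuous_on_minmax_slope[OF S(1,4,5)] this]
    have "continuous_on UNIV (\<lambda>z. minmax_slope S x (\<lambda>u. z (idx u)))" by simp
    from continuous_on_compose2[OF \<psi>(1) this]
    show ?thesis unfolding f_def by simp
  qed
  have "(\<lambda>n. \<integral>\<omega>. f (H n \<omega>) \<partial>M) \<longlonglongrightarrow> (\<integral>\<omega>. f (W \<omega>) \<partial>N)"
  proof (rule cramer_wold[where J = J and V = 1 and B = B and f = f and H = H and U = W])
    show "prob_space M" "prob_space N" by unfold_locales
    show "finite J" using S(1) by (simp add: J_def)
    show "(\<lambda>\<omega>. H n \<omega> j) \<in> borel_measurable M" for n j unfolding H_def by measurable
    show "integrable M (\<lambda>\<omega>. (H n \<omega> j)\<^sup>2)" "(\<integral>\<omega>. (H n \<omega> j)\<^sup>2 \<partial>M) \<le> 1" if "j \<in> J" for n j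
      using emp2 that by (auto simp: H_def)
    show "(\<lambda>\<omega>. W \<omega> j) \<in> borel_measurable N" for j
      unfolding W_def using U_meas by (cases "j \<in> J") auto
    show "integrable N (\<lambda>\<omega>. (W \<omega> j)\<^sup>2)" if "j \<in> J" for j
      using bridge_sum_cos(2)[OF bridge, of "{}" "F (pt j)"] F01 that by (simp add: W_def)
    show "(\<integral>\<omega>. (W \<omega> j)\<^sup>2 \<partial>N) \<le> 1" if "j \<in> J" for j
    proof -
      have "(\<integral>\<omega>. U (F (pt j)) \<omega> * U (F (pt j)) \<omega> \<partial>N) = min (F (pt j)) (F (pt j)) - F (pt j) * F (pt j)"
        using bridge F01 by (simp add: standard_brownian_bridge_def)
      also have "\<dots> \<le> 1" using F(3)[of "pt j"] zero_le_square[of "F (pt j)"] by linarith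
      finally show ?thesis using that by (simp add: W_def power2_eq_square)
    qed
    show "\<bar>f z\<bar> \<le> B" for z using \<psi>(2) by (simp add: f_def)
    show "(\<lambda>\<omega>. f (H n \<omega>)) \<in> borel_measurable M" for n
      unfolding fH by (rule measurable_compose[OF measurable_minmax_slope[OF S(1) emp_meas] \<psi>_meas])
    show "(\<lambda>\<omega>. f (W \<omega>)) \<in> borel_measurable N"
      unfolding fW by (rule measurable_compose[OF measurable_minmax_slope[OF S(1) U_meas] \<psi>_meas])
  qed (use conv cont in \<open>auto simp: H_def W_def\<close>)
  then show ?thesis by (simp add: fH fW)
qed

end

section \<open>Approximation and measurability of the estimator\<close>

text \<open>The approximants may depend on the test function and the tolerance, and their limit
  \<open>y\<close> need only be near the target. Continuous steps suffice as tests; being uniformly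
  continuous with values in \<open>{0..1}\<close>, they convert closeness off a small event into
  closeness of integrals.\<close>

lemma weak_conv_m_approx:
  assumes M: "prob_space M" and N: "prob_space N"
    and D: "\<And>n. D n \<in> borel_measurable M" and D0: "D0 \<in> borel_measurable N"
    and approx: "\<And>\<psi> e. continuous_on UNIV \<psi> \<Longrightarrow> (\<And>x. \<bar>\<psi> x\<bar> \<le> (1::real)) \<Longrightarrow> 0 < e \<Longrightarrow>
      \<exists>Y y. (\<forall>n. Y n \<in> borel_measurable M) \<and> (\<lambda>n. \<integral>\<omega>. \<psi> (Y n \<omega>) \<partial>M) \<longlonglongrightarrow> y \<and>
        \<bar>y - (\<integral>\<omega>. \<psi> (D0 \<omega>) \<partial>N)\<bar> \<le> e \<and>
        (\<forall>\<^sub>F n in sequentially. \<exists>B\<in>sets M. measure M B \<le> e \<and>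
           (\<forall>\<omega>\<in>space M - B. \<bar>D n \<omega> - Y n \<omega>\<bar> \<le> e))"
  shows "weak_conv_m (\<lambda>n. distr M borel (D n)) (distr N borel D0)"
proof (rule integral_cts_step_conv_imp_weak_conv)
  interpret M: prob_space M by fact
  interpret N: prob_space N by fact
  show "real_distribution (distr M borel (D n))" for n using D by (intro M.real_distribution_distr)
  show "real_distribution (distr N borel D0)" using D0 by (intro N.real_distribution_distr)
  fix x y :: real assume xy: "x < y"
  define \<psi> where "\<psi> = cts_step x y"
  have uc: "uniformly_continuous_on UNIV \<psi>" unfolding \<psi>_def using xy by (rule cts_step_uniformly_continuous)
  then have cont: "continuous_on UNIV \<psi>" by (rule uniformly_continuous_imp_continuous)
  have \<psi>m: "\<psi> \<in> borel_measurable borel" using cont by (rule borel_measurable_continuous_onI)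
  have \<psi>01: "0 \<le> \<psi> z" "\<psi> z \<le> 1" for z using xy by (auto simp: \<psi>_def cts_step_def field_simps)
  then have \<psi>1: "\<bar>\<psi> z\<bar> \<le> 1" for z by simp
  have "(\<lambda>n. \<integral>\<omega>. \<psi> (D n \<omega>) \<partial>M) \<longlonglongrightarrow> (\<integral>\<omega>. \<psi> (D0 \<omega>) \<partial>N)"
  proof (rule LIMSEQ_I)
    fix r :: real assume r: "0 < r"
    obtain d where d: "0 < d" "\<And>z w. \<bar>z - w\<bar> < d \<Longrightarrow> \<bar>\<psi> z - \<psi> w\<bar> < r / 5"
      using uc r unfolding uniformly_continuous_on_def dist_real_def
      by (metis UNIV_I divide_pos_pos zero_less_numeral)
    \<comment> \<open>The errors add up to less than \<open>2 * r / 5 + 2 * e\<close>, which is at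
      most \<open>4 * r / 5\<close>.\<close>
    define e where "e = min (r / 5) (d / 2)"
    have e: "0 < e" "e \<le> r / 5" "e < d" using r d by (auto simp: e_def)
    obtain Y y where Y: "\<And>n. Y n \<in> borel_measurable M" "(\<lambda>n. \<integral>\<omega>. \<psi> (Y n \<omega>) \<partial>M) \<longlonglongrightarrow> y"
        "\<bar>y - (\<integral>\<omega>. \<psi> (D0 \<omega>) \<partial>N)\<bar> \<le> e"
        "\<forall>\<^sub>F n in sequentially. \<exists>B\<in>sets M. measure M B \<le> e \<and> (\<forall>\<omega>\<in>space M - B. \<bar>D n \<omega> - Y n \<omega>\<bar> \<le> e)"
      using approx[OF cont \<psi>1 e(1)] by blast
    have close: "\<bar>(\<integral>\<omega>. \<psi> (D n \<omega>) \<partial>M) - (\<integral>\<omega>. \<psi> (Y n \<omega>) \<partial>M)\<bar> \<le> r / 5 + e"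
      if B: "B \<in> sets M" "measure M B \<le> e" "\<And>\<omega>. \<omega> \<in> space M - B \<Longrightarrow> \<bar>D n \<omega> - Y n \<omega>\<bar> \<le> e" for n B
    proof -
      have int: "integrable M (\<lambda>\<omega>. \<psi> (D n \<omega>))" "integrable M (\<lambda>\<omega>. \<psi> (Y n \<omega>))"
        using measurable_compose[OF D \<psi>m] measurable_compose[OF Y(1) \<psi>m] \<psi>1
        by (auto intro!: M.integrable_const_bound[of _ 1])
      have intB: "integrable M (indicator B :: _ \<Rightarrow> real)"
        using B(1) by (intro integrable_real_indicator) (auto simp: M.emeasure_eq_measure)
      have pt: "\<bar>\<psi> (D n \<omega>) - \<psi> (Y n \<omega>)\<bar> \<le> r / 5 + indicator B \<omega>" if "\<omega> \<in> space M" for \<omega>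
      proof (cases "\<omega> \<in> B")
        case True
        then show ?thesis using \<psi>01[of "D n \<omega>"] \<psi>01[of "Y n \<omega>"] r by (simp add: abs_le_iff)
      next
        case False
        then have "\<bar>D n \<omega> - Y n \<omega>\<bar> < d" using B(3)[of \<omega>] that e by auto
        from d(2)[OF this] show ?thesis using False by simp
      qed
      have "\<bar>(\<integral>\<omega>. \<psi> (D n \<omega>) \<partial>M) - (\<integral>\<omega>. \<psi> (Y n \<omega>) \<partial>M)\<bar> = \<bar>\<integral>\<omega>. \<psi> (D n \<omega>) - \<psi> (Y n \<omega>) \<partial>M\<bar>"
        using int by simp
      also have "\<dots> \<le> (\<integral>\<omega>. \<bar>\<psi> (D n \<omega>) - \<psi> (Y n \<omega>)\<bar> \<partial>M)" by (rule integral_abs_bound)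
      also have "\<dots> \<le> (\<integral>\<omega>. r / 5 + indicator B \<omega> \<partial>M)"
        using int intB pt by (intro integral_mono) auto
      also have "\<dots> = r / 5 + measure M B"
        using intB B(1) by (simp add: M.prob_space sets.sets_into_space Int_absorb2)
      finally show ?thesis using B(2) by simp
    qed
    have "\<forall>\<^sub>F n in sequentially. \<bar>(\<integral>\<omega>. \<psi> (Y n \<omega>) \<partial>M) - y\<bar> < r / 5"
      using tendstoD[OF Y(2), of "r / 5"] r by (simp add: dist_real_def)
    with Y(4) have "\<forall>\<^sub>F n in sequentially. norm ((\<integral>\<omega>. \<psi> (D n \<omega>) \<partial>M) - (\<integral>\<omega>. \<psi> (D0 \<omega>) \<partial>N)) < r"
    proof eventually_elim
      case (elim n)
      then have "\<bar>(\<integral>\<omega>. \<psi> (D n \<omega>) \<partial>M) - (\<integral>\<omega>. \<psi> (Y n \<omega>) \<partial>M)\<bar> \<le> r / 5 + e" using close by blast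
      then show ?case using elim(2) Y(3) e(2) r unfolding real_norm_def by linarith
    qed
    then show "\<exists>n0. \<forall>n\<ge>n0. norm ((\<integral>\<omega>. \<psi> (D n \<omega>) \<partial>M) - (\<integral>\<omega>. \<psi> (D0 \<omega>) \<partial>N)) < r"
      by (simp add: eventually_sequentially)
  qed
  moreover have "integral\<^sup>L (distr M borel (D n)) (cts_step x y) = (\<integral>\<omega>. \<psi> (D n \<omega>) \<partial>M)" for n
    unfolding \<psi>_def[symmetric] using D \<psi>m by (rule integral_distr)
  moreover have "integral\<^sup>L (distr N borel D0) (cts_step x y) = (\<integral>\<omega>. \<psi> (D0 \<omega>) \<partial>N)"
    unfolding \<psi>_def[symmetric] using D0 \<psi>m by (rule integral_distr)
  ultimately show "(\<lambda>n. integral\<^sup>L (distr M borel (D n)) (cts_step x y)) \<longlonglongrightarrow>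
      integral\<^sup>L (distr N borel D0) (cts_step x y)" by simp
qed

lemma concave_on_supporting_line:
  fixes L :: "real \<Rightarrow> real"
  assumes "concave_on I L" "x \<in> interior I"
  obtains \<tau> where "\<And>u. u \<in> I \<Longrightarrow> L u \<le> L x + \<tau> * (u - x)"
proof -
  have conv: "convex_on I (\<lambda>x. - L x)" using assms(1) by (simp add: concave_on_def)
  show thesis
  proof (rule that)
    fix u assume "u \<in> I"
    from convex_le_Inf_differential[OF conv assms(2) this]
    show "L u \<le> L x + (- Inf ((\<lambda>t. (- L x - - L t) / (x - t)) ` ({x<..} \<inter> I))) * (u - x)"
      by simp
  qed
qed

section \<open>Measurability of the estimator at a point\<close>

context density_sample
begin

abbreviation Fn where "Fn \<equiv> emp_distr_fun X"

lemma emp_distr_fun_mono: "u \<le> v \<Longrightarrow> Fn n \<omega> u \<le> Fn n \<omega> v"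
  unfolding emp_distr_fun_def by (intro divide_right_mono sum_mono) (auto simp: indicator_def)

lemma emp_distr_fun_le_1: "Fn n \<omega> u \<le> 1"
proof (cases "n = 0")
  case False
  have "(\<Sum>i<n. indicator {..u} (X i \<omega>)) \<le> (\<Sum>i<n. 1 :: real)"
    by (intro sum_mono) (auto simp: indicator_def)
  then show ?thesis using False by (simp add: emp_distr_fun_def divide_le_eq)
qed (simp add: emp_distr_fun_def)

lemma emp_lcm_majorant:
  defines "L \<equiv> \<lambda>n \<omega>. least_concave_majorant {0..} (\<lambda>u. ereal (Fn n \<omega> u))"
  shows "L n \<omega> \<in> concave_majorants {0..} (\<lambda>u. ereal (Fn n \<omega> u))"
    and "0 \<le> x \<Longrightarrow> bdd_below ((\<lambda>h. h x) ` concave_majorants {0..} (\<lambda>u. ereal (Fn n \<omega> u)))"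
proof -
  show bdd: "bdd_below ((\<lambda>h. h x) ` concave_majorants {0..} (\<lambda>u. ereal (Fn n \<omega> u)))" if "0 \<le> x" for x
    using that by (intro bdd_below_concave_majorants[of x _ x]) auto
  have "(\<lambda>_. 1) \<in> concave_majorants {0..} (\<lambda>u. ereal (Fn n \<omega> u))"
    using emp_distr_fun_le_1 affine_concave_on[of "{0..}" 1 0] by (auto simp: concave_majorants_def)
  then have ne: "concave_majorants {0..} (\<lambda>u. ereal (Fn n \<omega> u)) \<noteq> {}" by auto
  show "L n \<omega> \<in> concave_majorants {0..} (\<lambda>u. ereal (Fn n \<omega> u))"
    unfolding L_def using ne bdd by (intro least_concave_majorant_in_concave_majorants) auto
qed

text \<open>Reduces the majorant to countably many conditions, for measurability. A supporting line
  at \<open>x\<close> is raised to rational coefficients. Conversely, a line that dominates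
  \<open>Fn\<close> at rational points does so everywhere, because \<open>Fn\<close> is
  nondecreasing and the line changes little on the way to a rational point just to the
  right.\<close>

lemma emp_lcm_less_iff:
  assumes x: "0 < x"
  shows "least_concave_majorant {0..} (\<lambda>u. ereal (Fn n \<omega> u)) x < y \<longleftrightarrow>
    (\<exists>\<alpha>\<in>\<rat>. \<exists>\<tau>\<in>\<rat>. \<alpha> + \<tau> * x < y \<and> (\<forall>u\<in>\<rat>. 0 \<le> u \<longrightarrow> Fn n \<omega> u \<le> \<alpha> + \<tau> * u))"
    (is "?L x < y \<longleftrightarrow> ?rhs")
proof
  note maj = emp_lcm_majorant(1)[of n \<omega>]
  have L: "concave_on {0..} ?L" and ge: "\<And>u. 0 \<le> u \<Longrightarrow> Fn n \<omega> u \<le> ?L u"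
    using maj by (auto simp: concave_majorants_def)
  assume less: "?L x < y"
  obtain \<tau>0 where \<tau>0: "\<And>u. u \<in> {0..} \<Longrightarrow> ?L u \<le> ?L x + \<tau>0 * (u - x)"
    using concave_on_supporting_line[OF L, of x] x by (auto simp: interior_real_atLeast)
  define e where "e = (y - ?L x) / 2"
  have e: "0 < e" using less by (simp add: e_def)
  \<comment> \<open>Both coefficients are only increased, so the line stays above on the half-line;
    together the increases cost less than \<open>2 * e\<close>, which is \<open>y - ?L x\<close>, at
    the point \<open>x\<close>.\<close>
  obtain \<tau> where \<tau>: "\<tau> \<in> \<rat>" "\<tau>0 < \<tau>" "\<tau> < \<tau>0 + e / x"
    using Rats_dense_in_real[of \<tau>0 "\<tau>0 + e / x"] e x by auto
  obtain \<alpha> where \<alpha>: "\<alpha> \<in> \<rat>" "?L x - \<tau>0 * x < \<alpha>" "\<alpha> < ?L x - \<tau>0 * x + e"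
    using Rats_dense_in_real[of "?L x - \<tau>0 * x" "?L x - \<tau>0 * x + e"] e by auto
  have "\<tau> * x < (\<tau>0 + e / x) * x" using \<tau>(3) x by (rule mult_strict_right_mono)
  then have "\<tau> * x < \<tau>0 * x + e" using x by (simp add: distrib_right)
  then have "\<alpha> + \<tau> * x < ?L x + 2 * e" using \<alpha>(3) by linarith
  moreover have "2 * e = y - ?L x" by (simp add: e_def)
  ultimately have lt: "\<alpha> + \<tau> * x < y" by linarith
  have "Fn n \<omega> u \<le> \<alpha> + \<tau> * u" if "0 \<le> u" for u
  proof -
    have "Fn n \<omega> u \<le> ?L x + \<tau>0 * (u - x)" using ge[OF that] \<tau>0[of u] that by auto
    also have "\<dots> = (?L x - \<tau>0 * x) + \<tau>0 * u" by (simp add: algebra_simps)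
    also have "\<dots> \<le> \<alpha> + \<tau> * u" using \<alpha> \<tau> that by (intro add_mono mult_right_mono) auto
    finally show ?thesis .
  qed
  then show ?rhs using lt \<alpha>(1) \<tau>(1) by blast
next
  assume ?rhs
  then obtain \<alpha> \<tau> where lt: "\<alpha> + \<tau> * x < y" and rat: "\<And>u. u \<in> \<rat> \<Longrightarrow> 0 \<le> u \<Longrightarrow> Fn n \<omega> u \<le> \<alpha> + \<tau> * u"
    by blast
  have "Fn n \<omega> u \<le> \<alpha> + \<tau> * u" if u: "0 \<le> u" for u
  proof (rule ccontr)
    assume "\<not> ?thesis"
    then have gap: "0 < Fn n \<omega> u - (\<alpha> + \<tau> * u)" by simp
    define e where "e = (Fn n \<omega> u - (\<alpha> + \<tau> * u)) / (\<bar>\<tau>\<bar> + 1)"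
    have e: "0 < e" using gap by (simp add: e_def)
    then obtain v where v: "v \<in> \<rat>" "u < v" "v < u + e" using Rats_dense_in_real[of u "u + e"] by auto
    have "\<tau> * (v - u) \<le> \<bar>\<tau>\<bar> * (v - u)" using v by (intro mult_right_mono) auto
    also have "\<dots> < (\<bar>\<tau>\<bar> + 1) * (v - u)" using v by (intro mult_strict_right_mono) auto
    also have "\<dots> \<le> (\<bar>\<tau>\<bar> + 1) * e" using v by (intro mult_left_mono) auto
    also have "\<dots> = Fn n \<omega> u - (\<alpha> + \<tau> * u)" by (simp add: e_def add_nonneg_eq_0_iff)
    finally have "\<alpha> + \<tau> * v < Fn n \<omega> u" by (simp add: algebra_simps)
    also have "\<dots> \<le> Fn n \<omega> v" using v by (intro emp_distr_fun_mono) auto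
    finally show False using rat[of v] v u by auto
  qed
  then have "(\<lambda>u. \<alpha> + \<tau> * u) \<in> concave_majorants {0..} (\<lambda>u. ereal (Fn n \<omega> u))"
    by (auto simp: concave_majorants_def affine_concave_on)
  then have "?L x \<le> \<alpha> + \<tau> * x"
    using x by (intro least_concave_majorant_least[OF emp_lcm_majorant(2), of x "\<lambda>u. \<alpha> + \<tau> * u"]) auto
  then show "?L x < y" using lt by simp
qed

text \<open>The left derivative is the limit of difference quotients along a fixed sequence
  approaching \<open>x\<close> from the left, and each quotient is measurable by the countable
  description of the majorant.\<close>

lemma grenander_measurable:
  assumes x: "0 < x"
  shows "(\<lambda>\<omega>. grenander X n \<omega> x) \<in> borel_measurable M"
proof -
  define L where "L \<omega> = least_concave_majorant {0..} (\<lambda>u. ereal (Fn n \<omega> u))" for \<omega>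
  have Fn_meas [measurable]: "(\<lambda>\<omega>. Fn n \<omega> u) \<in> borel_measurable M" for u
    unfolding emp_distr_fun_def by measurable
  have L_meas: "(\<lambda>\<omega>. L \<omega> z) \<in> borel_measurable M" if z: "0 < z" for z
    unfolding borel_measurable_iff_less
  proof
    fix y
    have c: "countable (\<rat> :: real set)" by (rule countable_rat)
    have "{\<omega> \<in> space M. L \<omega> z < y} = {\<omega>\<in>space M. \<exists>\<alpha>\<in>\<rat>. \<exists>\<tau>\<in>\<rat>. \<alpha> + \<tau> * z < y \<and>
        (\<forall>u\<in>\<rat>. 0 \<le> u \<longrightarrow> Fn n \<omega> u \<le> \<alpha> + \<tau> * u)}"
      unfolding L_def emp_lcm_less_iff[OF z] ..
    also have "\<dots> \<in> sets M"
      by (intro sets.sets_Collect_countable_Ex' sets.sets_Collect_countable_All' sets.sets_Collect_conj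
          sets.sets_Collect_imp c) measurable
    finally show "{\<omega> \<in> space M. L \<omega> z < y} \<in> sets M" .
  qed
  \<comment> \<open>The shift to \<open>k + 2\<close> keeps \<open>t k\<close> strictly positive,
    where \<open>L_meas\<close> applies.\<close>
  define t where "t k = x - x / real (k + 2)" for k :: nat
  have t: "0 < t k" "t k < x" for k
  proof -
    have "x / real (k + 2) \<le> x / 2" by (rule divide_left_mono) (use x in auto)
    moreover have "0 < x / real (k + 2)" using x by simp
    ultimately show "0 < t k" "t k < x" using x unfolding t_def by linarith+
  qed
  have t_lim: "t \<longlonglongrightarrow> x"
  proof -
    have "(\<lambda>k. x / real k) \<longlonglongrightarrow> 0" by (rule lim_const_over_n)
    from LIMSEQ_ignore_initial_segment[OF this, of 2] have "t \<longlonglongrightarrow> x - 0"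
      unfolding t_def[abs_def] by (intro tendsto_diff tendsto_const)
    then show ?thesis by simp
  qed
  then have "filterlim t (at_left x) sequentially"
    using t(2) by (auto simp: filterlim_at less_imp_neq intro!: always_eventually)
  moreover have "((\<lambda>u. (L \<omega> u - L \<omega> x) / (u - x)) \<longlongrightarrow> grenander X n \<omega> x) (at_left x)" for \<omega>
  proof -
    have "concave_on {0..} (L \<omega>)" using emp_lcm_majorant(1)[of n \<omega>] by (simp add: L_def concave_majorants_def)
    from concave_on_left_deriv(1)[OF this, of x] x
    have "(L \<omega> has_vector_derivative grenander X n \<omega> x) (at_left x)"
      by (simp add: interior_real_atLeast grenander_def gren_def L_def)
    then show ?thesis
      by (simp add: has_real_derivative_iff_has_vector_derivative[symmetric] has_field_derivative_iff)
  qed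
  ultimately have "(\<lambda>k. (L \<omega> (t k) - L \<omega> x) / (t k - x)) \<longlonglongrightarrow> grenander X n \<omega> x" for \<omega>
    by (rule filterlim_compose[rotated])
  then show ?thesis
    by (rule borel_measurable_LIMSEQ_real) (use L_meas t x in auto)
qed

end

section \<open>The contact set and the comparison of slopes\<close>

locale touching_line = density_sample +
  fixes x0 a b c s :: real
  assumes order: "0 < s" "0 \<le> a" "a < x0" "x0 < b"
    and lcm_line: "\<And>u. u \<in> {a..b} \<Longrightarrow> distr_fun_lcm f0 u = c + s * u"
    and below: "\<And>u. 0 \<le> u \<Longrightarrow> distr_fun f0 u \<le> c + s * u"
    and contact: "\<And>u. 0 \<le> u \<Longrightarrow> distr_fun f0 u = c + s * u \<longleftrightarrow> u \<in> {a..b} \<inter> wellspec_set f0"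
    and ends: "a \<in> wellspec_set f0" "b \<in> wellspec_set f0" and x0: "x0 \<notin> wellspec_set f0"
begin

definition K where "K = {a..b} \<inter> wellspec_set f0"

lemma K_line: "k \<in> K \<Longrightarrow> F k = c + s * k"
  using contact[of k] order by (auto simp: K_def)

lemma K_bounds: "k \<in> K \<Longrightarrow> 0 \<le> k \<and> a \<le> k \<and> k \<le> b"
  using order by (auto simp: K_def)

lemma ends_K: "a \<in> K" "b \<in> K"
  using ends order by (auto simp: K_def)

lemma compact_K: "compact K"
proof -
  have "K = {a..b} \<inter> {u. F u = c + s * u}"
    using contact order by (auto simp: K_def)
  moreover have "closed {u. F u = c + s * u}"
    by (intro closed_Collect_eq F(6) continuous_intros)
  ultimately show ?thesis by (simp add: compact_Int_closed)
qed

text \<open>The values on \<open>K\<close> lie on a line of positive slope. Distinct contact points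
  thus become distinct times of the bridge.\<close>

lemma inj_F_K: "inj_on F K"
  using K_line order by (auto simp: inj_on_def)

text \<open>\<open>K\<close> is closed and misses \<open>x0\<close>. This distance is the
  denominator in the slope estimates.\<close>

lemma gap: obtains d where "0 < d" "\<And>k. k \<in> K \<Longrightarrow> d \<le> \<bar>k - x0\<bar>"
proof -
  have "x0 \<notin> K" using x0 by (simp add: K_def)
  then obtain d where "d > 0" "\<forall>y\<in>K. d \<le> dist x0 y"
    using separate_point_closed[OF compact_imp_closed[OF compact_K]] by blast
  then show thesis using that[of d] by (auto simp: dist_real_def abs_minus_commute)
qed

text \<open>The left derivative lies between the chord slopes to \<open>a\<close> and to
  \<open>b\<close>, which both equal \<open>s\<close>.\<close>

lemma proj_density_eq: "proj_density f0 x0 = s"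
proof -
  have "distr_fun_lcm f0 \<in> concave_majorants {0..} (\<lambda>x. ereal (F x))" by (rule distr_fun_lcm_majorant(1)[OF density])
  then have conc: "concave_on {0..} (distr_fun_lcm f0)" by (simp add: concave_majorants_def)
  have int: "x0 \<in> interior {0..}" using order by (simp add: interior_real_atLeast)
  have "proj_density f0 x0 \<le> (distr_fun_lcm f0 x0 - distr_fun_lcm f0 a) / (x0 - a)"
    unfolding proj_density_def using order by (intro concave_on_left_deriv(2)[OF conc int]) auto
  also have "\<dots> = s" using order by (simp add: lcm_line field_simps)
  finally have 1: "proj_density f0 x0 \<le> s" .
  have "(distr_fun_lcm f0 b - distr_fun_lcm f0 x0) / (b - x0) \<le> proj_density f0 x0"
    unfolding proj_density_def using order by (intro concave_on_left_deriv(3)[OF conc int]) auto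
  moreover have "(distr_fun_lcm f0 b - distr_fun_lcm f0 x0) / (b - x0) = s" using order by (simp add: lcm_line field_simps)
  ultimately show ?thesis using 1 by simp
qed

text \<open>The ends \<open>a\<close> and \<open>b\<close> are demanded so that every net has points
  on both sides of \<open>x0\<close>.\<close>

definition fine_net :: "real \<Rightarrow> real set \<Rightarrow> bool" where
  "fine_net \<eta> S \<longleftrightarrow> finite S \<and> a \<in> S \<and> b \<in> S \<and> S \<subseteq> K \<and> (\<forall>k\<in>K. \<exists>k'\<in>S. \<bar>k - k'\<bar> < \<eta>)"

lemma fine_net_exists: assumes "0 < \<eta>" shows "\<exists>S. fine_net \<eta> S"
proof -
  obtain T where T: "finite T" "T \<subseteq> K" "K \<subseteq> (\<Union>x\<in>T. ball x \<eta>)"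
    using seq_compact_imp_totally_bounded[OF compact_imp_seq_compact[OF compact_K]] assms by metis
  have "fine_net \<eta> (T \<union> {a, b})"
    using T ends_K by (fastforce simp: fine_net_def dist_real_def abs_minus_commute)
  then show ?thesis ..
qed

lemma fine_net_sides:
  assumes "fine_net \<eta> S"
  shows "finite S" "x0 \<notin> S" "{u\<in>S. u < x0} \<noteq> {}" "{v\<in>S. x0 < v} \<noteq> {}" "S \<subseteq> K"
  using assms x0 order by (auto simp: fine_net_def K_def)

text \<open>On a bounded range the ratio \<open>q\<close> is continuous and positive on a compact
  set; far out \<open>F \<le> 1\<close> while the line grows. The weight \<open>1 + u\<close> is
  there because the penalty must later beat a term \<open>\<gamma> * u\<close> on the unbounded
  half-line.\<close>

lemma separation:
  assumes "0 < \<eta>"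
  obtains r where "0 < r" "\<And>u. 0 \<le> u \<Longrightarrow> (\<And>k. k \<in> K \<Longrightarrow> \<eta> \<le> \<bar>u - k\<bar>) \<Longrightarrow> F u + r * (1 + u) \<le> c + s * u"
proof -
  \<comment> \<open>Beyond \<open>B\<close>, half of the growth, \<open>s / 2 * u\<close>, already
    pays for \<open>1 - c + s / 2\<close>; the other half remains as the margin.\<close>
  define B where "B = \<bar>2 * (1 - c) / s\<bar> + 1"
  have large: "F u + (s / 2) * (1 + u) \<le> c + s * u" if "B \<le> u" for u
  proof -
    have "2 * (1 - c) / s + 1 \<le> u" using that unfolding B_def by linarith
    then have "s / 2 * (2 * (1 - c) / s + 1) \<le> s / 2 * u" using order by (intro mult_left_mono) auto
    moreover have "s / 2 * (2 * (1 - c) / s + 1) = 1 - c + s / 2" using order by (simp add: field_simps)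
    ultimately show ?thesis using F(3)[of u] by (simp add: field_simps)
  qed
  define C where "C = {0..B} \<inter> (\<Inter>k\<in>K. {u. \<eta> \<le> \<bar>u - k\<bar>})"
  have "closed (\<Inter>k\<in>K. {u. \<eta> \<le> \<bar>u - k\<bar>})"
    by (intro closed_INT ballI closed_Collect_le continuous_intros)
  then have cC: "compact C" unfolding C_def by (intro compact_Int_closed) auto
  define q where "q u = (c + s * u - F u) / (1 + u)" for u
  have q: "r \<le> q u \<longleftrightarrow> F u + r * (1 + u) \<le> c + s * u" if "0 \<le> u" for u r
    using that by (auto simp: q_def le_divide_eq)
  have cq: "continuous_on C q"
    unfolding q_def using continuous_on_subset[OF F(6)]
    by (intro continuous_intros) (auto simp: C_def)
  have qpos: "0 < q u" if "u \<in> C" for u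
  proof -
    have u: "0 \<le> u" "u \<notin> K" using that assms by (auto simp: C_def)
    then have "F u < c + s * u" using below[of u] contact[of u] by (auto simp: K_def less_le)
    then show ?thesis using u by (simp add: q_def)
  qed
  obtain m where m: "0 < m" "\<And>u. u \<in> C \<Longrightarrow> m \<le> q u"
  proof (cases "C = {}")
    case True
    then show thesis using that[of 1] by simp
  next
    case False
    then obtain u where "u \<in> C" "\<forall>v\<in>C. q u \<le> q v" using continuous_attains_inf[OF cC _ cq] by blast
    then show thesis using that[of "q u"] qpos by blast
  qed
  show thesis
  proof (rule that[of "min (s / 2) m"])
    show "0 < min (s / 2) m" using order m by simp
    fix u assume u: "0 \<le> u" "\<And>k. k \<in> K \<Longrightarrow> \<eta> \<le> \<bar>u - k\<bar>"
    show "F u + min (s / 2) m * (1 + u) \<le> c + s * u"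
    proof (cases "u \<le> B")
      case True
      then have "u \<in> C" using u by (auto simp: C_def)
      then show ?thesis using m(2)[of u] q[OF u(1), of "min (s / 2) m"] by auto
    next
      case False
      then have "s / 2 \<le> q u" using large[of u] q[OF u(1), of "s / 2"] by simp
      then show ?thesis using q[OF u(1), of "min (s / 2) m"] by auto
    qed
  qed
qed

text \<open>With \<open>\<gamma>\<close> the slope of the net, a line of slope
  \<open>s + \<gamma> / q\<close> lies above \<open>Fn\<close> and nearly touches it at two net
  points around \<open>x0\<close>. Then \<open>gren_near_slope\<close> gives an error of order
  \<open>1 / q\<close>, which the factor \<open>q\<close> removes. The mesh is fixed first;
  \<open>n\<close> is then chosen large against the penalty \<open>r\<close> belonging to
  it.\<close>

lemma emp_slope_approx:
  assumes \<epsilon>: "0 < \<epsilon>"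
  obtains \<eta> where "0 < \<eta>" "\<And>S. fine_net \<eta> S \<Longrightarrow>
    \<forall>\<^sub>F n in sequentially. \<exists>B\<in>events. prob B \<le> \<epsilon> \<and>
      (\<forall>\<omega>\<in>space M - B. \<bar>sqrt n * (grenander X n \<omega> x0 - s) - minmax_slope S x0 (emp_process n \<omega>)\<bar> \<le> \<epsilon>)"
proof -
  obtain d where d: "0 < d" "\<And>k. k \<in> K \<Longrightarrow> d \<le> \<bar>k - x0\<bar>" by (rule gap) blast
  \<comment> \<open>The first bound is for the probability; the second because near-contact within
    \<open>2 * e\<close> yields a slope error \<open>2 * e / d\<close>.\<close>
  define e where "e = min \<epsilon> (\<epsilon> * d / 2)"
  have e: "0 < e" "e \<le> \<epsilon>" "2 * e / d \<le> \<epsilon>" using \<epsilon> d by (auto simp: e_def min_def field_simps)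
  obtain \<delta> R n1 where \<delta>: "0 < \<delta>" and R: "0 < R" and n1: "\<And>n. n1 \<le> n \<Longrightarrow> \<exists>B\<in>events. prob B \<le> e \<and> (\<forall>\<omega>\<in>space M - B.
       (\<forall>u\<ge>0. \<bar>emp_process n \<omega> u\<bar> \<le> R) \<and>
       (\<forall>u\<ge>0. \<forall>v\<ge>0. \<bar>F u - F v\<bar> \<le> \<delta> \<longrightarrow> \<bar>emp_process n \<omega> u - emp_process n \<omega> v\<bar> \<le> e))"
    using emp_process_equicontinuous[OF e(1)] by metis
  define T where "T = R / d"
  have T: "0 < T" using R d by (simp add: T_def)
  have "uniformly_continuous_on {0..b + 1} F"
    by (intro compact_uniformly_continuous continuous_on_subset[OF F(6)]) auto
  then obtain \<eta>0 where \<eta>0: "0 < \<eta>0" "\<And>u v. u \<in> {0..b + 1} \<Longrightarrow> v \<in> {0..b + 1} \<Longrightarrow> \<bar>u - v\<bar> < \<eta>0 \<Longrightarrow> \<bar>F u - F v\<bar> < \<delta>"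
    using \<delta> unfolding uniformly_continuous_on_def dist_real_def by metis
  \<comment> \<open>From \<open>u\<close> to a net point there are two steps shorter than
    \<open>\<eta>\<close>, via a point of \<open>K\<close>. So \<open>2 * \<eta>\<close> must fit
    the modulus of \<open>F\<close>, keep \<open>u\<close> below \<open>b + 1\<close>, and change a
    line of slope at most \<open>T\<close> by no more than \<open>e\<close>.\<close>
  define \<eta> where "\<eta> = min (\<eta>0 / 2) (min (1 / 2) (e / (2 * T)))"
  have \<eta>: "0 < \<eta>" "2 * \<eta> \<le> \<eta>0" "2 * \<eta> \<le> 1" using \<eta>0 e T by (auto simp: \<eta>_def)
  have "\<eta> \<le> e / (2 * T)" by (simp add: \<eta>_def)
  then have \<eta>T: "T * (2 * \<eta>) \<le> e" using T by (simp add: field_simps)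
  show thesis
  proof (rule that[OF \<eta>(1)])
    fix S assume net: "fine_net \<eta> S"
    note sides = fine_net_sides[OF net]
    have S: "a \<in> S" "b \<in> S" "\<And>k. k \<in> K \<Longrightarrow> \<exists>k'\<in>S. \<bar>k - k'\<bar> < \<eta>" using net by (auto simp: fine_net_def)
    obtain r where r: "0 < r" "\<And>u. 0 \<le> u \<Longrightarrow> (\<And>k. k \<in> K \<Longrightarrow> \<eta> \<le> \<bar>u - k\<bar>) \<Longrightarrow> F u + r * (1 + u) \<le> c + s * u"
      by (rule separation[OF \<eta>(1)]) blast
    have "filterlim (\<lambda>n. sqrt (real n)) at_top sequentially"
      by (intro filterlim_compose[OF sqrt_at_top] filterlim_real_sequentially)
    \<comment> \<open>The weight \<open>sqrt n * r\<close> has to outweigh two values of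
      \<open>G\<close>, the term \<open>\<gamma> * b\<close> from the comparison with the net point
      \<open>b\<close>, and the growth \<open>T * u\<close>.\<close>
    then have "\<forall>\<^sub>F n in sequentially. (T + 2 * R + T * b) / r \<le> sqrt (real n)"
      by (simp add: filterlim_at_top)
    then show "\<forall>\<^sub>F n in sequentially. \<exists>B\<in>events. prob B \<le> \<epsilon> \<and>
      (\<forall>\<omega>\<in>space M - B. \<bar>sqrt n * (grenander X n \<omega> x0 - s) - minmax_slope S x0 (emp_process n \<omega>)\<bar> \<le> \<epsilon>)"
      using eventually_ge_at_top[of n1] eventually_gt_at_top[of 0]
    proof eventually_elim
      case (elim n)
      obtain B where B: "B \<in> events" "prob B \<le> e" "\<And>\<omega> u. \<omega> \<in> space M - B \<Longrightarrow> 0 \<le> u \<Longrightarrow> \<bar>emp_process n \<omega> u\<bar> \<le> R"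
         "\<And>\<omega> u v. \<omega> \<in> space M - B \<Longrightarrow> 0 \<le> u \<Longrightarrow> 0 \<le> v \<Longrightarrow> \<bar>F u - F v\<bar> \<le> \<delta> \<Longrightarrow> \<bar>emp_process n \<omega> u - emp_process n \<omega> v\<bar> \<le> e"
        using n1[OF elim(2)] by blast
      define q where "q = sqrt (real n)"
      have q: "0 < q" "T + 2 * R + T * b \<le> q * r" using elim r by (auto simp: q_def field_simps)
      have "\<bar>q * (grenander X n \<omega> x0 - s) - minmax_slope S x0 (emp_process n \<omega>)\<bar> \<le> \<epsilon>"
        if \<omega>: "\<omega> \<in> space M - B" for \<omega>
      proof -
        define G where "G = emp_process n \<omega>"
        define \<gamma> where "\<gamma> = minmax_slope S x0 G"
        have GR: "\<bar>G u\<bar> \<le> R" if "0 \<le> u" for u using B(3)[OF \<omega> that] by (simp add: G_def)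
        have \<gamma>T: "\<bar>\<gamma>\<bar> \<le> T" unfolding \<gamma>_def T_def
          using sides d GR K_bounds by (intro abs_minmax_slope_le) auto
        obtain u0 v0 where uv: "u0 \<in> S" "u0 < x0" "v0 \<in> S" "x0 < v0" "G v0 - \<gamma> * v0 = G u0 - \<gamma> * u0"
          and top: "\<And>k. k \<in> S \<Longrightarrow> G k - \<gamma> * k \<le> G u0 - \<gamma> * u0"
          unfolding \<gamma>_def using minmax_slope_touches[OF sides(1-4), of G] by metis
        define m where "m = G u0 - \<gamma> * u0"
        have Fn_eq: "Fn n \<omega> u = F u + G u / q" for u
          using q by (simp add: G_def emp_process_def q_def)
        \<comment> \<open>Near \<open>K\<close> the drift is at most \<open>0\<close> and
          equicontinuity compares with a net point; elsewhere the drift is so negative that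
          comparison with the end \<open>b\<close> suffices.\<close>
        have main: "q * (F u - (c + s * u)) + G u - \<gamma> * u \<le> m + 2 * e" if u: "0 \<le> u" for u
        proof (cases "\<exists>k\<in>K. \<bar>u - k\<bar> < \<eta>")
          case True
          then obtain k where k: "k \<in> K" "\<bar>u - k\<bar> < \<eta>" by auto
          obtain k' where k': "k' \<in> S" "\<bar>k - k'\<bar> < \<eta>" using S(3)[OF k(1)] by auto
          have uk: "\<bar>u - k'\<bar> < 2 * \<eta>" using k k' by linarith
          have kb: "0 \<le> k'" "k' \<le> b" using k' sides(5) K_bounds by auto
          have "u \<le> b + 1" using uk kb \<eta>(3) by linarith
          then have "\<bar>F u - F k'\<bar> < \<delta>" using uk kb u \<eta>(2) by (intro \<eta>0(2)) auto
          then have "\<bar>G u - G k'\<bar> \<le> e" unfolding G_def using B(4)[OF \<omega> u kb(1)] by simp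
          moreover have "q * (F u - (c + s * u)) \<le> 0" using below[OF u] q by (simp add: mult_le_0_iff)
          moreover have "\<gamma> * (k' - u) \<le> e"
          proof -
            have "\<gamma> * (k' - u) \<le> \<bar>\<gamma>\<bar> * \<bar>u - k'\<bar>" by (metis abs_ge_self abs_minus_commute abs_mult)
            also have "\<dots> \<le> T * (2 * \<eta>)" using \<gamma>T uk T by (intro mult_mono) auto
            finally show ?thesis using \<eta>T by simp
          qed
          moreover have "G k' - \<gamma> * k' \<le> m" using top[OF k'(1)] by (simp add: m_def)
          ultimately show ?thesis by (simp add: algebra_simps)
        next
          case False
          then have "F u + r * (1 + u) \<le> c + s * u" using u by (intro r(2)) (auto simp: not_less)
          then have "q * (F u - (c + s * u)) \<le> q * (- (r * (1 + u)))" using q by (intro mult_left_mono) auto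
          moreover have "(T + 2 * R + T * b) * (1 + u) \<le> (q * r) * (1 + u)" using q u by (intro mult_right_mono) auto
          moreover have "0 \<le> (2 * R + T * b) * u" using R T u order by (intro mult_nonneg_nonneg add_nonneg_nonneg) auto
          moreover have "- (\<gamma> * u) \<le> T * u" "\<gamma> * b \<le> T * b"
            using mult_right_mono[of "- \<gamma>" T u] mult_right_mono[of \<gamma> T b] \<gamma>T u order by auto
          moreover have "G u \<le> R" "- R \<le> G b" using GR[OF u] GR[of b] order by auto
          moreover have "G b - \<gamma> * b \<le> m" using top[OF S(2)] by (simp add: m_def)
          moreover have "(T + 2 * R + T * b) * (1 + u) = T + 2 * R + T * b + T * u + (2 * R + T * b) * u"
            by (simp add: algebra_simps)
          moreover have "q * (- (r * (1 + u))) = - ((q * r) * (1 + u))" by simp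
          ultimately show ?thesis using e T by linarith
        qed
        have line: "Fn n \<omega> u \<le> (c + (m + 2 * e) / q) + (s + \<gamma> / q) * u" if u: "0 \<le> u" for u
        proof -
          have "(q * (F u - (c + s * u)) + (G u - \<gamma> * u)) / q \<le> (m + 2 * e) / q"
            using main[OF u] q by (intro divide_right_mono) auto
          moreover have "(q * (F u - (c + s * u)) + (G u - \<gamma> * u)) / q = F u - (c + s * u) + (G u / q - \<gamma> / q * u)"
            using q by (simp add: add_divide_distrib diff_divide_distrib)
          moreover have "(s + \<gamma> / q) * u = s * u + \<gamma> / q * u" by (rule distrib_right)
          ultimately show ?thesis unfolding Fn_eq by linarith
        qed
        have touch: "Fn n \<omega> k = (c + (m + 2 * e) / q) + (s + \<gamma> / q) * k - 2 * e / q"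
          if k: "k \<in> S" "G k - \<gamma> * k = m" for k
        proof -
          have "F k = c + s * k" using K_line sides(5) k by auto
          moreover have "G k / q = m / q + \<gamma> / q * k"
            using k(2) by (simp add: add_divide_distrib[symmetric] algebra_simps)
          ultimately show ?thesis by (simp add: Fn_eq add_divide_distrib algebra_simps)
        qed
        have "\<bar>gren {0..} (\<lambda>u. ereal (Fn n \<omega> u)) x0 - (s + \<gamma> / q)\<bar> \<le> (2 * e / q) / d"
        proof (rule gren_near_slope[where u = u0 and v = v0 and \<alpha> = "c + (m + 2 * e) / q"])
          show "least_concave_majorant {0..} (\<lambda>u. ereal (Fn n \<omega> u)) \<in> concave_majorants {0..} (\<lambda>u. ereal (Fn n \<omega> u))"
            by (rule emp_lcm_majorant)
          show "bdd_below ((\<lambda>h. h x0) ` concave_majorants {0..} (\<lambda>u. ereal (Fn n \<omega> u)))"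
            using order by (intro emp_lcm_majorant) auto
          show "x0 \<in> interior {0..}" using order by (simp add: interior_real_atLeast)
          show "u0 \<in> {0..}" "v0 \<in> {0..}" using uv sides(5) K_bounds by auto
          show "u0 + d \<le> x0" "x0 + d \<le> v0" using d(2)[of u0] d(2)[of v0] uv sides(5) by auto
          show "ereal (Fn n \<omega> w) \<le> ereal (c + (m + 2 * e) / q + (s + \<gamma> / q) * w)" if "w \<in> {0..}" for w
            using line[of w] that by simp
          show "ereal (c + (m + 2 * e) / q + (s + \<gamma> / q) * u0 - 2 * e / q) \<le> ereal (Fn n \<omega> u0)"
            using touch[OF uv(1)] by (simp add: m_def)
          show "ereal (c + (m + 2 * e) / q + (s + \<gamma> / q) * v0 - 2 * e / q) \<le> ereal (Fn n \<omega> v0)"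
            using touch[OF uv(3)] uv(5) by (simp add: m_def)
        qed (rule d)
        then have "q * \<bar>grenander X n \<omega> x0 - (s + \<gamma> / q)\<bar> \<le> q * ((2 * e / q) / d)"
          using q by (intro mult_left_mono) (auto simp: grenander_def)
        also have "\<dots> = 2 * e / d" using q by simp
        also have "\<dots> \<le> \<epsilon>" by (rule e)
        finally have "q * \<bar>grenander X n \<omega> x0 - (s + \<gamma> / q)\<bar> \<le> \<epsilon>" .
        moreover have "q * \<bar>grenander X n \<omega> x0 - (s + \<gamma> / q)\<bar> = \<bar>q * (grenander X n \<omega> x0 - (s + \<gamma> / q))\<bar>"
          using q by (simp add: abs_mult)
        moreover have "q * (grenander X n \<omega> x0 - (s + \<gamma> / q)) = q * (grenander X n \<omega> x0 - s) - \<gamma>"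
          using q by (simp add: algebra_simps)
        ultimately show ?thesis by (simp add: \<gamma>_def G_def)
      qed
      then show ?case using B(1,2) e(2) unfolding q_def by (intro bexI[of _ B]) auto
    qed
  qed
qed

text \<open>The comparison of \<open>emp_slope_approx\<close> for a single path: uniform continuity
  on the compact set \<open>K\<close> takes the place of equicontinuity, and off \<open>K\<close>
  the value \<open>-\<infinity>\<close> that of the penalty. The mesh depends on the path.\<close>

lemma bridge_slope_approx:
  assumes bridge: "standard_brownian_bridge N U" and \<omega>: "\<omega> \<in> space N" and \<epsilon>: "0 < \<epsilon>"
  obtains \<eta> where "0 < \<eta>" "\<And>S. fine_net \<eta> S \<Longrightarrow>
    \<bar>gren {a..b} (mod_bridge f0 U \<omega>) x0 - minmax_slope S x0 (\<lambda>u. U (F u) \<omega>)\<bar> \<le> \<epsilon>"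
proof -
  obtain d where d: "0 < d" "\<And>k. k \<in> K \<Longrightarrow> d \<le> \<bar>k - x0\<bar>" by (rule gap) blast
  define p where "p u = U (F u) \<omega>" for u
  have "continuous_on {0..1} (\<lambda>t. U t \<omega>)" using bridge \<omega> by (simp add: standard_brownian_bridge_def)
  then have p_cont: "continuous_on K p"
    unfolding p_def using F(2,3) by (intro continuous_on_compose2[of "{0..1}" "\<lambda>t. U t \<omega>" K F] continuous_on_subset[OF F(6)]) auto
  then have uc: "uniformly_continuous_on K p" using compact_K by (rule compact_uniformly_continuous)
  have "bounded (p ` K)" using compact_continuous_image[OF p_cont compact_K] by (rule compact_imp_bounded)
  then obtain R where R: "0 < R" "\<And>k. k \<in> K \<Longrightarrow> \<bar>p k\<bar> \<le> R" unfolding bounded_pos by auto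
  define e where "e = \<epsilon> * d / 2"
  have e: "0 < e" "2 * e / d = \<epsilon>" using \<epsilon> d by (auto simp: e_def)
  define T where "T = R / d"
  have T: "0 < T" using R d by (simp add: T_def)
  obtain \<eta>0 where \<eta>0: "0 < \<eta>0" "\<And>u v. u \<in> K \<Longrightarrow> v \<in> K \<Longrightarrow> \<bar>u - v\<bar> < \<eta>0 \<Longrightarrow> \<bar>p u - p v\<bar> < e"
    using uc e(1) unfolding uniformly_continuous_on_def dist_real_def by metis
  define \<eta> where "\<eta> = min \<eta>0 (e / T)"
  have \<eta>: "0 < \<eta>" using \<eta>0 e T by (auto simp: \<eta>_def)
  have "\<eta> \<le> e / T" by (simp add: \<eta>_def)
  then have \<eta>T: "T * \<eta> \<le> e" using T by (simp add: field_simps)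
  show thesis
  proof (rule that[OF \<eta>])
    fix S assume net: "fine_net \<eta> S"
    note sides = fine_net_sides[OF net]
    define \<gamma> where "\<gamma> = minmax_slope S x0 p"
    have \<gamma>T: "\<bar>\<gamma>\<bar> \<le> T" unfolding \<gamma>_def T_def
      using sides d R by (intro abs_minmax_slope_le) auto
    obtain u0 v0 where uv: "u0 \<in> S" "u0 < x0" "v0 \<in> S" "x0 < v0" "p v0 - \<gamma> * v0 = p u0 - \<gamma> * u0"
      and top: "\<And>k. k \<in> S \<Longrightarrow> p k - \<gamma> * k \<le> p u0 - \<gamma> * u0"
      unfolding \<gamma>_def using minmax_slope_touches[OF sides(1-4), of p] by metis
    define m where "m = p u0 - \<gamma> * u0"
    have main: "p w \<le> (m + 2 * e) + \<gamma> * w" if w: "w \<in> K" for w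
    proof -
      obtain k where k: "k \<in> S" "\<bar>w - k\<bar> < \<eta>" using net w by (auto simp: fine_net_def)
      have "\<bar>p w - p k\<bar> < e" using k sides(5) w by (intro \<eta>0(2)) (auto simp: \<eta>_def)
      moreover have "\<gamma> * (k - w) \<le> e"
      proof -
        have "\<gamma> * (k - w) \<le> \<bar>\<gamma>\<bar> * \<bar>w - k\<bar>" by (metis abs_ge_self abs_minus_commute abs_mult)
        also have "\<dots> \<le> T * \<eta>" using \<gamma>T k T by (intro mult_mono) auto
        finally show ?thesis using \<eta>T by simp
      qed
      ultimately show ?thesis using top[OF k(1)] by (simp add: m_def algebra_simps)
    qed
    let ?g = "mod_bridge f0 U \<omega>"
    have gK: "?g w = ereal (p w)" if "w \<in> K" for w using that by (simp add: mod_bridge_def K_def p_def)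
    have maj: "?g w \<le> ereal (m + 2 * e + \<gamma> * w)" if "w \<in> {a..b}" for w
      using main[of w] gK[of w] that by (cases "w \<in> K") (auto simp: mod_bridge_def K_def)
    have bdd: "bdd_below ((\<lambda>h. h x) ` concave_majorants {a..b} ?g)" if "x \<in> {a..b}" for x
      using that order gK[OF ends_K(1)] gK[OF ends_K(2)] by (intro bdd_below_concave_majorants[of a _ b]) auto
    have "(\<lambda>w. m + 2 * e + \<gamma> * w) \<in> concave_majorants {a..b} ?g"
      using maj by (auto simp: concave_majorants_def affine_concave_on)
    then have ne: "concave_majorants {a..b} ?g \<noteq> {}" by auto
    have uvK: "u0 \<in> K" "v0 \<in> K" using uv sides(5) by auto
    have "\<bar>gren {a..b} ?g x0 - \<gamma>\<bar> \<le> (2 * e) / d"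
    proof (rule gren_near_slope[where u = u0 and v = v0 and \<alpha> = "m + 2 * e"])
      show "least_concave_majorant {a..b} ?g \<in> concave_majorants {a..b} ?g"
        using ne bdd by (rule least_concave_majorant_in_concave_majorants)
      show "bdd_below ((\<lambda>h. h x0) ` concave_majorants {a..b} ?g)" using order by (intro bdd) auto
      show "x0 \<in> interior {a..b}" using order by simp
      show "u0 \<in> {a..b}" "v0 \<in> {a..b}" using uvK by (auto simp: K_def)
      show "u0 + d \<le> x0" "x0 + d \<le> v0" using d(2)[of u0] d(2)[of v0] uv uvK by auto
      show "ereal (m + 2 * e + \<gamma> * u0 - 2 * e) \<le> ?g u0" using gK[OF uvK(1)] by (simp add: m_def)
      show "ereal (m + 2 * e + \<gamma> * v0 - 2 * e) \<le> ?g v0" using gK[OF uvK(2)] uv(5) by (simp add: m_def)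
    qed (use maj d in auto)
    then show "\<bar>gren {a..b} ?g x0 - minmax_slope S x0 (\<lambda>u. U (F u) \<omega>)\<bar> \<le> \<epsilon>"
      by (simp add: \<gamma>_def p_def[abs_def] e(2))
  qed
qed

lemma scaled_grenander_measurable:
  "(\<lambda>\<omega>. sqrt (real n) * (grenander X n \<omega> x0 - proj_density f0 x0)) \<in> borel_measurable M"
  using grenander_measurable[of x0 n] order by simp

lemma emp_slope_measurable:
  assumes "finite S"
  shows "(\<lambda>\<omega>. minmax_slope S x0 (emp_process n \<omega>)) \<in> borel_measurable M"
proof (rule measurable_minmax_slope[OF assms])
  show "(\<lambda>\<omega>. emp_process n \<omega> k) \<in> borel_measurable M" for k
    unfolding emp_process_eq emp_sum_def by measurable
qed

text \<open>Along a fixed sequence of ever finer nets the finite slopes converge for every path,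
  although the mesh required varies with the path. This gives measurability of the limit and, by
  dominated convergence, closeness of the integrals. The mesh required on the sample side is
  deterministic, so these nets meet it eventually.\<close>

lemma weak_conv_bridge:
  assumes bridge: "standard_brownian_bridge N U"
  shows "weak_conv_m
    (\<lambda>n. distr M borel (\<lambda>\<omega>. sqrt (real n) * (grenander X n \<omega> x0 - proj_density f0 x0)))
    (distr N borel (\<lambda>\<omega>. gren {a..b} (mod_bridge f0 U \<omega>) x0))"
proof -
  have N: "prob_space N" using bridge by (simp add: standard_brownian_bridge_def)
  interpret N: prob_space N by (rule N)
  define D where "D \<omega> = gren {a..b} (mod_bridge f0 U \<omega>) x0" for \<omega>
  define S where "S k = (SOME S. fine_net (1 / real (Suc k)) S)" for k
  have S: "fine_net (1 / real (Suc k)) (S k)" for k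
    unfolding S_def by (rule someI_ex, rule fine_net_exists) simp
  have finer: "fine_net \<eta> (S k)" if "1 / real (Suc k) \<le> \<eta>" for k \<eta>
    using S[of k] that unfolding fine_net_def by (meson order_less_le_trans)
  have ev_finer: "\<forall>\<^sub>F k in sequentially. fine_net \<eta> (S k)" if "0 < \<eta>" for \<eta>
  proof -
    have "\<forall>\<^sub>F k in sequentially. 1 / real (Suc k) < \<eta>"
      using order_tendstoD(2)[OF LIMSEQ_inverse_real_of_nat that] by (simp add: inverse_eq_divide)
    then show ?thesis by eventually_elim (use finer in auto)
  qed
  define Y where "Y k \<omega> = minmax_slope (S k) x0 (\<lambda>u. U (F u) \<omega>)" for k \<omega>
  have F01: "F u \<in> {0..1}" for u using F(2,3) by auto
  have U_meas: "U (F u) \<in> borel_measurable N" for u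
    using bridge F01[of u] by (auto simp: standard_brownian_bridge_def gaussian_process_def)
  have Y_meas: "Y k \<in> borel_measurable N" for k
    unfolding Y_def using fine_net_sides(1)[OF S] U_meas by (rule measurable_minmax_slope)
  have Y_lim: "(\<lambda>k. Y k \<omega>) \<longlonglongrightarrow> D \<omega>" if \<omega>: "\<omega> \<in> space N" for \<omega>
  proof (rule tendstoI)
    fix r :: real assume "0 < r"
    then have r2: "0 < r / 2" by simp
    obtain \<eta> where \<eta>: "0 < \<eta>" "\<And>S. fine_net \<eta> S \<Longrightarrow>
        \<bar>gren {a..b} (mod_bridge f0 U \<omega>) x0 - minmax_slope S x0 (\<lambda>u. U (F u) \<omega>)\<bar> \<le> r / 2"
      by (rule bridge_slope_approx[OF bridge \<omega> r2]) blast
    from ev_finer[OF \<eta>(1)] show "\<forall>\<^sub>F k in sequentially. dist (Y k \<omega>) (D \<omega>) < r"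
    proof eventually_elim
      case (elim k)
      from \<eta>(2)[OF this] \<open>0 < r\<close> show ?case by (simp add: Y_def D_def dist_real_def abs_minus_commute)
    qed
  qed
  have D_meas: "D \<in> borel_measurable N" using Y_lim Y_meas by (rule borel_measurable_LIMSEQ_real)
  show ?thesis
    unfolding D_def[symmetric]
  proof (rule weak_conv_m_approx[OF prob_space_axioms N scaled_grenander_measurable D_meas])
    fix \<psi> :: "real \<Rightarrow> real" and e :: real
    assume \<psi>: "continuous_on UNIV \<psi>" "\<And>x. \<bar>\<psi> x\<bar> \<le> 1" and e: "0 < e"
    have \<psi>m: "\<psi> \<in> borel_measurable borel" using \<psi>(1) by (rule borel_measurable_continuous_onI)
    have "(\<lambda>k. \<integral>\<omega>. \<psi> (Y k \<omega>) \<partial>N) \<longlonglongrightarrow> (\<integral>\<omega>. \<psi> (D \<omega>) \<partial>N)"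
    proof (rule integral_dominated_convergence[where w = "\<lambda>_. 1"])
      have "isCont \<psi> z" for z using \<psi>(1) by (simp add: continuous_on_eq_continuous_at)
      then show "AE \<omega> in N. (\<lambda>k. \<psi> (Y k \<omega>)) \<longlonglongrightarrow> \<psi> (D \<omega>)"
        using Y_lim by (intro AE_I2) (auto intro: isCont_tendsto_compose)
    qed (use \<psi>(2) measurable_compose[OF Y_meas \<psi>m] measurable_compose[OF D_meas \<psi>m] in auto)
    from tendstoD[OF this e]
    have close: "\<forall>\<^sub>F k in sequentially. \<bar>(\<integral>\<omega>. \<psi> (Y k \<omega>) \<partial>N) - (\<integral>\<omega>. \<psi> (D \<omega>) \<partial>N)\<bar> < e"
      by (simp add: dist_real_def)
    obtain \<eta> where \<eta>: "0 < \<eta>" "\<And>S. fine_net \<eta> S \<Longrightarrow>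
        \<forall>\<^sub>F n in sequentially. \<exists>B\<in>events. prob B \<le> e \<and>
        (\<forall>\<omega>\<in>space M - B. \<bar>sqrt n * (grenander X n \<omega> x0 - s) - minmax_slope S x0 (emp_process n \<omega>)\<bar> \<le> e)"
      by (rule emp_slope_approx[OF e]) blast
    \<comment> \<open>One net has to serve the bridge and the sample; both conditions hold for all
      large \<open>k\<close>.\<close>
    obtain k where k: "\<bar>(\<integral>\<omega>. \<psi> (Y k \<omega>) \<partial>N) - (\<integral>\<omega>. \<psi> (D \<omega>) \<partial>N)\<bar> < e" "fine_net \<eta> (S k)"
      using eventually_happens'[OF sequentially_bot eventually_conj[OF close ev_finer[OF \<eta>(1)]]] by blast
    note sides = fine_net_sides[OF k(2)]
    have lim: "(\<lambda>n. expectation (\<lambda>\<omega>. \<psi> (minmax_slope (S k) x0 (emp_process n \<omega>)))) \<longlonglongrightarrow>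
        (\<integral>\<omega>. \<psi> (minmax_slope (S k) x0 (\<lambda>u. U (F u) \<omega>)) \<partial>N)"
      using sides K_bounds inj_on_subset[OF inj_F_K sides(5)] \<psi>
      by (intro minmax_slope_emp_process_tendsto[OF _ _ _ _ _ bridge]) auto
    show "\<exists>Y y. (\<forall>n. Y n \<in> borel_measurable M) \<and> (\<lambda>n. \<integral>\<omega>. \<psi> (Y n \<omega>) \<partial>M) \<longlonglongrightarrow> y \<and>
        \<bar>y - (\<integral>\<omega>. \<psi> (D \<omega>) \<partial>N)\<bar> \<le> e \<and>
        (\<forall>\<^sub>F n in sequentially. \<exists>B\<in>sets M. measure M B \<le> e \<and>
           (\<forall>\<omega>\<in>space M - B. \<bar>sqrt (real n) * (grenander X n \<omega> x0 - proj_density f0 x0) - Y n \<omega>\<bar> \<le> e))"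
    proof (intro exI conjI allI)
      show "(\<lambda>\<omega>. minmax_slope (S k) x0 (emp_process n \<omega>)) \<in> borel_measurable M" for n
        using sides(1) by (rule emp_slope_measurable)
      show "(\<lambda>n. \<integral>\<omega>. \<psi> (minmax_slope (S k) x0 (emp_process n \<omega>)) \<partial>M) \<longlonglongrightarrow> (\<integral>\<omega>. \<psi> (Y k \<omega>) \<partial>N)"
        unfolding Y_def by (rule lim)
      show "\<bar>(\<integral>\<omega>. \<psi> (Y k \<omega>) \<partial>N) - (\<integral>\<omega>. \<psi> (D \<omega>) \<partial>N)\<bar> \<le> e" using k(1) by simp
    qed (use \<eta>(2)[OF k(2)] in \<open>simp add: proj_density_eq\<close>)
  qed
qed

text \<open>The net \<open>{a, b}\<close> is now fine for every mesh, and its slope is a difference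
  quotient. The variance is that of an indicator of probability \<open>p = s * (b - a)\<close>,
  namely \<open>p * (1 - p)\<close>, divided by \<open>(b - a)\<^sup>2\<close>.\<close>

lemma weak_conv_normal:
  assumes K: "K = {a, b}"
  defines "\<sigma> \<equiv> sqrt (s * (1 / (b - a) - s))"
  shows "weak_conv_m
    (\<lambda>n. distr M borel (\<lambda>\<omega>. sqrt (real n) * (grenander X n \<omega> x0 - proj_density f0 x0)))
    (distr std_normal_distribution borel (\<lambda>z. \<sigma> * z))"
proof -
  have ab: "a < b" "a \<noteq> b" using order by auto
  have N: "prob_space std_normal_distribution" using real_dist_normal_dist by (simp add: real_distribution_def)
  \<comment> \<open>The difference quotient is written as a sum with coefficients, the form in which
    \<open>emp_process_fdd\<close> applies.\<close>
  have slope: "minmax_slope {a, b} x0 h = (\<Sum>u\<in>{a, b}. (if u = a then - 1 / (b - a) else 1 / (b - a)) * h u)" for h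
  proof -
    have "{u \<in> {a, b}. u < x0} = {a}" "{v \<in> {a, b}. x0 < v} = {b}" using order by auto
    then have "minmax_slope {a, b} x0 h = (h b - h a) / (b - a)" by (simp add: minmax_slope_def)
    also have "\<dots> = (\<Sum>u\<in>{a, b}. (if u = a then - 1 / (b - a) else 1 / (b - a)) * h u)"
      using ab by (simp add: diff_divide_distrib)
    finally show ?thesis .
  qed
  have var: "(\<Sum>u\<in>{a, b}. \<Sum>w\<in>{a, b}. (if u = a then - 1 / (b - a) else 1 / (b - a)) *
      (if w = a then - 1 / (b - a) else 1 / (b - a)) * (min (F u) (F w) - F u * F w)) = s * (1 / (b - a) - s)"
  proof -
    have Fab: "F a = c + s * a" "F b = c + s * b" using K_line ends_K by auto
    have "F a \<le> F b" using ab by (intro monoD[OF F(1)]) auto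
    then have m: "min (F a) (F b) = F a" "min (F b) (F a) = F a" by auto
    define w where "w = 1 / (b - a)"
    have w: "- 1 / (b - a) = - w" "1 / (b - a) = w" by (simp_all add: w_def)
    have "(\<Sum>u\<in>{a, b}. \<Sum>v\<in>{a, b}. (if u = a then - w else w) *
      (if v = a then - w else w) * (min (F u) (F v) - F u * F v)) =
      w * w * ((F b - F a) * (1 - (F b - F a)))"
      using ab by (simp add: m algebra_simps)
    also have "F b - F a = s * (b - a)" by (simp add: Fab algebra_simps)
    also have "w * w * (s * (b - a) * (1 - s * (b - a))) = s * (w * (b - a)) * (w - s * (w * (b - a)))"
      by (simp add: algebra_simps)
    also have "w * (b - a) = 1" using ab by (simp add: w_def)
    finally show ?thesis unfolding w by simp
  qed
  show ?thesis
  proof (rule weak_conv_m_approx[OF prob_space_axioms N scaled_grenander_measurable])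
    fix \<psi> :: "real \<Rightarrow> real" and e :: real
    assume \<psi>: "continuous_on UNIV \<psi>" "\<And>x. \<bar>\<psi> x\<bar> \<le> 1" and e: "0 < e"
    obtain \<eta> where \<eta>: "0 < \<eta>" "\<And>S. fine_net \<eta> S \<Longrightarrow>
        \<forall>\<^sub>F n in sequentially. \<exists>B\<in>events. prob B \<le> e \<and>
        (\<forall>\<omega>\<in>space M - B. \<bar>sqrt n * (grenander X n \<omega> x0 - s) - minmax_slope S x0 (emp_process n \<omega>)\<bar> \<le> e)"
      by (rule emp_slope_approx[OF e]) blast
    have net: "fine_net \<eta> {a, b}" using \<eta>(1) by (auto simp: fine_net_def K)
    have \<psi>c: "isCont \<psi> z" for z using \<psi>(1) by (simp add: continuous_on_eq_continuous_at)
    have lim: "(\<lambda>n. expectation (\<lambda>\<omega>. \<psi> (minmax_slope {a, b} x0 (emp_process n \<omega>)))) \<longlonglongrightarrow>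
        (\<integral>z. \<psi> (\<sigma> * z) \<partial>std_normal_distribution)"
      unfolding slope \<sigma>_def var[symmetric] using \<psi>c \<psi>(2) by (intro emp_process_fdd(1)[where B = 1]) auto
    show "\<exists>Y y. (\<forall>n. Y n \<in> borel_measurable M) \<and> (\<lambda>n. \<integral>\<omega>. \<psi> (Y n \<omega>) \<partial>M) \<longlonglongrightarrow> y \<and>
        \<bar>y - (\<integral>z. \<psi> (\<sigma> * z) \<partial>std_normal_distribution)\<bar> \<le> e \<and>
        (\<forall>\<^sub>F n in sequentially. \<exists>B\<in>sets M. measure M B \<le> e \<and>
           (\<forall>\<omega>\<in>space M - B. \<bar>sqrt (real n) * (grenander X n \<omega> x0 - proj_density f0 x0) - Y n \<omega>\<bar> \<le> e))"
    proof (intro exI conjI allI)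
      show "(\<lambda>\<omega>. minmax_slope {a, b} x0 (emp_process n \<omega>)) \<in> borel_measurable M" for n
        by (rule emp_slope_measurable) simp
      show "(\<lambda>n. \<integral>\<omega>. \<psi> (minmax_slope {a, b} x0 (emp_process n \<omega>)) \<partial>M) \<longlonglongrightarrow>
        (\<integral>z. \<psi> (\<sigma> * z) \<partial>std_normal_distribution)" by (rule lim)
    qed (use \<eta>(2)[OF net] e in \<open>simp_all add: proj_density_eq\<close>)
  qed simp
qed

end

theorem theorem2p4:
  fixes M :: "'a measure" and X :: "nat \<Rightarrow> 'a \<Rightarrow> real"
    and f0 :: "real \<Rightarrow> real" and x0 a b :: real
  assumes "halfline_density f0"
    and "prob_space M"
    and "prob_space.indep_vars M (\<lambda>_. borel) X UNIV"
    and "\<And>i. distributed M lborel (X i) (\<lambda>x. ennreal (f0 x))"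
    and "x0 \<in> misspec_set f0"
    and "largest_linear_interval (distr_fun_lcm f0) x0 {a..b}"
  shows
    "(\<forall>(N :: 'b measure) U. standard_brownian_bridge N U \<longrightarrow>
        weak_conv_m
          (\<lambda>n. distr M borel
             (\<lambda>\<omega>. sqrt (real n) * (grenander X n \<omega> x0 - proj_density f0 x0)))
          (distr N borel (\<lambda>\<omega>. gren {a..b} (mod_bridge f0 U \<omega>) x0))) \<and>
     ({a..b} \<inter> wellspec_set f0 = {a, b} \<longrightarrow>
        (let \<sigma> = sqrt (proj_density f0 x0 * (1 / (b - a) - proj_density f0 x0)) in
          weak_conv_m
            (\<lambda>n. distr M borel
               (\<lambda>\<omega>. sqrt (real n) * (grenander X n \<omega> x0 - proj_density f0 x0)))
            (distr std_normal_distribution borel (\<lambda>z. \<sigma> * z))))"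
proof -
  interpret prob_space M by fact
  interpret density_sample M X f0 using assms by unfold_locales
  obtain c s where cs: "0 < s" "0 \<le> a" "a < x0" "x0 < b"
    "\<And>u. u \<in> {a..b} \<Longrightarrow> distr_fun_lcm f0 u = c + s * u"
    "\<And>u. 0 \<le> u \<Longrightarrow> distr_fun f0 u \<le> c + s * u"
    "\<And>u. 0 \<le> u \<Longrightarrow> distr_fun f0 u = c + s * u \<longleftrightarrow> u \<in> {a..b} \<inter> wellspec_set f0"
    "a \<in> wellspec_set f0" "b \<in> wellspec_set f0"
    using linear_piece[OF assms(1,5,6)] by metis
  have "x0 \<notin> wellspec_set f0" using assms(5) by (auto simp: misspec_set_def wellspec_set_def)
  with cs interpret touching_line M X f0 x0 a b c s by unfold_locales auto
  show ?thesis
    using weak_conv_bridge weak_conv_normal by (auto simp: Let_def proj_density_eq K_def)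
qed

end
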